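(* Let $N\ge2$, $R>0$, $p\ge2$, and let $f\in L^{r,\infty}(B_R)$ be non-negative and radially decreasing, with $$r>\frac{Np}{N(p-1)+(2-p)} .$$ If $u_p$ is a weak solution of $$-\mathrm{div}\left((|\nabla u_p|-1)_+^{p-1}\frac{\nabla u_p}{|\nabla u_p|}\right)=f\ \text{ in } B_R,\qquad u_p=0\ \text{ on }\partial B_R,$$ then $$(|\nabla u_p|-1)_+^{\frac p2}\,\frac{\nabla u_p}{|\nabla u_p|}\in W^{1,2}(B_R).$$
   Context: $B_R=\{x\in\mathbb{R}^N:|x|<R\}$ and $(\cdot)_+$ is the positive part. For $\alpha>0$ put $H_\alpha(\xi)=(|\xi|-1)_+^{\alpha}\frac{\xi}{|\xi|}$ if $\xi\in\mathbb{R}^N\setminus\{0\}$ and $H_\alpha(0)=0$ (so $(|\nabla u|-1)_+^{p/2}\nabla u/|\nabla u|$ means $H_{p/2}(\nabla u)$, equal to $0$ where $\nabla u=0$; it is $\mathbb{R}^N$-valued). Weak solution: $u\in W^{1,p}_0(B_R)$ is a weak solution of the Dirichlet problem if $\int_{B_R}\langle H_{p-1}(\nabla u),\nabla\varphi\rangle\,dx=\int_{B_R}f\varphi\,dx$ for all $\varphi\in C_0^\infty(B_R)$. Rearrangements: for measurable $f:B_R\to\mathbb{R}$, $\mu_f(\tau)=|\{x\in B_R:|f(x)|>\tau\}|$ for $\tau\ge0$; $f^*(\lambda)=\inf\{\tau\ge0:\mu_f(\tau)\le\lambda\}$ for $\lambda\ge0$; $f^{**}(t)=\frac1t\int_0^t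 f^*(s)\,ds$ for $t>0$. Lorentz space: for $1<r<\infty$, $L^{r,\infty}(B_R)$ is the set of measurable $f$ with $\|f\|_{L^{r,\infty}}=\sup_{0<t<\infty}t^{1/r}f^{**}(t)<\infty$. "Radially decreasing" means that $f(x)$ depends only on $|x|$ and is a non-increasing function of $|x|$. *)

theory Defs
  imports "HOL-Analysis.Analysis"
begin

section \<open>Test functions\<close>

primrec Ck :: "nat \<Rightarrow> ('a::euclidean_space \<Rightarrow> real) \<Rightarrow> bool" where
  "Ck 0 \<phi> \<longleftrightarrow> continuous_on UNIV \<phi>"
| "Ck (Suc k) \<phi> \<longleftrightarrow>
     (\<forall>x. \<phi> differentiable (at x)) \<and>
     (\<forall>b\<in>Basis. Ck k (\<lambda>x. frechet_derivative \<phi> (at x) b))"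

definition gradient :: "('a::euclidean_space \<Rightarrow> real) \<Rightarrow> 'a \<Rightarrow> 'a" where
  "gradient \<phi> x = (\<Sum>b\<in>Basis. frechet_derivative \<phi> (at x) b *\<^sub>R b)"

text \<open>Test functions on \<open>\<Omega>\<close> are represented by their extension by zero to the whole space.\<close>

definition test_functions :: "'a::euclidean_space set \<Rightarrow> ('a \<Rightarrow> real) set" where
  "test_functions \<Omega> =
     {\<phi>. (\<forall>k. Ck k \<phi>) \<and> compact (closure {x. \<phi> x \<noteq> 0}) \<and> closure {x. \<phi> x \<noteq> 0} \<subseteq> \<Omega>}"

section \<open>Lebesgue and Sobolev spaces\<close>

text \<open>
  Members of the function spaces below are functions rather than classes modulo null sets, defined
  on the whole space; every condition depends only on the restriction to \<open>\<Omega>\<close>, up to null sets.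
\<close>

definition Lp_space :: "'a::euclidean_space set \<Rightarrow> real \<Rightarrow> ('a \<Rightarrow> 'b::euclidean_space) set" where
  "Lp_space \<Omega> p =
     {u \<in> borel_measurable (lebesgue_on \<Omega>). integrable (lebesgue_on \<Omega>) (\<lambda>x. norm (u x) powr p)}"

definition L1_loc :: "'a::euclidean_space set \<Rightarrow> ('a \<Rightarrow> 'b::euclidean_space) set" where
  "L1_loc \<Omega> =
     {u \<in> borel_measurable (lebesgue_on \<Omega>). \<forall>K. compact K \<and> K \<subseteq> \<Omega> \<longrightarrow> integrable (lebesgue_on K) u}"

definition has_weak_partial ::
  "'a::euclidean_space set \<Rightarrow> 'a \<Rightarrow> ('a \<Rightarrow> 'b::euclidean_space) \<Rightarrow> ('a \<Rightarrow> 'b) \<Rightarrow> bool" where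
  "has_weak_partial \<Omega> b u v \<longleftrightarrow>
     u \<in> L1_loc \<Omega> \<and> v \<in> L1_loc \<Omega> \<and>
     (\<forall>\<phi>\<in>test_functions \<Omega>.
        (\<integral>x. frechet_derivative \<phi> (at x) b *\<^sub>R u x \<partial>lebesgue_on \<Omega>) =
        - (\<integral>x. \<phi> x *\<^sub>R v x \<partial>lebesgue_on \<Omega>))"

text \<open>For vector-valued \<open>u\<close> this is the space of functions all of whose components are in \<open>W\<^sup>1\<^sup>,\<^sup>p\<close>.\<close>

definition W1p :: "'a::euclidean_space set \<Rightarrow> real \<Rightarrow> ('a \<Rightarrow> 'b::euclidean_space) set" where
  "W1p \<Omega> p =
     {u \<in> Lp_space \<Omega> p. \<forall>b\<in>Basis. \<exists>v\<in>Lp_space \<Omega> p. has_weak_partial \<Omega> b u v}"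

definition has_weak_gradient ::
  "'a::euclidean_space set \<Rightarrow> ('a \<Rightarrow> real) \<Rightarrow> ('a \<Rightarrow> 'a) \<Rightarrow> bool" where
  "has_weak_gradient \<Omega> u G \<longleftrightarrow> (\<forall>b\<in>Basis. has_weak_partial \<Omega> b u (\<lambda>x. G x \<bullet> b))"

text \<open>A weak gradient is unique up to null sets; this picks one representative.\<close>

definition weak_gradient :: "'a::euclidean_space set \<Rightarrow> ('a \<Rightarrow> real) \<Rightarrow> 'a \<Rightarrow> 'a" where
  "weak_gradient \<Omega> u = (SOME G. has_weak_gradient \<Omega> u G)"

text \<open>The closure of the test functions in the norm of \<open>W\<^sup>1\<^sup>,\<^sup>p\<close>.\<close>

definition W1p_0 :: "'a::euclidean_space set \<Rightarrow> real \<Rightarrow> ('a \<Rightarrow> real) set" where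
  "W1p_0 \<Omega> p =
     {u \<in> W1p \<Omega> p. \<exists>\<phi>. (\<forall>k. \<phi> k \<in> test_functions \<Omega>) \<and>
        (\<lambda>k. \<integral>x. \<bar>u x - \<phi> k x\<bar> powr p \<partial>lebesgue_on \<Omega>) \<longlonglongrightarrow> 0 \<and>
        (\<lambda>k. \<integral>x. norm (weak_gradient \<Omega> u x - gradient (\<phi> k) x) powr p \<partial>lebesgue_on \<Omega>) \<longlonglongrightarrow> 0}"

section \<open>The degenerate operator\<close>

definition H :: "real \<Rightarrow> 'a::euclidean_space \<Rightarrow> 'a" where
  "H \<alpha> \<xi> = (if \<xi> = 0 then 0 else (max 0 (norm \<xi> - 1) powr \<alpha>) *\<^sub>R (\<xi> /\<^sub>R norm \<xi>))"

definition weak_solution ::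
  "real \<Rightarrow> real \<Rightarrow> ('a::euclidean_space \<Rightarrow> real) \<Rightarrow> ('a \<Rightarrow> real) \<Rightarrow> bool" where
  "weak_solution R p f u \<longleftrightarrow>
     u \<in> W1p_0 (ball 0 R) p \<and>
     (\<forall>\<phi>\<in>test_functions (ball 0 R).
        (\<integral>x. H (p - 1) (weak_gradient (ball 0 R) u x) \<bullet> gradient \<phi> x \<partial>lebesgue_on (ball 0 R)) =
        (\<integral>x. f x * \<phi> x \<partial>lebesgue_on (ball 0 R)))"

section \<open>Rearrangements and Lorentz spaces\<close>

text \<open>
  Values in \<open>ennreal\<close>: \<open>f\<^sup>*(0) = \<infinity>\<close> when \<open>f\<close> is unbounded, and the integral in \<open>f\<^sup>*\<^sup>*\<close> may diverge.
\<close>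

definition distr_fun :: "'a::euclidean_space set \<Rightarrow> ('a \<Rightarrow> real) \<Rightarrow> real \<Rightarrow> ennreal" where
  "distr_fun \<Omega> f \<tau> = emeasure lebesgue {x\<in>\<Omega>. \<bar>f x\<bar> > \<tau>}"

definition rearr :: "'a::euclidean_space set \<Rightarrow> ('a \<Rightarrow> real) \<Rightarrow> real \<Rightarrow> ennreal" where
  "rearr \<Omega> f l = (INF \<tau>\<in>{\<tau>. 0 \<le> \<tau> \<and> distr_fun \<Omega> f \<tau> \<le> ennreal l}. ennreal \<tau>)"

definition max_rearr :: "'a::euclidean_space set \<Rightarrow> ('a \<Rightarrow> real) \<Rightarrow> real \<Rightarrow> ennreal" where
  "max_rearr \<Omega> f t = ennreal (1 / t) * (\<integral>\<^sup>+ s\<in>{0..t}. rearr \<Omega> f s \<partial>lborel)"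

definition lorentz_weak_norm :: "'a::euclidean_space set \<Rightarrow> real \<Rightarrow> ('a \<Rightarrow> real) \<Rightarrow> ennreal" where
  "lorentz_weak_norm \<Omega> r f = (SUP t\<in>{0<..}. ennreal (t powr (1 / r)) * max_rearr \<Omega> f t)"

definition lorentz_weak :: "'a::euclidean_space set \<Rightarrow> real \<Rightarrow> ('a \<Rightarrow> real) set" where
  "lorentz_weak \<Omega> r =
     {f \<in> borel_measurable (lebesgue_on \<Omega>). lorentz_weak_norm \<Omega> r f < \<infinity>}"

text \<open>
  As for any element of a Lorentz space, this is a condition modulo null sets. Demanding it at every
  point, including the origin, would force the real-valued \<open>f\<close> to be bounded by \<open>f 0\<close> and
  so exclude functions such as \<open>x \<mapsto> norm x powr (- a)\<close> with \<open>a > 0\<close>.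
\<close>

definition radially_decreasing :: "real \<Rightarrow> ('a::euclidean_space \<Rightarrow> real) \<Rightarrow> bool" where
  "radially_decreasing R f \<longleftrightarrow>
     (\<exists>g. antimono_on {0<..<R} g \<and> (AE x in lebesgue_on (ball 0 R). f x = g (norm x)))"

end

theory Submission
  imports Defs "HOL-Real_Asymp.Real_Asymp"
begin

text \<open>
  The flux of a weak solution is determined by \<open>f\<close>, although the solution need not be unique.
  Writing \<open>f(x) = g(|x|)\<close>, the radial field \<open>F\<close> with \<open>F(x) = - h(|x|) x / |x|\<close> and
  \<open>h(\<rho>) = \<rho>\<^sup>1\<^sup>-\<^sup>N \<integral>\<^sub>0\<^sup>\<rho> g(s) s\<^sup>N\<^sup>-\<^sup>1 ds\<close> satisfies \<open>- div F = f\<close>, and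
  \<open>F = H\<^sub>p\<^sub>-\<^sub>1(V)\<close> for the radial field \<open>V(x) = - (1 + h(|x|)\<^sup>1\<^sup>/\<^sup>(\<^sup>p\<^sup>-\<^sup>1\<^sup>)) x / |x|\<close>. Hence
  \<open>H\<^sub>p\<^sub>-\<^sub>1(\<nabla>u) - F\<close> is orthogonal to gradients of test functions, thus to \<open>\<nabla>u\<close> and, by approximation
  with radial test functions, to \<open>V\<close>. Monotonicity of \<open>H\<^sub>p\<^sub>-\<^sub>1\<close> gives \<open>H\<^sub>p\<^sub>-\<^sub>1(\<nabla>u) = F\<close>, so
  \<open>H\<^sub>p\<^sub>/\<^sub>2(\<nabla>u) = - h(|x|)\<^sup>q\<^sup>/\<^sup>2 x / |x|\<close> with \<open>q = p / (p - 1)\<close>. As \<open>g\<close> decreases,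
  \<open>\<rho> g(\<rho>) \<le> N h(\<rho>)\<close>, which bounds the derivative of this field by a multiple of \<open>h\<^sup>q\<^sup>/\<^sup>2 / |x|\<close>; the
  Lorentz norm gives \<open>h(\<rho>) \<le> K \<rho>\<^sup>1\<^sup>-\<^sup>N\<^sup>/\<^sup>r\<close>, and the condition on \<open>r\<close> says exactly that
  \<open>|x|\<close> to the power \<open>q (1 - N / r) - 2\<close> is integrable near the origin.
\<close>

section \<open>Smooth functions\<close>

text \<open>\<open>H\<close> vanishes on the whole closed unit ball, so the equation carries no
  information about the gradient there and differentiating it is of little use; this is why two
  fluxes are compared instead. The zero boundary condition enters only through the approximation of
  the gradient of \<open>u\<close> by gradients of test functions. The field V is not exhibited as a
  weak gradient: its orthogonality relation comes from explicit smooth radial potentials. Two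
  defects of smoothness shape the calculus. First, g is merely monotone, so h is differentiable only
  off a countable, possibly dense, set of radii; weak derivatives are therefore obtained from a
  fundamental theorem of calculus that tolerates countably many exceptional points. Second, the
  power q / 2 is not differentiable at 0 when p > 2; this does no harm, because h is either positive
  at all positive radii or zero at all of them. The hypothesis p \<ge> 2 appears as q \<le> 2. The
  summand -2 in the critical exponent comes from squaring the factor 1 / |x| in the bound for the
  derivative.\<close>

abbreviation smooth :: "('a::euclidean_space \<Rightarrow> real) \<Rightarrow> bool" where
  "smooth \<phi> \<equiv> \<forall>k. Ck k \<phi>"

text \<open>The recursion for \<open>Ck\<close> tests one derivative and passes to the partials.
  Induction on the order, with the function left arbitrary, therefore needs only a family of
  differentiable functions that is stable under partial derivatives.\<close>

lemma smooth_coinduct: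
  assumes "\<phi> \<in> X"
    and diff: "\<And>\<phi> x. \<phi> \<in> X \<Longrightarrow> \<phi> differentiable (at x)"
    and step: "\<And>\<phi> b. \<phi> \<in> X \<Longrightarrow> b \<in> Basis \<Longrightarrow> (\<lambda>x. frechet_derivative \<phi> (at x) b) \<in> X"
  shows "smooth \<phi>"
proof
  fix k
  show "Ck k \<phi>" using assms(1)
  proof (induction k arbitrary: \<phi>)
    case 0
    then show ?case
      using diff by (auto intro!: continuous_at_imp_continuous_on differentiable_imp_continuous_within)
  next
    case (Suc k)
    then show ?case using diff step by auto
  qed
qed

lemma smooth_differentiable: "smooth \<phi> \<Longrightarrow> \<phi> differentiable (at x)"
  by (metis Ck.simps(2))

lemma smooth_partial: "smooth \<phi> \<Longrightarrow> b \<in> Basis \<Longrightarrow> smooth (\<lambda>x. frechet_derivative \<phi> (at x) b)"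
  by (metis Ck.simps(2))

lemma smooth_continuous_on: "smooth \<phi> \<Longrightarrow> continuous_on S \<phi>"
  by (metis Ck.simps(1) continuous_on_subset subset_UNIV)

text \<open>Differentiation turns products and composites into sums of products, so no single
  operation yields a family stable under partial derivatives. Closing under all of them at once
  does, as \<open>smooth_coinduct\<close> requires.\<close>

inductive_set smooth_closure :: "('a::euclidean_space \<Rightarrow> real) set" where
  base: "smooth \<phi> \<Longrightarrow> \<phi> \<in> smooth_closure"
| const: "(\<lambda>x. c) \<in> smooth_closure"
| coord: "(\<lambda>x. x \<bullet> v) \<in> smooth_closure"
| add: "\<phi> \<in> smooth_closure \<Longrightarrow> \<psi> \<in> smooth_closure \<Longrightarrow> (\<lambda>x. \<phi> x + \<psi> x) \<in> smooth_closure"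
| mult: "\<phi> \<in> smooth_closure \<Longrightarrow> \<psi> \<in> smooth_closure \<Longrightarrow> (\<lambda>x. \<phi> x * \<psi> x) \<in> smooth_closure"
| comp: "smooth \<theta> \<Longrightarrow> \<phi> \<in> smooth_closure \<Longrightarrow> (\<lambda>x. \<theta> (\<phi> x :: real)) \<in> smooth_closure"

lemma smooth_closure_derivative:
  fixes \<phi> :: "'a::euclidean_space \<Rightarrow> real"
  assumes "\<phi> \<in> smooth_closure"
  shows "\<exists>D. (\<forall>x. (\<phi> has_derivative D x) (at x)) \<and> (\<forall>b\<in>Basis. (\<lambda>x. D x b) \<in> smooth_closure)"
  using assms
proof induction
  case (base \<phi>)
  then have "\<forall>x. (\<phi> has_derivative frechet_derivative \<phi> (at x)) (at x)"
    using smooth_differentiable frechet_derivative_works by blast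
  moreover have "\<forall>b\<in>Basis. (\<lambda>x. frechet_derivative \<phi> (at x) b) \<in> smooth_closure"
    using base smooth_partial smooth_closure.base by blast
  ultimately show ?case by (intro exI[of _ "\<lambda>x. frechet_derivative \<phi> (at x)"]) simp
next
  case (const c)
  show ?case
    by (rule exI[of _ "\<lambda>x y. 0"]) (auto intro: smooth_closure.const)
next
  case (coord v)
  show ?case
    by (rule exI[of _ "\<lambda>x y. y \<bullet> v"]) (auto intro!: smooth_closure.const derivative_eq_intros)
next
  case (add \<phi> \<psi>)
  then obtain D D' where
    "\<forall>x. (\<phi> has_derivative D x) (at x)" "\<forall>b\<in>Basis. (\<lambda>x. D x b) \<in> smooth_closure"
    "\<forall>x. (\<psi> has_derivative D' x) (at x)" "\<forall>b\<in>Basis. (\<lambda>x. D' x b) \<in> smooth_closure"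
    by blast
  then show ?case
    by (intro exI[of _ "\<lambda>x y. D x y + D' x y"])
      (auto intro!: smooth_closure.add has_derivative_add)
next
  case (mult \<phi> \<psi>)
  then obtain D D' where
    "\<forall>x. (\<phi> has_derivative D x) (at x)" "\<forall>b\<in>Basis. (\<lambda>x. D x b) \<in> smooth_closure"
    "\<forall>x. (\<psi> has_derivative D' x) (at x)" "\<forall>b\<in>Basis. (\<lambda>x. D' x b) \<in> smooth_closure"
    by blast
  then show ?case using mult.hyps
    by (intro exI[of _ "\<lambda>x y. \<phi> x * D' x y + D x y * \<psi> x"])
      (auto intro!: smooth_closure.add smooth_closure.mult has_derivative_mult)
next
  case (comp \<theta> \<phi>)
  then obtain D where
    D: "\<forall>x. (\<phi> has_derivative D x) (at x)" "\<forall>b\<in>Basis. (\<lambda>x. D x b) \<in> smooth_closure"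
    by blast
  let ?d = "\<lambda>t. frechet_derivative \<theta> (at t) 1"
  have d: "(\<theta> has_real_derivative ?d t) (at t)" for t
  proof -
    have 1: "(\<theta> has_derivative frechet_derivative \<theta> (at t)) (at t)"
      using comp.hyps smooth_differentiable frechet_derivative_works by blast
    have "frechet_derivative \<theta> (at t) = (\<lambda>y. frechet_derivative \<theta> (at t) 1 * y)"
    proof
      fix y
      show "frechet_derivative \<theta> (at t) y = frechet_derivative \<theta> (at t) 1 * y"
        using linear_scale[OF has_derivative_linear[OF 1], of y 1] by (simp add: mult.commute)
    qed
    then show ?thesis using 1 unfolding has_field_derivative_def by simp
  qed
  have "smooth ?d" using comp.hyps(1) by (intro smooth_partial) auto
  then have "(\<lambda>x. ?d (\<phi> x)) \<in> smooth_closure"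
    using comp.hyps smooth_closure.comp by blast
  moreover have "((\<lambda>x. \<theta> (\<phi> x)) has_derivative (\<lambda>y. ?d (\<phi> x) * D x y)) (at x)" for x
    using has_derivative_compose[OF D(1)[rule_format] d[unfolded has_field_derivative_def]]
    by simp
  ultimately show ?case using D
    by (intro exI[of _ "\<lambda>x y. ?d (\<phi> x) * D x y"]) (auto intro!: smooth_closure.mult)
qed

lemma smooth_closure_smooth: "\<phi> \<in> smooth_closure \<Longrightarrow> smooth \<phi>"
proof (rule smooth_coinduct[where X = smooth_closure])
  fix \<phi> :: "'a \<Rightarrow> real" and x
  assume "\<phi> \<in> smooth_closure"
  from smooth_closure_derivative[OF this] obtain D where
    D: "\<And>x. (\<phi> has_derivative D x) (at x)" "\<And>b. b \<in> Basis \<Longrightarrow> (\<lambda>x. D x b) \<in> smooth_closure"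
    by blast
  then show "\<phi> differentiable (at x)" by (blast intro: differentiableI)
  have "frechet_derivative \<phi> (at x) = D x" for x
    using D(1) by (metis frechet_derivative_at)
  then show "(\<lambda>x. frechet_derivative \<phi> (at x) b) \<in> smooth_closure" if "b \<in> Basis" for b
    using D(2) that by simp
qed 

lemma smooth_const: "smooth (\<lambda>x. c)"
  by (rule smooth_closure_smooth) (rule smooth_closure.const)

lemma smooth_inner: "smooth (\<lambda>x. x \<bullet> v)"
  by (rule smooth_closure_smooth) (rule smooth_closure.coord)

lemma smooth_ident: "smooth (\<lambda>x::real. x)"
  using smooth_inner[of "1::real"] by simp

lemma smooth_add: "smooth \<phi> \<Longrightarrow> smooth \<psi> \<Longrightarrow> smooth (\<lambda>x. \<phi> x + \<psi> x)"
  by (rule smooth_closure_smooth) (intro smooth_closure.add smooth_closure.base)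

lemma smooth_mult: "smooth \<phi> \<Longrightarrow> smooth \<psi> \<Longrightarrow> smooth (\<lambda>x. \<phi> x * \<psi> x)"
  by (rule smooth_closure_smooth) (intro smooth_closure.mult smooth_closure.base)

lemma smooth_compose: "smooth \<theta> \<Longrightarrow> smooth \<phi> \<Longrightarrow> smooth (\<lambda>x. \<theta> (\<phi> x :: real))"
  by (rule smooth_closure_smooth) (blast intro: smooth_closure.comp[of \<theta>] smooth_closure.base)

lemma smooth_diff:
  assumes "smooth \<phi>" "smooth \<psi>"
  shows "smooth (\<lambda>x. \<phi> x - \<psi> x)"
proof -
  have "(\<lambda>x. \<phi> x - \<psi> x) = (\<lambda>x. \<phi> x + (-1) * \<psi> x)" by auto
  then show ?thesis
    by (simp only:) (intro smooth_add smooth_mult smooth_const assms)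
qed

lemma smooth_sum:
  assumes "\<And>i. i \<in> I \<Longrightarrow> smooth (\<phi> i)"
  shows "smooth (\<lambda>x. \<Sum>i\<in>I. \<phi> i x)"
  using assms
proof (induction I rule: infinite_finite_induct)
  case (insert i I)
  then have "(\<lambda>x. \<Sum>i\<in>insert i I. \<phi> i x) = (\<lambda>x. \<phi> i x + (\<Sum>i\<in>I. \<phi> i x))"
    by simp
  moreover have "smooth (\<lambda>x. \<phi> i x + (\<Sum>i\<in>I. \<phi> i x))"
    by (intro smooth_add insert.IH insert.prems) auto
  ultimately show ?case by (simp only: simp_thms)
next
  case empty
  show ?case unfolding sum.empty by (rule smooth_const)
next
  case (infinite I)
  show ?case unfolding sum.infinite[OF infinite.hyps] by (rule smooth_const)
qed

lemma smooth_prod: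
  assumes "\<And>i. i \<in> I \<Longrightarrow> smooth (\<phi> i)"
  shows "smooth (\<lambda>x. \<Prod>i\<in>I. \<phi> i x)"
  using assms
proof (induction I rule: infinite_finite_induct)
  case (insert i I)
  then have "(\<lambda>x. \<Prod>i\<in>insert i I. \<phi> i x) = (\<lambda>x. \<phi> i x * (\<Prod>i\<in>I. \<phi> i x))"
    by simp
  moreover have "smooth (\<lambda>x. \<phi> i x * (\<Prod>i\<in>I. \<phi> i x))"
    by (intro smooth_mult insert.IH insert.prems) auto
  ultimately show ?case by (simp only: simp_thms)
next
  case empty
  show ?case unfolding prod.empty by (rule smooth_const)
next
  case (infinite I)
  show ?case unfolding prod.infinite[OF infinite.hyps] by (rule smooth_const)
qed

lemma smooth_square_norm: "smooth (\<lambda>x. (norm x)\<^sup>2)"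
proof -
  have "(\<lambda>x::'a. (norm x)\<^sup>2) = (\<lambda>x. \<Sum>b\<in>Basis. (x \<bullet> b) * (x \<bullet> b))"
    by (metis dot_square_norm euclidean_inner)
  then show ?thesis
    by (simp only:) (intro smooth_sum smooth_mult smooth_inner)
qed

lemma smooth_polynomial_function:
  assumes "real_polynomial_function (P :: real \<Rightarrow> real)"
  shows "smooth P"
  using assms
proof induction
  case (linear f)
  have "f = (\<lambda>x. f 1 * x)"
  proof -
    have "f x = f 1 * x" for x
      using linear_scale[OF bounded_linear.linear[OF linear], of x 1]
      by (simp add: mult.commute)
    then show ?thesis by blast
  qed
  then show ?case
    using smooth_mult[OF smooth_const[of "f 1"] smooth_ident] by metis
next
  case (const c)
  show ?case by (rule smooth_const)
next
  case (add f g)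
  then show ?case by (intro smooth_add)
next
  case (mult f g)
  then show ?case by (intro smooth_mult)
qed

lemma smooth_antiderivative:
  fixes \<psi> :: "real \<Rightarrow> real"
  assumes "\<And>t. (\<psi> has_real_derivative \<eta> t) (at t)" "smooth \<eta>"
  shows "smooth \<psi>"
proof
  fix k show "Ck k \<psi>"
  proof (cases k)
    case 0
    then show ?thesis using assms(1) DERIV_isCont
      by (auto intro!: continuous_at_imp_continuous_on)
  next
    case (Suc m)
    have "frechet_derivative \<psi> (at t) = (\<lambda>y. \<eta> t * y)" for t
      using assms(1)[of t] by (metis frechet_derivative_at has_field_derivative_def)
    then show ?thesis using Suc assms
      by (auto simp: has_field_derivative_def intro: differentiableI)
  qed
qed

section \<open>Smooth cutoffs on the real line\<close>

definition flat_exp :: "real \<Rightarrow> real" where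
  "flat_exp t = (if t > 0 then exp (- 1 / t) else 0)"

lemma poly_exp_flat:
  "((\<lambda>t. poly P (1 / t) * exp (- 1 / t)) \<longlongrightarrow> 0) (at_right (0::real))"
proof -
  have 1: "((\<lambda>y::real. y ^ n * exp (- y)) \<longlongrightarrow> 0) at_top" for n :: nat
    using tendsto_power_div_exp_0[of n] by (simp add: exp_minus divide_inverse)
  have "((\<lambda>y. \<Sum>i\<le>degree P. coeff P i * (y ^ i * exp (- y))) \<longlongrightarrow> (\<Sum>i\<le>degree P. coeff P i * 0)) at_top"
    by (intro tendsto_intros 1)
  then have "((\<lambda>y. poly P y * exp (- y)) \<longlongrightarrow> 0) at_top"
    by (simp add: poly_altdef sum_distrib_right mult.assoc)
  from filterlim_compose[OF this filterlim_inverse_at_top_right]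
  show ?thesis by (simp add: field_simps)
qed

text \<open>The functions P(1/t) exp(-1/t), extended by 0 to t \<le> 0, form a family stable under
  differentiation, and \<open>flat_exp\<close> is the member with P = 1.\<close>

lemma smooth_flat_exp: "smooth flat_exp"
proof -
  define F :: "real poly \<Rightarrow> real \<Rightarrow> real"
    where "F P t = (if t > 0 then poly P (1 / t) * exp (- 1 / t) else 0)" for P t
  \<comment> \<open>With y = 1/t, the chain rule factor is - y^2, and the derivative of P(y) exp(-y)
    in y is (P' - P)(y) exp(-y); this yields the polynomial y^2 (P - P').\<close>
  have deriv: "(F P has_real_derivative F (monom 1 2 * (P - pderiv P)) t) (at t)" for P t
  proof -
    consider "t > 0" | "t < 0" | "t = 0" by linarith
    then show ?thesis
    proof cases
      case 1
      have "((\<lambda>t. poly P (1 / t) * exp (- 1 / t)) has_real_derivative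
          F (monom 1 2 * (P - pderiv P)) t) (at t)"
        using 1 unfolding F_def
        by (auto intro!: derivative_eq_intros DERIV_chain2[where f = "poly P"] poly_DERIV
            simp: poly_monom field_simps power2_eq_square)
      then show ?thesis
        by (rule DERIV_cong_ev[THEN iffD1, rotated -1, OF _ refl _ refl])
          (use 1 in \<open>auto simp: F_def intro!: eventually_mono[OF eventually_nhds_in_open[of "{0<..}" t]]\<close>)
    next
      case 2
      have "((\<lambda>t. 0) has_real_derivative F (monom 1 2 * (P - pderiv P)) t) (at t)"
        using 2 unfolding F_def by auto
      then show ?thesis
        by (rule DERIV_cong_ev[THEN iffD1, rotated -1, OF _ refl _ refl])
          (use 2 in \<open>auto simp: F_def intro!: eventually_mono[OF eventually_nhds_in_open[of "{..<0}" t]]\<close>)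
    next
      case 3
      have "((\<lambda>h. F P h / h) \<longlongrightarrow> 0) (at_left 0)"
        by (rule tendsto_eventually) (auto simp: F_def eventually_at_filter)
      \<comment> \<open>Dividing by the argument multiplies P by its variable, so the difference
        quotient at 0 is again covered by \<open>poly_exp_flat\<close>.\<close>
      moreover have "((\<lambda>h. F P h / h) \<longlongrightarrow> 0) (at_right 0)"
      proof (rule Lim_transform_eventually[OF poly_exp_flat[of "monom 1 1 * P"]])
        show "\<forall>\<^sub>F x in at_right 0. poly (monom 1 1 * P) (1 / x) * exp (- 1 / x) = F P x / x"
          unfolding F_def eventually_at_filter
          by (rule always_eventually) (auto simp: poly_monom)
      qed
      ultimately have "((\<lambda>h. F P h / h) \<longlongrightarrow> 0) (at 0)"
        by (simp add: filterlim_split_at)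
      then show ?thesis unfolding 3 by (simp add: DERIV_def F_def)
    qed
  qed
  have "smooth (F 1)"
  proof (rule smooth_coinduct[where X = "range F"])
    fix \<phi> :: "real \<Rightarrow> real" and x b :: real
    assume "\<phi> \<in> range F"
    then obtain P where \<phi>: "\<phi> = F P" by blast
    show "\<phi> differentiable (at x)"
      unfolding \<phi> using deriv by (auto simp: has_field_derivative_def intro: differentiableI)
    have "frechet_derivative (F P) (at t) = (\<lambda>y. F (monom 1 2 * (P - pderiv P)) t * y)" for t
      using deriv by (metis frechet_derivative_at has_field_derivative_def)
    then show "(\<lambda>x. frechet_derivative \<phi> (at x) b) \<in> range F" if "b \<in> Basis"
      unfolding \<phi> using that by auto
  qed auto
  moreover have "F 1 = flat_exp" by (auto simp: F_def flat_exp_def)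
  ultimately show ?thesis by simp
qed

lemma flat_exp_bounds: "0 \<le> flat_exp t" "flat_exp t \<le> 1"
  by (auto simp: flat_exp_def)

lemma flat_exp_eq_0_iff [simp]: "flat_exp t = 0 \<longleftrightarrow> t \<le> 0"
  by (auto simp: flat_exp_def)

lemma flat_exp_limit:
  assumes "filterlim X at_top F"
  shows "((\<lambda>n. flat_exp (X n)) \<longlongrightarrow> 1) F"
proof -
  have "((\<lambda>n. exp (- inverse (X n))) \<longlongrightarrow> exp (- 0)) F"
    by (intro tendsto_intros filterlim_compose[OF tendsto_inverse_0_at_top assms] filterlim_ident)
  moreover have "\<forall>\<^sub>F n in F. X n > 0"
    using assms filterlim_at_top_dense by blast
  then have "\<forall>\<^sub>F n in F. exp (- inverse (X n)) = flat_exp (X n)"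
    by eventually_elim (auto simp: flat_exp_def field_simps)
  ultimately show ?thesis by (simp add: Lim_transform_eventually)
qed


section \<open>Integration along lines\<close>

text \<open>The gauge integral needs no prior integrability of the derivative. At an exceptional
  tag, continuity alone makes the increment of \<open>f\<close> smaller than a weight prescribed for
  that point, and the weights of countably many points can have a small sum.\<close>

theorem fundamental_theorem_of_calculus_countable:
  fixes f :: "real \<Rightarrow> 'a::banach"
  assumes "countable S" and "a \<le> b"
    and vec: "\<And>x. x \<in> {a..b} - S \<Longrightarrow> (f has_vector_derivative f' x) (at x)"
    and cont: "continuous_on {a..b} f"
  shows "(f' has_integral (f b - f a)) {a..b}"
proof -
  define s where "s = from_nat_into S"
  define g where "g x = (if x \<in> S then 0 else f' x)" for x
  have "(g has_integral (f b - f a)) {a..b}"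
    unfolding has_integral[of g, where a=a and b=b, unfolded box_real]
  proof (intro allI impI)
    fix e :: real
    assume "0 < e"
    define e1 where "e1 = e / (2 * (b - a + 1))"
    have e1: "e1 > 0" "e1 * (b - a) < e / 2"
      using \<open>0 < e\<close> \<open>a \<le> b\<close> by (auto simp: e1_def field_simps)
    \<comment> \<open>The weights sum to e / 4. Each point may be charged on both sides, so the
      exceptional tags cost at most e / 2; the choice of \<open>e1\<close> keeps the remaining tags
      below the other half.\<close>
    define w where "w n = e / 8 * (1/2) ^ n" for n :: nat
    have w_sums: "w sums (e / 4)"
      using sums_mult[OF geometric_sums[of "1/2::real"], of "e / 8"] unfolding w_def by simp
    have w: "summable w" "w n > 0" "suminf w = e / 4" for n
      using w_sums \<open>0 < e\<close> by (auto simp: sums_iff w_def)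
    \<comment> \<open>The monotone jump function \<open>m\<close> dominates the increments of \<open>f\<close> over intervals tagged in
      \<open>S\<close> and telescopes, so multiplicities of tags need not be counted.\<close>
    define j where "j v n = w n * (of_bool (v > s n) + of_bool (v \<ge> s n))" for v n
    define m where "m v = suminf (j v)" for v
    have j: "summable (j v)" "0 \<le> j v n" "j v n \<le> 2 * w n" for v n
    proof -
      show b: "0 \<le> j v n" "j v n \<le> 2 * w n" for n
        using w(2)[of n] by (auto simp: j_def of_bool_def)
      show "summable (j v)"
        by (rule summable_comparison_test'[where g = "\<lambda>n. 2 * w n" and N = 0])
          (use b w(1) in \<open>auto intro: summable_mult\<close>)
    qed
    have jump: "j v n - j u n \<le> m v - m u" if "u \<le> v" for u v n
    proof -
      have mono: "0 \<le> j v i - j u i" for i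
        using that w(2)[of i] by (auto simp: j_def of_bool_def)
      have "(\<Sum>i\<in>{n}. j v i - j u i) \<le> (\<Sum>i. j v i - j u i)"
        by (rule sum_le_suminf) (use mono in \<open>auto intro!: summable_diff j(1)\<close>)
      then show ?thesis by (simp add: m_def suminf_diff[OF j(1) j(1)])
    qed
    have m_nonneg: "0 \<le> m v - m u" if "u \<le> v" for u v
      using jump[OF that, of 0] that w(2)[of 0] by (auto simp: j_def of_bool_def split: if_splits)
    have m_total: "m b - m a \<le> e / 2"
    proof -
      have "0 \<le> m a" unfolding m_def by (intro suminf_nonneg j)
      moreover have "m b \<le> (\<Sum>n. 2 * w n)"
        unfolding m_def by (intro suminf_le j summable_mult w)
      ultimately show ?thesis using w by (simp add: suminf_mult)
    qed
    have "\<exists>d>0. x \<in> {a..b} \<longrightarrow>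
        (\<forall>y\<in>{a..b}. norm (y - x) < d \<longrightarrow>
          (if x \<in> S then norm (f y - f x) \<le> w (to_nat_on S x)
           else norm (f y - f x - (y - x) *\<^sub>R f' x) \<le> e1 * norm (y - x)))" for x
    proof (cases "x \<in> {a..b}")
      case True
      show ?thesis
      proof (cases "x \<in> S")
        case True
        obtain d where "d > 0" "\<And>y. y \<in> {a..b} \<Longrightarrow> dist y x < d \<Longrightarrow> dist (f y) (f x) < w (to_nat_on S x)"
          using cont \<open>x \<in> {a..b}\<close> w(2)[of "to_nat_on S x"] unfolding continuous_on_iff by metis
        then show ?thesis
          using True by (intro exI[of _ d]) (auto simp: dist_norm intro: less_imp_le)
      next
        case False
        then have "(f has_derivative (\<lambda>y. y *\<^sub>R f' x)) (at x within {a..b})"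
          using vec[of x] True by (auto simp: has_vector_derivative_def intro: has_derivative_at_withinI)
        then show ?thesis
          using e1(1) False unfolding has_derivative_within_alt by auto
      qed
    qed (auto intro: exI[of _ 1])
    then obtain d where d: "\<And>x. 0 < d x"
      "\<And>x y. \<lbrakk>x \<in> {a..b}; y \<in> {a..b}; norm (y - x) < d x\<rbrakk> \<Longrightarrow>
          if x \<in> S then norm (f y - f x) \<le> w (to_nat_on S x)
           else norm (f y - f x - (y - x) *\<^sub>R f' x) \<le> e1 * norm (y - x)"
      by metis
    show "\<exists>\<gamma>. gauge \<gamma> \<and> (\<forall>p. p tagged_division_of {a..b} \<and> \<gamma> fine p \<longrightarrow>
        norm ((\<Sum>(x, k)\<in>p. measure lborel k *\<^sub>R g x) - (f b - f a)) < e)"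
    proof (rule exI, safe)
      show "gauge (\<lambda>x. ball x (d x))"
        using d(1) gauge_ball_dependent by blast
    next
      fix p
      assume ptag: "p tagged_division_of {a..b}" and finep: "(\<lambda>x. ball x (d x)) fine p"
      note tel = additive_tagged_division_1[OF \<open>a \<le> b\<close> ptag]
      have "norm (\<Sum>(x, K) \<in> p. (measure lborel K *\<^sub>R g x) - (f (Sup K) - f (Inf K)))
          \<le> (\<Sum>(x, K)\<in>p. e1 * (Sup K - Inf K) + (m (Sup K) - m (Inf K)))"
      proof (rule sum_norm_le, safe)
        fix x K
        assume xK: "(x, K) \<in> p"
        then have "x \<in> K" and kab: "K \<subseteq> {a..b}"
          using ptag by blast+
        obtain u v where k: "K = {u..v}"
          using ptag xK by (metis box_real(2) tagged_division_ofD(4))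
        have "u \<le> v" and uv: "u \<le> x" "x \<le> v"
          using \<open>x \<in> K\<close> unfolding k by auto
        have ball: "\<And>y. y \<in> K \<Longrightarrow> norm (y - x) < d x"
          using finep xK by (force simp: fine_def dist_real_def)
        have mem: "u \<in> K" "v \<in> K" "u \<in> {a..b}" "v \<in> {a..b}" "x \<in> {a..b}"
          using \<open>u \<le> v\<close> k kab \<open>x \<in> K\<close> by auto
        have "norm (measure lborel K *\<^sub>R g x - (f v - f u)) \<le> e1 * (v - u) + (m v - m u)"
        proof (cases "x \<in> S")
          case True
          define n where "n = to_nat_on S x"
          have sn: "s n = x"
            using True \<open>countable S\<close> by (simp add: s_def n_def)
          have close: "norm (f u - f x) \<le> w n" "norm (f v - f x) \<le> w n"
            using d(2)[of x u] d(2)[of x v] mem ball True by (auto simp: n_def)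
          \<comment> \<open>An endpoint that coincides with the tag costs nothing. Thus each side of
            the tag pays only for the half of the jump of \<open>j\<close> on that side, and a tag
            shared by two adjacent intervals is not charged twice.\<close>
          have u: "norm (f u - f x) \<le> w n * of_bool (u < x)"
            using close uv by (auto simp: of_bool_def split: if_splits)
          have v: "norm (f v - f x) \<le> w n * of_bool (x < v)"
            using close uv by (auto simp: of_bool_def split: if_splits)
          have "norm (f v - f u) \<le> norm (f v - f x) + norm (f u - f x)"
            using norm_triangle_ineq4[of "f v - f x" "f u - f x"] by simp
          also have "\<dots> \<le> w n * of_bool (x < v) + w n * of_bool (u < x)"
            using u v by linarith
          also have "\<dots> = j v n - j u n"
            using uv by (auto simp: j_def sn of_bool_def algebra_simps)
          also have "\<dots> \<le> m v - m u" by (rule jump[OF \<open>u \<le> v\<close>])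
          finally have "norm (f v - f u) \<le> m v - m u" .
          moreover have "0 \<le> e1 * (v - u)" using e1(1) \<open>u \<le> v\<close> by simp
          ultimately show ?thesis using True by (simp add: g_def norm_minus_commute)
        next
          case False
          have "norm ((v - u) *\<^sub>R f' x - (f v - f u)) =
              norm (f u - f x - (u - x) *\<^sub>R f' x - (f v - f x - (v - x) *\<^sub>R f' x))"
            by (auto simp: algebra_simps)
          also have "\<dots> \<le> norm (f u - f x - (u - x) *\<^sub>R f' x) + norm (f v - f x - (v - x) *\<^sub>R f' x)"
            by (rule norm_triangle_ineq4)
          also have "\<dots> \<le> e1 * norm (u - x) + e1 * norm (v - x)"
            using d(2)[of x u] d(2)[of x v] mem ball False by (intro add_mono) auto
          also have "\<dots> = e1 * (v - u)"
            using uv by (simp add: algebra_simps)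
          finally show ?thesis
            using False m_nonneg[OF \<open>u \<le> v\<close>] \<open>u \<le> v\<close> by (simp add: g_def k)
        qed
        then show "norm (measure lborel K *\<^sub>R g x - (f (Sup K) - f (Inf K)))
            \<le> e1 * (Sup K - Inf K) + (m (Sup K) - m (Inf K))"
          using \<open>u \<le> v\<close> by (simp add: k)
      qed
      also have "\<dots> = e1 * (b - a) + (m b - m a)"
        using tel[of "\<lambda>x. x"] tel[of m]
        by (simp add: split_def sum.distrib sum_distrib_left[symmetric])
      also have "\<dots> < e" using e1 m_total by simp
      finally show "norm ((\<Sum>(x, k)\<in>p. measure lborel k *\<^sub>R g x) - (f b - f a)) < e"
        using tel[of f] by (simp add: split_def sum_subtractf)
    qed
  qed
  then show ?thesis
    using countable_imp_null_set_lborel[OF \<open>countable S\<close>]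
    by (elim has_integral_spike[where S = S and f = g, rotated 2])
      (auto simp: g_def negligible_iff_null_sets intro: null_sets_completionI)
qed

text \<open>
  By translation invariance the difference \<open>\<Psi> (x + v) - \<Psi> x\<close> has integral 0, and it is the integral of
  \<open>D\<close> over a segment; Fubini does the rest, without splitting off a coordinate.
\<close>

lemma integral_directional_derivative_eq_0:
  fixes \<Psi> D :: "'a::euclidean_space \<Rightarrow> 'b::euclidean_space"
  assumes \<Psi>: "integrable lborel \<Psi>" and D: "integrable lborel D"
    and line: "AE x in lborel. ((\<lambda>s. D (x + s *\<^sub>R v)) has_integral (\<Psi> (x + v) - \<Psi> x)) {0..1}"
  shows "(\<integral>x. D x \<partial>lborel) = 0"
proof -
  have [measurable]: "\<Psi> \<in> borel_measurable borel" "D \<in> borel_measurable borel"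
    using \<Psi> D by auto
  have transl: "integrable lborel (\<lambda>x. g (x + c))"
    "(\<integral>x. g (x + c) \<partial>lborel) = (\<integral>x. g x \<partial>lborel)"
    if "integrable lborel g" for g :: "'a \<Rightarrow> 'b" and c
  proof -
    have g: "g \<in> borel_measurable borel" using that by auto
    have i: "integrable (distr lborel borel ((+) c)) g"
      using that by (simp add: lborel_distr_plus)
    show "integrable lborel (\<lambda>x. g (x + c))"
      using i g by (subst (asm) integrable_distr_eq) (auto simp: add.commute)
    have "(\<integral>x. g x \<partial>lborel) = (\<integral>x. g x \<partial>distr lborel borel ((+) c))"
      by (simp add: lborel_distr_plus)
    also have "\<dots> = (\<integral>x. g (x + c) \<partial>lborel)"
      using g by (subst integral_distr) (auto simp: add.commute)
    finally show "(\<integral>x. g (x + c) \<partial>lborel) = (\<integral>x. g x \<partial>lborel)" by simp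
  qed
  define h where "h s x = indicator {0..1} s *\<^sub>R D (x + s *\<^sub>R v)" for s :: real and x
  have [measurable]: "case_prod h \<in> borel_measurable (lborel \<Otimes>\<^sub>M lborel)"
    unfolding h_def by measurable
  have norm_D: "integrable lborel (\<lambda>x. norm (D x))" using D by simp
  have "integrable (lborel \<Otimes>\<^sub>M lborel) (case_prod h)"
  proof (rule lborel_pair.Fubini_integrable)
    have "(\<lambda>s. \<integral>x. norm (h s x) \<partial>lborel) = (\<lambda>s. indicator {0..1} s *\<^sub>R (\<integral>x. norm (D x) \<partial>lborel))"
    proof
      fix s
      have i: "integrable (distr lborel borel ((+) (s *\<^sub>R v))) (\<lambda>x. norm (D x))"
        using norm_D by (simp add: lborel_distr_plus)
      have "(\<integral>x. norm (D x) \<partial>lborel) = (\<integral>x. norm (D x) \<partial>distr lborel borel ((+) (s *\<^sub>R v)))"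
        by (simp add: lborel_distr_plus)
      also have "\<dots> = (\<integral>x. norm (D (x + s *\<^sub>R v)) \<partial>lborel)"
        by (subst integral_distr) (auto simp: add.commute)
      finally show "(\<integral>x. norm (h s x) \<partial>lborel) = indicator {0..1} s *\<^sub>R (\<integral>x. norm (D x) \<partial>lborel)"
        by (simp add: h_def)
    qed
    moreover have "integrable lborel (\<lambda>s::real. indicator {0..1} s *\<^sub>R (\<integral>x. norm (D x) \<partial>lborel))"
      by (intro integrable_scaleR_left integrable_real_indicator) auto
    ultimately show "integrable lborel (\<lambda>x. \<integral>y. norm (case (x, y) of (x, y) \<Rightarrow> h x y) \<partial>lborel)"
      by simp
    show "AE s in lborel. integrable lborel (\<lambda>y. case (s, y) of (x, y) \<Rightarrow> h x y)"
      unfolding h_def prod.case by (intro AE_I2 integrable_scaleR_right transl D)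
  qed simp
  note int = this
  have "(\<integral>x. (\<integral>s. h s x \<partial>lborel) \<partial>lborel) = (\<integral>s. (\<integral>x. h s x \<partial>lborel) \<partial>lborel)"
    by (rule lborel_pair.Fubini_integral[OF int])
  also have "\<dots> = (\<integral>s. indicator {0..1::real} s *\<^sub>R (\<integral>x. D x \<partial>lborel) \<partial>lborel)"
    using transl(2)[OF D] by (simp add: h_def)
  also have "\<dots> = (\<integral>s. indicator {0..1::real} s \<partial>lborel) *\<^sub>R (\<integral>x. D x \<partial>lborel)"
    by (rule integral_scaleR_left) (auto intro!: integrable_real_indicator)
  also have "\<dots> = (\<integral>x. D x \<partial>lborel)"
    by simp
  finally have 1: "(\<integral>x. (\<integral>s. h s x \<partial>lborel) \<partial>lborel) = (\<integral>x. D x \<partial>lborel)" .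
  have "AE x in lborel. (\<integral>s. h s x \<partial>lborel) = \<Psi> (x + v) - \<Psi> x"
    using line lborel_pair.AE_integrable_snd[OF int]
  proof eventually_elim
    case (elim x)
    have "((\<lambda>s. h s x) has_integral (\<integral>s. h s x \<partial>lborel)) UNIV"
      using elim(2) by (rule has_integral_integral_lborel)
    moreover have "((\<lambda>s. h s x) has_integral (\<Psi> (x + v) - \<Psi> x)) UNIV"
    proof -
      have "((\<lambda>s. if s \<in> {0..1} then D (x + s *\<^sub>R v) else 0) has_integral (\<Psi> (x + v) - \<Psi> x)) UNIV"
        using elim(1) by (simp only: has_integral_restrict_UNIV)
      moreover have "(\<lambda>s. h s x) = (\<lambda>s. if s \<in> {0..1} then D (x + s *\<^sub>R v) else 0)"
        by (auto simp: h_def indicator_def)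
      ultimately show ?thesis by simp
    qed
    ultimately show ?case by (rule has_integral_unique)
  qed
  moreover have "(\<lambda>x. \<integral>s. h s x \<partial>lborel) \<in> borel_measurable lborel"
    using lborel_pair.integrable_snd[OF int] by auto
  ultimately have "(\<integral>x. (\<integral>s. h s x \<partial>lborel) \<partial>lborel) = (\<integral>x. \<Psi> (x + v) - \<Psi> x \<partial>lborel)"
    by (intro integral_cong_AE) auto
  also have "\<dots> = 0"
    using transl[OF \<Psi>, of v] \<Psi> by simp
  finally show ?thesis using 1 by simp
qed


section \<open>Weak derivatives of radial fields\<close>

lemma test_function_smooth: "\<phi> \<in> test_functions \<Omega> \<Longrightarrow> smooth \<phi>"
  by (simp only: test_functions_def mem_Collect_eq simp_thms)

lemma test_function_eq_0:
  assumes "\<phi> \<in> test_functions \<Omega>" "x \<notin> \<Omega>"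
  shows "\<phi> x = 0"
  using assms closure_subset[of "{x. \<phi> x \<noteq> 0}"]
  by (simp only: test_functions_def mem_Collect_eq subset_iff) blast

lemma frechet_derivative_eq_0_outside_support:
  assumes "x \<notin> closure {x. \<phi> x \<noteq> 0}"
  shows "frechet_derivative \<phi> (at x) = (\<lambda>_. 0)"
proof -
  have "((\<lambda>_. 0) has_derivative (\<lambda>_. 0)) (at x)" by simp
  then have "(\<phi> has_derivative (\<lambda>_. 0)) (at x)"
    by (rule has_derivative_transform_within_open[where s = "- closure {x. \<phi> x \<noteq> 0}"])
      (use assms closure_subset[of "{x. \<phi> x \<noteq> 0}"] in auto)
  then show ?thesis by (metis frechet_derivative_at)
qed

lemma test_function_partial:
  assumes "\<phi> \<in> test_functions \<Omega>" "b \<in> Basis"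
  shows "(\<lambda>x. frechet_derivative \<phi> (at x) b) \<in> test_functions \<Omega>"
proof -
  have "{x. frechet_derivative \<phi> (at x) b \<noteq> 0} \<subseteq> closure {x. \<phi> x \<noteq> 0}"
    using frechet_derivative_eq_0_outside_support by fastforce
  then have sub: "closure {x. frechet_derivative \<phi> (at x) b \<noteq> 0} \<subseteq> closure {x. \<phi> x \<noteq> 0}"
    by (simp add: closure_minimal)
  then have "compact (closure {x. frechet_derivative \<phi> (at x) b \<noteq> 0})"
    using assms(1) unfolding test_functions_def
    by (metis (no_types, lifting) closed_closure compact_Int_closed inf.absorb_iff2 mem_Collect_eq)
  then show ?thesis
    using sub assms smooth_partial[OF test_function_smooth[OF assms(1)] assms(2)]
    unfolding test_functions_def by (simp only: mem_Collect_eq) blast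
qed

lemma test_function_bounded:
  assumes "\<phi> \<in> test_functions \<Omega>"
  obtains M where "\<And>x. \<bar>\<phi> x\<bar> \<le> M"
proof -
  let ?K = "closure {x. \<phi> x \<noteq> 0}"
  have "compact ?K" using assms by (simp add: test_functions_def)
  moreover have "continuous_on ?K \<phi>"
    by (rule smooth_continuous_on[OF test_function_smooth[OF assms]])
  ultimately have "bounded (\<phi> ` ?K)"
    by (intro compact_imp_bounded compact_continuous_image)
  then obtain M where M: "\<And>x. x \<in> ?K \<Longrightarrow> \<bar>\<phi> x\<bar> \<le> M"
    unfolding bounded_iff by auto
  have "\<bar>\<phi> x\<bar> \<le> max M 0" for x
  proof (cases "\<phi> x = 0")
    case False
    then have "x \<in> ?K" using closure_subset by fastforce
    then show ?thesis using M by (simp add: le_max_iff_disj)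
  qed simp
  then show ?thesis using that by blast
qed

lemma test_function_borel [measurable_dest]:
  "\<phi> \<in> test_functions \<Omega> \<Longrightarrow> \<phi> \<in> borel_measurable borel"
  by (intro borel_measurable_continuous_onI smooth_continuous_on[OF test_function_smooth])

lemma measurable_lebesgue_on_borel:
  "f \<in> borel_measurable borel \<Longrightarrow> f \<in> borel_measurable (lebesgue_on \<Omega>)"
  by (simp add: measurable_completion measurable_restrict_space1)

lemma integrable_scaleR_bounded:
  fixes g :: "'a \<Rightarrow> 'b::euclidean_space" and \<zeta> :: "'a \<Rightarrow> real"
  assumes "integrable M g" "\<zeta> \<in> borel_measurable M" "\<And>x. \<bar>\<zeta> x\<bar> \<le> C"
  shows "integrable M (\<lambda>x. \<zeta> x *\<^sub>R g x)"
proof (rule Bochner_Integration.integrable_bound[where f = "\<lambda>x. C * norm (g x)"])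
  show "integrable M (\<lambda>x. C * norm (g x))" using assms(1) by simp
  show "(\<lambda>x. \<zeta> x *\<^sub>R g x) \<in> borel_measurable M" using assms by measurable
  have "0 \<le> C" using assms(3)[of undefined] by simp
  then show "AE x in M. norm (\<zeta> x *\<^sub>R g x) \<le> norm (C * norm (g x))"
    using assms(3) by (auto intro!: mult_right_mono)
qed

text \<open>The zero extension of the test function turns integrals over \<open>\<Omega>\<close>
  into integrals over the whole space with respect to a translation invariant Borel measure, the
  setting of \<open>integral_directional_derivative_eq_0\<close>.\<close>

lemma test_function_lborel:
  fixes g :: "'a::euclidean_space \<Rightarrow> 'b::euclidean_space"
  assumes "\<phi> \<in> test_functions \<Omega>" "open \<Omega>" "g \<in> borel_measurable borel"
    and int: "integrable (lebesgue_on \<Omega>) g"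
  shows "integrable lborel (\<lambda>x. \<phi> x *\<^sub>R g x)"
    and "(\<integral>x. \<phi> x *\<^sub>R g x \<partial>lebesgue_on \<Omega>) = (\<integral>x. \<phi> x *\<^sub>R g x \<partial>lborel)"
proof -
  have \<phi>: "\<phi> \<in> borel_measurable borel" using assms(1) by (rule test_function_borel)
  then have m: "(\<lambda>x. \<phi> x *\<^sub>R g x) \<in> borel_measurable borel" using assms(3) by measurable
  obtain C where C: "\<And>x. \<bar>\<phi> x\<bar> \<le> C" using test_function_bounded[OF assms(1)] by blast
  have \<Omega>: "\<Omega> \<inter> space lebesgue \<in> sets lebesgue" using \<open>open \<Omega>\<close> by auto
  have eq: "(\<lambda>x. indicator \<Omega> x *\<^sub>R \<phi> x *\<^sub>R g x) = (\<lambda>x. \<phi> x *\<^sub>R g x)"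
  proof
    fix x show "indicator \<Omega> x *\<^sub>R \<phi> x *\<^sub>R g x = \<phi> x *\<^sub>R g x"
      using test_function_eq_0[OF assms(1), of x] by (cases "x \<in> \<Omega>") auto
  qed
  have "integrable (lebesgue_on \<Omega>) (\<lambda>x. \<phi> x *\<^sub>R g x)"
    by (rule integrable_scaleR_bounded[OF int measurable_lebesgue_on_borel[OF \<phi>] C])
  then have "integrable lebesgue (\<lambda>x. \<phi> x *\<^sub>R g x)"
    by (simp only: integrable_restrict_space[OF \<Omega>] eq)
  then show "integrable lborel (\<lambda>x. \<phi> x *\<^sub>R g x)"
    using m by (subst (asm) integrable_completion) auto
  show "(\<integral>x. \<phi> x *\<^sub>R g x \<partial>lebesgue_on \<Omega>) = (\<integral>x. \<phi> x *\<^sub>R g x \<partial>lborel)"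
    using m by (simp only: integral_restrict_space[OF \<Omega>] eq) (subst integral_completion, auto)
qed

lemma integrable_imp_L1_loc:
  assumes "open \<Omega>" "integrable (lebesgue_on \<Omega>) f"
  shows "f \<in> L1_loc \<Omega>"
  unfolding L1_loc_def
proof (intro CollectI conjI allI impI)
  show "f \<in> borel_measurable (lebesgue_on \<Omega>)" using assms by auto
  fix K assume K: "compact K \<and> K \<subseteq> \<Omega>"
  have \<Omega>: "\<Omega> \<inter> space lebesgue \<in> sets lebesgue" using \<open>open \<Omega>\<close> by auto
  have K': "K \<in> sets lebesgue" using K by (simp add: borel_compact lmeasurable_compact fmeasurableD)
  have "integrable lebesgue (\<lambda>x. indicator \<Omega> x *\<^sub>R f x)"
    using assms(2) by (simp only: integrable_restrict_space[OF \<Omega>])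
  from integrable_mult_indicator[OF K' this]
  have "integrable lebesgue (\<lambda>x. indicator K x *\<^sub>R f x)"
    by (rule Bochner_Integration.integrable_cong[THEN iffD1, OF refl, rotated])
      (use K in \<open>auto simp: indicator_def\<close>)
  then show "integrable (lebesgue_on K) f"
    using K' by (subst integrable_restrict_space) auto
qed

text \<open>Squaring gives a monic quadratic equation in \<open>s\<close>, solved by completing the
  square. Consequently a countable set of exceptional radii meets each such line in a countable set
  of parameters.\<close>

lemma finite_norm_level_on_line:
  fixes x b :: "'a::euclidean_space"
  assumes "b \<in> Basis"
  shows "finite {s. norm (x + s *\<^sub>R b) = c}"
proof -
  define d where "d = c\<^sup>2 - (norm x)\<^sup>2 + (x \<bullet> b)\<^sup>2"
  have "s \<in> {sqrt d - x \<bullet> b, - sqrt d - x \<bullet> b}" if "norm (x + s *\<^sub>R b) = c" for s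
  proof -
    have "c\<^sup>2 = (norm x)\<^sup>2 + 2 * s * (x \<bullet> b) + s\<^sup>2"
      unfolding that[symmetric] power2_norm_eq_inner using assms
      by (simp add: inner_add_left inner_add_right inner_commute power2_eq_square)
    then have "(s + x \<bullet> b)\<^sup>2 = d"
      by (simp add: d_def power2_eq_square algebra_simps)
    then have "\<bar>s + x \<bullet> b\<bar> = sqrt d" by (metis real_sqrt_abs)
    then show ?thesis by auto
  qed
  then have "{s. norm (x + s *\<^sub>R b) = c} \<subseteq> {sqrt d - x \<bullet> b, - sqrt d - x \<bullet> b}" by blast
  then show ?thesis using finite_subset by blast
qed

text \<open>A line in direction \<open>b\<close> through the origin lies in the hyperplane
  orthogonal to any other basis vector, and that hyperplane is a null set. The second basis vector
  is where dimension two is needed.\<close>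

lemma AE_line_avoids_origin:
  fixes b :: "'a::euclidean_space"
  assumes "DIM('a) \<ge> 2" "b \<in> Basis"
  shows "AE x in lborel. \<forall>s. x + s *\<^sub>R b \<noteq> 0"
proof -
  obtain b' :: 'a where b': "b' \<in> Basis" "b' \<noteq> b"
  proof -
    have "Basis \<noteq> {b}"
    proof
      assume "Basis = {b}"
      then have "DIM('a) = card {b}" by (rule arg_cong)
      then show False using assms(1) by simp
    qed
    then show ?thesis using that assms(2) by blast
  qed
  have "{x. x \<bullet> b' = 0} \<in> null_sets lebesgue"
    using negligible_standard_hyperplane[OF b'(1), of 0] by (simp add: negligible_iff_null_sets)
  then have "AE x in lebesgue. x \<notin> {x. x \<bullet> b' = 0}" by (rule AE_not_in)
  then have "AE x in lborel. x \<notin> {x. x \<bullet> b' = 0}" by (simp only: AE_completion_iff)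
  then show ?thesis
  proof eventually_elim
    case (elim x)
    show ?case
    proof (intro allI notI)
      fix s assume "x + s *\<^sub>R b = 0"
      then have "(x + s *\<^sub>R b) \<bullet> b' = 0" by simp
      then show False using elim assms(2) b' by (simp add: inner_add_left inner_not_same_Basis)
    qed
  qed
qed

lemma norm_radial_partial_le:
  fixes x b :: "'a::euclidean_space"
  assumes "b \<in> Basis"
  shows "norm (c *\<^sub>R b + (d * (x \<bullet> b) / norm x) *\<^sub>R x) \<le> \<bar>c\<bar> + \<bar>norm x * d\<bar>"
proof -
  have "norm (c *\<^sub>R b + (d * (x \<bullet> b) / norm x) *\<^sub>R x) \<le> \<bar>c\<bar> + \<bar>d\<bar> * (\<bar>x \<bullet> b\<bar> / norm x * norm x)"
    using assms by (intro norm_triangle_le) (simp add: abs_mult)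
  also have "\<dots> \<le> \<bar>c\<bar> + \<bar>d\<bar> * norm x"
    using Basis_le_norm[OF assms, of x] by (intro add_left_mono mult_left_mono) auto
  finally show ?thesis by (simp add: abs_mult mult.commute)
qed

text \<open>
  The possible singularity at the origin contributes nothing because in dimension at least two
  almost every line parallel to \<open>b\<close> avoids it.
\<close>

theorem radial_field_has_weak_partial:
  fixes k k' :: "real \<Rightarrow> real" and b :: "'a::euclidean_space"
  assumes dim: "DIM('a) \<ge> 2" and b: "b \<in> Basis" and C: "countable C"
    and cont: "continuous_on {0<..} k"
    and deriv: "\<And>\<rho>. \<rho> > 0 \<Longrightarrow> \<rho> \<notin> C \<Longrightarrow> (k has_real_derivative k' \<rho>) (at \<rho>)"
    and [measurable]: "k \<in> borel_measurable borel" "k' \<in> borel_measurable borel"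
    and int: "integrable (lebesgue_on (ball 0 R)) (\<lambda>x::'a. k (norm x))"
      "integrable (lebesgue_on (ball 0 R)) (\<lambda>x::'a. norm x * k' (norm x))"
  defines "v \<equiv> (\<lambda>x. k (norm x) *\<^sub>R b + (k' (norm x) * (x \<bullet> b) / norm x) *\<^sub>R x)"
  shows "has_weak_partial (ball 0 R) b (\<lambda>x. k (norm x) *\<^sub>R x) v"
    and "integrable (lebesgue_on (ball 0 R)) (\<lambda>x::'a. k (norm x) *\<^sub>R x)"
    and "integrable (lebesgue_on (ball 0 R)) v"
proof -
  let ?u = "\<lambda>x::'a. k (norm x) *\<^sub>R x"
  have um [measurable]: "?u \<in> borel_measurable borel" by measurable
  have vm [measurable]: "v \<in> borel_measurable borel" unfolding v_def by measurable
  show iu: "integrable (lebesgue_on (ball 0 R)) ?u"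
  proof (rule Bochner_Integration.integrable_bound)
    show "integrable (lebesgue_on (ball 0 R)) (\<lambda>x::'a. R * k (norm x))" using int(1) by simp
    show "AE x in lebesgue_on (ball 0 R). norm (?u x) \<le> norm (R * k (norm x))"
      by (rule AE_I2) (auto simp: mult.commute abs_mult intro!: mult_right_mono)
  qed (rule measurable_lebesgue_on_borel[OF um])
  show iv: "integrable (lebesgue_on (ball 0 R)) v"
  proof (rule Bochner_Integration.integrable_bound)
    show "integrable (lebesgue_on (ball 0 R)) (\<lambda>x::'a. \<bar>k (norm x)\<bar> + \<bar>norm x * k' (norm x)\<bar>)"
      using int by (intro Bochner_Integration.integrable_add integrable_abs)
    have "norm (v x) \<le> norm (\<bar>k (norm x)\<bar> + \<bar>norm x * k' (norm x)\<bar>)" for x :: 'a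
      using norm_radial_partial_le[OF b, of "k (norm x)" "k' (norm x)" x] by (simp add: v_def)
    then show "AE x in lebesgue_on (ball 0 R). norm (v x) \<le> norm (\<bar>k (norm x)\<bar> + \<bar>norm x * k' (norm x)\<bar>)"
      by simp
  qed (rule measurable_lebesgue_on_borel[OF vm])
  show "has_weak_partial (ball 0 R) b ?u v"
    unfolding has_weak_partial_def
  proof (intro conjI ballI)
    show "?u \<in> L1_loc (ball 0 R)" "v \<in> L1_loc (ball 0 R)"
      using iu iv by (auto intro: integrable_imp_L1_loc)
    fix \<phi> :: "'a \<Rightarrow> real"
    assume \<phi>: "\<phi> \<in> test_functions (ball 0 R)"
    let ?d = "\<lambda>x. frechet_derivative \<phi> (at x) b"
    have d: "?d \<in> test_functions (ball 0 R)" by (rule test_function_partial[OF \<phi> b])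
    note A = test_function_lborel[OF d open_ball um iu]
    note B = test_function_lborel[OF \<phi> open_ball vm iv]
    have \<phi>_deriv: "(\<phi> has_derivative frechet_derivative \<phi> (at x)) (at x)" for x
      using smooth_differentiable[OF test_function_smooth[OF \<phi>]] frechet_derivative_works by blast
    \<comment> \<open>Off the exceptional radii and the origin the integrand is the derivative along
      \<open>b\<close> of the product of \<open>\<phi>\<close> and \<open>?u\<close>, so the weak
      identity says that this derivative integrates to 0.\<close>
    have "(\<integral>x. ?d x *\<^sub>R ?u x + \<phi> x *\<^sub>R v x \<partial>lborel) = 0"
    proof (rule integral_directional_derivative_eq_0[where \<Psi> = "\<lambda>x. \<phi> x *\<^sub>R ?u x" and v = b])
      show "integrable lborel (\<lambda>x. \<phi> x *\<^sub>R ?u x)"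
        by (rule test_function_lborel[OF \<phi> open_ball um iu])
      show "integrable lborel (\<lambda>x. ?d x *\<^sub>R ?u x + \<phi> x *\<^sub>R v x)"
        by (rule Bochner_Integration.integrable_add[OF A(1) B(1)])
      show "AE x in lborel. ((\<lambda>s. ?d (x + s *\<^sub>R b) *\<^sub>R ?u (x + s *\<^sub>R b) + \<phi> (x + s *\<^sub>R b) *\<^sub>R v (x + s *\<^sub>R b))
          has_integral (\<phi> (x + b) *\<^sub>R ?u (x + b) - \<phi> x *\<^sub>R ?u x)) {0..1}"
        using AE_line_avoids_origin[OF dim b]
      proof eventually_elim
        case (elim x)
        let ?y = "\<lambda>s. x + s *\<^sub>R b"
        define S where "S = (\<Union>c\<in>C. {s. norm (?y s) = c})"
        have "countable S"
          unfolding S_def using C finite_norm_level_on_line[OF b]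
          by (intro countable_UN) (auto intro: countable_finite)
        define f where "f s = \<phi> (?y s) *\<^sub>R ?u (?y s)" for s
        have y: "(?y has_derivative (\<lambda>h. h *\<^sub>R b)) (at s)" for s
          by (auto intro!: derivative_eq_intros)
        have dphi: "((\<lambda>s. \<phi> (?y s)) has_real_derivative ?d (?y s)) (at s)" for s
        proof -
          have "((\<lambda>s. \<phi> (?y s)) has_derivative (\<lambda>h. frechet_derivative \<phi> (at (?y s)) (h *\<^sub>R b))) (at s)"
            by (rule has_derivative_compose[OF y \<phi>_deriv])
          then show ?thesis
            unfolding has_field_derivative_def
            by (simp add: linear_scale[OF has_derivative_linear[OF \<phi>_deriv]] mult.commute[of _ "?d (?y s)"])
        qed
        have dn: "((\<lambda>s. norm (?y s)) has_real_derivative (?y s \<bullet> b / norm (?y s))) (at s)" for s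
        proof -
          have "((\<lambda>s. norm (?y s)) has_derivative (\<lambda>h. (h *\<^sub>R b) \<bullet> sgn (?y s))) (at s)"
            using elim by (intro has_derivative_compose[OF y has_derivative_norm]) auto
          then show ?thesis
            unfolding has_field_derivative_def
            by (rule has_derivative_eq_rhs)
              (simp add: fun_eq_iff sgn_div_norm inner_commute divide_inverse mult.commute mult.left_commute)
        qed
        have "((\<lambda>s. ?d (?y s) *\<^sub>R ?u (?y s) + \<phi> (?y s) *\<^sub>R v (?y s)) has_integral f 1 - f 0) {0..1}"
        proof (rule fundamental_theorem_of_calculus_countable[OF \<open>countable S\<close>])
          show "continuous_on {0..1} f"
          proof -
            have "continuous_on {0..1} (\<lambda>s. \<phi> (?y s))"
              using dphi by (intro continuous_at_imp_continuous_on) (auto intro: DERIV_isCont)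
            moreover have "continuous_on {0..1} (\<lambda>s. k (norm (?y s)))"
              using elim by (intro continuous_on_compose2[OF cont] continuous_intros) auto
            ultimately show ?thesis unfolding f_def by (intro continuous_intros)
          qed
          fix s assume s: "s \<in> {0..1} - S"
          have "((\<lambda>s. k (norm (?y s))) has_real_derivative
              k' (norm (?y s)) * (?y s \<bullet> b / norm (?y s))) (at s)"
            using s elim by (intro DERIV_chain2[OF deriv dn]) (auto simp: S_def)
          from has_vector_derivative_scaleR[OF this, of ?y b]
          have dv: "((\<lambda>s. ?u (?y s)) has_vector_derivative v (?y s)) (at s)"
            using y by (simp add: v_def has_vector_derivative_def)
          show "(f has_vector_derivative ?d (?y s) *\<^sub>R ?u (?y s) + \<phi> (?y s) *\<^sub>R v (?y s)) (at s)"
            unfolding f_def using has_vector_derivative_scaleR[OF dphi dv] by (simp add: add.commute)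
        qed simp
        then show ?case by (simp add: f_def)
      qed
    qed
    then have "(\<integral>x. ?d x *\<^sub>R ?u x \<partial>lborel) = - (\<integral>x. \<phi> x *\<^sub>R v x \<partial>lborel)"
      using A(1) B(1) by (simp add: eq_neg_iff_add_eq_0)
    then show "(\<integral>x. ?d x *\<^sub>R ?u x \<partial>lebesgue_on (ball 0 R)) = - (\<integral>x. \<phi> x *\<^sub>R v x \<partial>lebesgue_on (ball 0 R))"
      by (simp only: A(2) B(2))
  qed
qed


section \<open>The fundamental lemma of the calculus of variations\<close>

text \<open>A smooth approximation of the indicator of the open box: as \<open>m\<close> grows, each
  factor tends to 1 inside, while some factor is 0 outside for every \<open>m\<close>.\<close>

definition box_bump :: "nat \<Rightarrow> 'a::euclidean_space \<Rightarrow> 'a \<Rightarrow> 'a \<Rightarrow> real" where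
  "box_bump m a c z =
     (\<Prod>b\<in>Basis. flat_exp (real m * ((z - a) \<bullet> b)) * flat_exp (real m * ((c - z) \<bullet> b)))"

lemma box_bump_bounds: "0 \<le> box_bump m a c z" "box_bump m a c z \<le> 1"
  unfolding box_bump_def
  by (auto intro!: prod_nonneg prod_le_1 mult_nonneg_nonneg mult_le_one flat_exp_bounds)

lemma box_bump_eq_0:
  assumes "z \<notin> box a c"
  shows "box_bump m a c z = 0"
proof -
  obtain b where b: "b \<in> Basis" "(z - a) \<bullet> b \<le> 0 \<or> (c - z) \<bullet> b \<le> 0"
    using assms by (auto simp: mem_box inner_diff_left not_less)
  then have "real m * ((z - a) \<bullet> b) \<le> 0 \<or> real m * ((c - z) \<bullet> b) \<le> 0"
    by (auto simp: mult_le_0_iff)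
  then have "\<exists>b\<in>Basis. flat_exp (real m * ((z - a) \<bullet> b)) * flat_exp (real m * ((c - z) \<bullet> b)) = 0"
    using b(1) by (intro bexI[of _ b]) auto
  then show ?thesis
    unfolding box_bump_def by (intro prod_zero) auto
qed

lemma smooth_box_bump: "smooth (box_bump m a c)"
proof -
  have eq: "box_bump m a c = (\<lambda>z. \<Prod>b\<in>Basis. flat_exp (real m * (z \<bullet> b - a \<bullet> b)) * flat_exp (real m * (c \<bullet> b - z \<bullet> b)))"
    by (simp add: box_bump_def inner_diff_left fun_eq_iff)
  show ?thesis
    unfolding eq
    by (intro smooth_prod smooth_mult smooth_compose[OF smooth_flat_exp] smooth_diff smooth_const smooth_inner)
qed

lemma box_bump_test_function:
  assumes "cbox a c \<subseteq> \<Omega>"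
  shows "box_bump m a c \<in> test_functions \<Omega>"
proof -
  have "closure {z. box_bump m a c z \<noteq> 0} \<subseteq> cbox a c"
    using box_bump_eq_0 box_subset_cbox by (intro closure_minimal) fastforce+
  moreover from this have "compact (closure {z. box_bump m a c z \<noteq> 0})"
    by (metis closed_closure compact_Int_closed compact_cbox inf.absorb_iff2)
  ultimately show ?thesis
    unfolding test_functions_def using smooth_box_bump[of m a c] assms
    by (simp only: mem_Collect_eq) blast
qed

lemma box_bump_tendsto: "(\<lambda>m. box_bump m a c z) \<longlonglongrightarrow> indicator (box a c) z"
proof (cases "z \<in> box a c")
  case True
  have lim: "(\<lambda>m. flat_exp (real m * t)) \<longlonglongrightarrow> 1" if "t > 0" for t
    using that by (intro flat_exp_limit filterlim_tendsto_pos_mult_at_top[of "\<lambda>_. t", simplified mult.commute[of t]]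
        filterlim_real_sequentially) (auto simp: mult.commute)
  have "(\<lambda>m. box_bump m a c z) \<longlonglongrightarrow> (\<Prod>b\<in>(Basis::'a set). 1 * 1)"
    unfolding box_bump_def using True
    by (intro tendsto_prod tendsto_mult lim) (auto simp: mem_box inner_diff_left)
  then show ?thesis using True by simp
next
  case False
  then show ?thesis by (simp add: box_bump_eq_0)
qed

lemma test_function_L1_loc_integrable:
  fixes w :: "'a::euclidean_space \<Rightarrow> 'b::euclidean_space"
  assumes \<phi>: "\<phi> \<in> test_functions \<Omega>" and "open \<Omega>" and w: "w \<in> L1_loc \<Omega>"
  shows "integrable (lebesgue_on \<Omega>) (\<lambda>x. \<phi> x *\<^sub>R w x)"
proof -
  let ?K = "closure {x. \<phi> x \<noteq> 0}"
  have K: "compact ?K" "?K \<subseteq> \<Omega>" using \<phi> unfolding test_functions_def by blast+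
  then have "integrable (lebesgue_on ?K) w" using w unfolding L1_loc_def by blast
  moreover obtain C where "\<And>x. \<bar>\<phi> x\<bar> \<le> C" using test_function_bounded[OF \<phi>] by blast
  ultimately have "integrable (lebesgue_on ?K) (\<lambda>x. \<phi> x *\<^sub>R w x)"
    by (intro integrable_scaleR_bounded measurable_lebesgue_on_borel test_function_borel[OF \<phi>])
  then have "integrable lebesgue (\<lambda>x. indicator ?K x *\<^sub>R \<phi> x *\<^sub>R w x)"
    using K by (subst (asm) integrable_restrict_space) (auto simp: lmeasurable_compact fmeasurableD)
  moreover have "indicator ?K x *\<^sub>R \<phi> x *\<^sub>R w x = indicator \<Omega> x *\<^sub>R \<phi> x *\<^sub>R w x" for x
  proof (cases "\<phi> x = 0")
    case False
    then have "x \<in> ?K" using closure_subset[of "{x. \<phi> x \<noteq> 0}"] by blast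
    then show ?thesis using K by (auto simp: indicator_def)
  qed simp
  ultimately have "integrable lebesgue (\<lambda>x. indicator \<Omega> x *\<^sub>R \<phi> x *\<^sub>R w x)"
    by (simp only:)
  moreover have "\<Omega> \<inter> space lebesgue \<in> sets lebesgue" using \<open>open \<Omega>\<close> by auto
  ultimately show ?thesis by (simp only: integrable_restrict_space)
qed

text \<open>Box bumps and dominated convergence show that \<open>w\<close> has integral 0 over every
  closed box in \<open>\<Omega>\<close>; differentiating integrals over shrinking boxes then
  recovers \<open>w\<close> almost everywhere.\<close>

theorem fundamental_lemma_calculus_of_variations:
  fixes w :: "'a::euclidean_space \<Rightarrow> real"
  assumes "open \<Omega>" and w: "w \<in> L1_loc \<Omega>"
    and zero: "\<And>\<phi>. \<phi> \<in> test_functions \<Omega> \<Longrightarrow> (\<integral>x. \<phi> x * w x \<partial>lebesgue_on \<Omega>) = 0"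
  shows "AE x in lebesgue_on \<Omega>. w x = 0"
proof -
  have \<Omega>: "\<Omega> \<inter> space lebesgue \<in> sets lebesgue" using \<open>open \<Omega>\<close> by auto
  have wm: "w \<in> borel_measurable (lebesgue_on \<Omega>)" using w by (simp add: L1_loc_def)
  have box0: "integral (cbox a c) w = 0" if sub: "cbox a c \<subseteq> \<Omega>" for a c
  proof -
    have "integrable (lebesgue_on (cbox a c)) w"
      using w sub by (simp add: L1_loc_def)
    then have i1: "integrable lebesgue (\<lambda>x. indicator (cbox a c) x *\<^sub>R w x)"
      by (subst (asm) integrable_restrict_space) auto
    have "indicator (box a c) x *\<^sub>R indicator (cbox a c) x *\<^sub>R w x = indicator (box a c) x *\<^sub>R w x" for x
      using box_subset_cbox[of a c] by (auto simp: indicator_def)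
    then have i2: "integrable lebesgue (\<lambda>x. indicator (box a c) x *\<^sub>R w x)"
      using integrable_mult_indicator[OF _ i1, of "box a c"] by (simp only:) simp
    have eq: "indicator \<Omega> x *\<^sub>R (indicator (cbox a c) x *\<^sub>R w x) = indicator (cbox a c) x *\<^sub>R w x"
      "indicator \<Omega> x *\<^sub>R (indicator (box a c) x *\<^sub>R w x) = indicator (box a c) x *\<^sub>R w x" for x
      using sub box_subset_cbox[of a c] by (auto simp: indicator_def)
    have i3: "integrable (lebesgue_on \<Omega>) (\<lambda>x. \<bar>indicator (cbox a c) x *\<^sub>R w x\<bar>)"
      using i1 by (intro integrable_abs) (simp only: integrable_restrict_space[OF \<Omega>] eq)
    have "(\<lambda>m. \<integral>x. box_bump m a c x * w x \<partial>lebesgue_on \<Omega>)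
        \<longlonglongrightarrow> (\<integral>x. indicator (box a c) x * w x \<partial>lebesgue_on \<Omega>)"
    proof (rule integral_dominated_convergence[OF _ _ i3])
      show "(\<lambda>x. box_bump m a c x * w x) \<in> borel_measurable (lebesgue_on \<Omega>)" for m
        using test_function_L1_loc_integrable[OF box_bump_test_function[OF sub] \<open>open \<Omega>\<close> w, of m] by auto
      have "integrable (lebesgue_on \<Omega>) (\<lambda>x. indicator (box a c) x *\<^sub>R w x)"
        using i2 by (simp only: integrable_restrict_space[OF \<Omega>] eq)
      then show "(\<lambda>x. indicator (box a c) x * w x) \<in> borel_measurable (lebesgue_on \<Omega>)" by auto
      show "AE x in lebesgue_on \<Omega>. (\<lambda>m. box_bump m a c x * w x) \<longlonglongrightarrow> indicator (box a c) x * w x"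
        by (intro AE_I2 tendsto_intros box_bump_tendsto)
      show "AE x in lebesgue_on \<Omega>. norm (box_bump m a c x * w x) \<le> \<bar>indicator (cbox a c) x *\<^sub>R w x\<bar>" for m
      proof (rule AE_I2)
        fix x
        show "norm (box_bump m a c x * w x) \<le> \<bar>indicator (cbox a c) x *\<^sub>R w x\<bar>"
        proof (cases "x \<in> box a c")
          case True
          then have "x \<in> cbox a c" using box_subset_cbox by blast
          then show ?thesis
            using box_bump_bounds[of m a c x] by (simp add: abs_mult mult_left_le_one_le)
        qed (simp add: box_bump_eq_0)
      qed
    qed
    moreover have "(\<integral>x. box_bump m a c x * w x \<partial>lebesgue_on \<Omega>) = 0" for m
      by (rule zero[OF box_bump_test_function[OF sub]])
    ultimately have "(\<integral>x. indicator (box a c) x *\<^sub>R w x \<partial>lebesgue_on \<Omega>) = 0"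
      by (simp add: LIMSEQ_const_iff)
    then have "(\<integral>x. indicator (box a c) x *\<^sub>R w x \<partial>lebesgue) = 0"
      by (simp only: integral_restrict_space[OF \<Omega>] eq)
    then have "((\<lambda>x. indicator (box a c) x *\<^sub>R w x) has_integral 0) UNIV"
      using has_integral_integral_lebesgue[OF i2] by simp
    moreover have "(\<lambda>x. indicator (box a c) x *\<^sub>R w x) = (\<lambda>x. if x \<in> box a c then w x else 0)"
      by (auto simp: indicator_def)
    ultimately have "(w has_integral 0) (box a c)"
      by (simp add: has_integral_restrict_UNIV)
    then show ?thesis by (metis integral_open_interval integral_unique)
  qed
  obtain C :: "nat \<Rightarrow> 'a set" where C: "\<And>n. compact (C n)" "\<And>n. C n \<subseteq> \<Omega>"
    "\<And>n. C n \<subseteq> interior (C (Suc n))" "\<Union>(range C) = \<Omega>"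
    using open_Union_compact_subsets[OF \<open>open \<Omega>\<close>] by metis
  have "AE x in lebesgue. x \<in> C n \<longrightarrow> w x = 0" for n
  proof -
    \<comment> \<open>The indicator makes the function integrable on the whole space, as the
      differentiation theorem requires. Points of \<open>C n\<close> are interior to
      \<open>C (Suc n)\<close>, so small boxes at them do not meet the cut.\<close>
    define f where "f = (\<lambda>x. indicator (C (Suc n)) x *\<^sub>R w x)"
    have "integrable (lebesgue_on (C (Suc n))) w" using w C by (simp add: L1_loc_def)
    then have "integrable lebesgue f"
      unfolding f_def using C(1)
      by (subst (asm) integrable_restrict_space) (auto simp: lmeasurable_compact fmeasurableD)
    then have "f integrable_on UNIV"
      using has_integral_integral_lebesgue has_integral_integrable by blast
    then have "f integrable_on cbox a b" for a b
      by (rule integrable_on_subcbox) simp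
    then obtain N where N: "negligible N" "\<And>x e. \<lbrakk>x \<notin> N; 0 < e\<rbrakk> \<Longrightarrow>
        \<exists>d>0. \<forall>h. 0 < h \<and> h < d \<longrightarrow> norm (integral (cbox x (x + h *\<^sub>R One)) f /\<^sub>R h ^ DIM('a) - f x) < e"
      using integrable_ccontinuous_explicit[of f] by blast
    have "w x = 0" if x: "x \<in> C n" "x \<notin> N" for x
    proof (rule ccontr)
      assume "w x \<noteq> 0"
      have xi: "x \<in> interior (C (Suc n))" using C(3) x by blast
      then obtain r where r: "r > 0" "ball x r \<subseteq> C (Suc n)"
        by (meson mem_interior)
      have "f x = w x" using xi interior_subset by (force simp: f_def)
      with N(2)[OF x(2), of "\<bar>w x\<bar>"] \<open>w x \<noteq> 0\<close> obtain d where d: "d > 0"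
        "\<And>h. 0 < h \<and> h < d \<Longrightarrow> norm (integral (cbox x (x + h *\<^sub>R One)) f /\<^sub>R h ^ DIM('a) - w x) < \<bar>w x\<bar>"
        by auto
      \<comment> \<open>Points of a box with corner \<open>x\<close> and side \<open>h\<close> have
        l1 distance at most \<open>h * DIM('a)\<close> from \<open>x\<close>; the second term of the
        minimum keeps this below \<open>r\<close>, the first keeps \<open>h\<close> below
        \<open>d\<close>.\<close>
      define h where "h = min (d / 2) (r / (2 * DIM('a)))"
      have h: "0 < h" "h < d" "h * DIM('a) < r"
        using d(1) r(1) by (auto simp: h_def min_def field_simps)
      have sub: "cbox x (x + h *\<^sub>R One) \<subseteq> ball x r"
      proof
        fix y assume y: "y \<in> cbox x (x + h *\<^sub>R One)"
        have "norm (y - x) \<le> (\<Sum>b\<in>Basis. \<bar>(y - x) \<bullet> b\<bar>)" by (rule norm_le_l1)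
        also have "\<dots> \<le> (\<Sum>b\<in>(Basis::'a set). h)"
          using y by (intro sum_mono) (auto simp: mem_box inner_diff_left inner_add_left)
        also have "\<dots> = h * DIM('a)" by simp
        finally show "y \<in> ball x r" using h by (simp add: dist_norm norm_minus_commute)
      qed
      have "integral (cbox x (x + h *\<^sub>R One)) f = integral (cbox x (x + h *\<^sub>R One)) w"
        using sub r by (intro integral_cong) (auto simp: f_def indicator_def)
      also have "\<dots> = 0"
        using sub r C(2) by (intro box0) blast
      finally show False using d(2)[of h] h by simp
    qed
    then have "{x. \<not> (x \<in> C n \<longrightarrow> w x = 0)} \<subseteq> N" by blast
    then have "{x. \<not> (x \<in> C n \<longrightarrow> w x = 0)} \<in> null_sets lebesgue"
      using N(1) negligible_subset negligible_iff_null_sets by blast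
    then show ?thesis by (intro AE_I'[where N = "{x. \<not> (x \<in> C n \<longrightarrow> w x = 0)}"]) auto
  qed
  then have "AE x in lebesgue. \<forall>n. x \<in> C n \<longrightarrow> w x = 0"
    by (simp only: AE_all_countable simp_thms)
  then show ?thesis
    unfolding AE_restrict_space_iff[OF \<Omega>]
    by eventually_elim (use C(4) in blast)
qed

lemma weak_partial_unique:
  fixes u v v' :: "'a::euclidean_space \<Rightarrow> real"
  assumes "open \<Omega>" "has_weak_partial \<Omega> b u v" "has_weak_partial \<Omega> b u v'"
  shows "AE x in lebesgue_on \<Omega>. v x = v' x"
proof -
  have L: "v \<in> L1_loc \<Omega>" "v' \<in> L1_loc \<Omega>"
    using assms by (auto simp: has_weak_partial_def)
  then have "(\<lambda>x. v x - v' x) \<in> L1_loc \<Omega>"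
    by (auto simp: L1_loc_def)
  then have "AE x in lebesgue_on \<Omega>. v x - v' x = 0"
  proof (rule fundamental_lemma_calculus_of_variations[OF \<open>open \<Omega>\<close>])
    fix \<phi> assume \<phi>: "\<phi> \<in> test_functions \<Omega>"
    have "(\<integral>x. \<phi> x *\<^sub>R v x \<partial>lebesgue_on \<Omega>) = (\<integral>x. \<phi> x *\<^sub>R v' x \<partial>lebesgue_on \<Omega>)"
      using assms(2,3) \<phi> unfolding has_weak_partial_def by (metis neg_equal_iff_equal)
    then show "(\<integral>x. \<phi> x * (v x - v' x) \<partial>lebesgue_on \<Omega>) = 0"
      using test_function_L1_loc_integrable[OF \<phi> \<open>open \<Omega>\<close> L(1)]
        test_function_L1_loc_integrable[OF \<phi> \<open>open \<Omega>\<close> L(2)]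
      by (simp add: right_diff_distrib)
  qed
  then show ?thesis by eventually_elim simp
qed

text \<open>The choice made by \<open>weak_gradient\<close> asks only for local integrability.
  Uniqueness of weak partials identifies its components almost everywhere with the p-integrable ones
  supplied by \<open>W1p\<close>.\<close>

lemma weak_gradient_W1p:
  fixes u :: "'a::euclidean_space \<Rightarrow> real"
  assumes "open \<Omega>" "u \<in> W1p \<Omega> p" "p > 0"
  shows "has_weak_gradient \<Omega> u (weak_gradient \<Omega> u)"
    and "weak_gradient \<Omega> u \<in> Lp_space \<Omega> p"
proof -
  let ?G = "weak_gradient \<Omega> u"
  obtain v where v: "\<And>b. b \<in> Basis \<Longrightarrow> v b \<in> Lp_space \<Omega> p"
    "\<And>b. b \<in> Basis \<Longrightarrow> has_weak_partial \<Omega> b u (v b)"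
  proof -
    have "\<forall>b\<in>Basis. \<exists>v. v \<in> Lp_space \<Omega> p \<and> has_weak_partial \<Omega> b u v"
      using assms(2) by (auto simp: W1p_def)
    from bchoice[OF this] show ?thesis using that by blast
  qed
  have "has_weak_gradient \<Omega> u (\<lambda>x. \<Sum>b\<in>Basis. v b x *\<^sub>R b)"
    unfolding has_weak_gradient_def using v(2) by (simp add: inner_sum_left inner_Basis if_distrib cong: if_cong)
  then show G: "has_weak_gradient \<Omega> u ?G"
    unfolding weak_gradient_def by (rule someI[where P = "has_weak_gradient \<Omega> u"])
  then have Gb: "has_weak_partial \<Omega> b u (\<lambda>x. ?G x \<bullet> b)" if "b \<in> Basis" for b
    using that by (simp add: has_weak_gradient_def)
  have "(\<lambda>x. ?G x \<bullet> b) \<in> borel_measurable (lebesgue_on \<Omega>)" if "b \<in> Basis" for b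
    using Gb[OF that] unfolding has_weak_partial_def L1_loc_def by blast
  then have Gm [measurable]: "?G \<in> borel_measurable (lebesgue_on \<Omega>)"
    by (rule borel_measurable_euclidean_space[THEN iffD2, rule_format])
  have "AE x in lebesgue_on \<Omega>. \<forall>b\<in>Basis. ?G x \<bullet> b = v b x"
    using weak_partial_unique[OF \<open>open \<Omega>\<close> Gb v(2)] by (intro AE_finite_allI) auto
  then have bound: "AE x in lebesgue_on \<Omega>. norm (norm (?G x) powr p)
      \<le> norm (real DIM('a) powr p * (\<Sum>b\<in>Basis. norm (v b x) powr p))"
  proof eventually_elim
    case (elim x)
    \<comment> \<open>Comparing with the largest component, instead of expanding a power of a sum,
      gives a bound by the sum of the p-th powers for every positive p.\<close>
    have "Max ((\<lambda>b. \<bar>?G x \<bullet> b\<bar>) ` Basis) \<in> (\<lambda>b. \<bar>?G x \<bullet> b\<bar>) ` Basis"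
      by (rule Max_in) auto
    then obtain b where b: "b \<in> Basis" "Max ((\<lambda>b. \<bar>?G x \<bullet> b\<bar>) ` Basis) = \<bar>?G x \<bullet> b\<bar>"
      by blast
    have "norm (?G x) \<le> (\<Sum>b\<in>Basis. \<bar>?G x \<bullet> b\<bar>)" by (rule norm_le_l1)
    also have "\<dots> \<le> (\<Sum>i\<in>(Basis::'a set). \<bar>?G x \<bullet> b\<bar>)"
      by (intro sum_mono) (simp flip: b(2))
    also have "\<dots> = DIM('a) * norm (v b x)" using elim b(1) by simp
    finally have "norm (?G x) powr p \<le> (DIM('a) * norm (v b x)) powr p"
      using \<open>p > 0\<close> by (intro powr_mono2) auto
    also have "\<dots> = real DIM('a) powr p * norm (v b x) powr p" by (simp add: powr_mult)
    also have "norm (v b x) powr p \<le> (\<Sum>b\<in>Basis. norm (v b x) powr p)"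
      using b(1) by (intro member_le_sum) auto
    finally show ?case by (simp add: mult_left_mono sum_nonneg)
  qed
  have "integrable (lebesgue_on \<Omega>) (\<lambda>x. norm (?G x) powr p)"
  proof (rule Bochner_Integration.integrable_bound[OF _ _ bound])
    show "integrable (lebesgue_on \<Omega>) (\<lambda>x. real DIM('a) powr p * (\<Sum>b\<in>Basis. norm (v b x) powr p))"
      using v(1) unfolding Lp_space_def by (intro integrable_mult_right Bochner_Integration.integrable_sum) blast
  qed measurable
  then show "?G \<in> Lp_space \<Omega> p" using Gm by (simp add: Lp_space_def)
qed


section \<open>Radial functions in Lorentz spaces\<close>

text \<open>On the ball of radius \<open>\<rho>\<close> the function is almost everywhere at least
  \<open>g \<rho>\<close>, so its rearrangement is at least \<open>g \<rho>\<close> below the volume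
  of that ball. Evaluating the Lorentz norm with \<open>t\<close> equal to this volume gives the
  decay, since \<open>t\<close> is a multiple of the N-th power of \<open>\<rho>\<close>.\<close>

lemma lorentz_weak_radial_bound:
  fixes f :: "'a::euclidean_space \<Rightarrow> real"
  assumes "r > 0" and f: "f \<in> lorentz_weak (ball 0 R) r"
    and g: "antimono_on {0<..<R} g" "\<And>\<rho>. 0 < \<rho> \<Longrightarrow> \<rho> < R \<Longrightarrow> 0 \<le> g \<rho>"
    and fg: "AE x in lebesgue_on (ball 0 R). f x = g (norm x)"
  obtains K where "K \<ge> 0" "\<And>\<rho>. 0 < \<rho> \<Longrightarrow> \<rho> < R \<Longrightarrow> g \<rho> \<le> K * \<rho> powr (- (real DIM('a) / r))"
proof -
  let ?B = "ball 0 R :: 'a set"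
  have fm [measurable]: "f \<in> borel_measurable (lebesgue_on ?B)"
    and fin: "lorentz_weak_norm ?B r f < \<infinity>"
    using f by (auto simp: lorentz_weak_def)
  define L where "L = enn2real (lorentz_weak_norm ?B r f)"
  define V where "V = unit_ball_vol (real DIM('a))"
  have V: "V > 0" unfolding V_def by simp
  have AE: "AE x in lebesgue. x \<in> ?B \<longrightarrow> f x = g (norm x)"
    using fg by (subst (asm) AE_restrict_space_iff) auto
  have nz: "AE x::'a in lebesgue. x \<noteq> 0"
    using AE_lborel_singleton[of "0::'a"] by (rule AE_completion)
  have rearr_ge: "ennreal (g \<rho>) \<le> rearr ?B f s"
    if \<rho>: "0 < \<rho>" "\<rho> < R" and s: "s < V * \<rho> ^ DIM('a)" for \<rho> s
    unfolding rearr_def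
  proof (rule INF_greatest, clarify)
    fix \<tau> assume \<tau>: "0 \<le> \<tau>" "distr_fun ?B f \<tau> \<le> ennreal s"
    show "ennreal (g \<rho>) \<le> ennreal \<tau>"
    proof (rule ccontr)
      assume "\<not> ?thesis"
      then have less: "\<tau> < g \<rho>" by (meson ennreal_leI not_le)
      have meas: "{x\<in>?B. \<bar>f x\<bar> > \<tau>} \<in> sets lebesgue"
      proof -
        have "{x \<in> space (lebesgue_on ?B). \<bar>f x\<bar> > \<tau>} \<in> sets (lebesgue_on ?B)" by measurable
        then show ?thesis by (auto simp: sets_restrict_space_iff space_restrict_space)
      qed
      have "ennreal (V * \<rho> ^ DIM('a)) = emeasure lebesgue (ball (0::'a) \<rho>)"
        using \<rho> by (simp add: emeasure_ball V_def)
      also have "\<dots> \<le> emeasure lebesgue {x\<in>?B. \<bar>f x\<bar> > \<tau>}"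
      proof (rule emeasure_mono_AE[OF _ meas])
        show "AE x in lebesgue. x \<in> ball 0 \<rho> \<longrightarrow> x \<in> {x \<in> ?B. \<tau> < \<bar>f x\<bar>}"
          using AE nz
        proof eventually_elim
          case (elim x)
          show ?case
          proof
            assume x: "x \<in> ball 0 \<rho>"
            then have "g \<rho> \<le> g (norm x)"
              using g(1) elim \<rho> by (intro monotone_onD[OF g(1)]) auto
            then show "x \<in> {x \<in> ?B. \<tau> < \<bar>f x\<bar>}" using elim x \<rho> less by auto
          qed
        qed
      qed
      also have "\<dots> \<le> ennreal s" using \<tau> by (simp add: distr_fun_def)
      finally show False
        using ennreal_lessI[of "V * \<rho> ^ DIM('a)" s] s V \<rho> by (simp flip: not_less)
    qed
  qed
  have bound: "g \<rho> \<le> L * V powr (- (1 / r)) * \<rho> powr (- (real DIM('a) / r))" if \<rho>: "0 < \<rho>" "\<rho> < R" for \<rho>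
  proof -
    define t where "t = V * \<rho> ^ DIM('a)"
    have t: "t > 0" using V \<rho> by (simp add: t_def)
    have "ennreal (g \<rho>) = ennreal (1 / t) * (ennreal (g \<rho>) * ennreal t)"
      using t g(2)[OF \<rho>] by (simp add: ennreal_mult[symmetric])
    \<comment> \<open>The half-open interval keeps the strict inequality that
      \<open>rearr_ge\<close> demands, and its length is still \<open>t\<close>.\<close>
    also have "ennreal (g \<rho>) * ennreal t = (\<integral>\<^sup>+ s. ennreal (g \<rho>) * indicator {0..<t} s \<partial>lborel)"
      using t by (subst nn_integral_cmult_indicator) auto
    also have "\<dots> \<le> (\<integral>\<^sup>+ s\<in>{0..t}. rearr ?B f s \<partial>lborel)"
      by (intro nn_integral_mono) (auto simp: indicator_def t_def intro!: rearr_ge \<rho>)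
    finally have "ennreal (g \<rho>) \<le> max_rearr ?B f t"
      unfolding max_rearr_def by (simp add: mult_left_mono)
    then have "ennreal (t powr (1 / r)) * ennreal (g \<rho>) \<le> ennreal (t powr (1 / r)) * max_rearr ?B f t"
      by (intro mult_left_mono) auto
    also have "\<dots> \<le> lorentz_weak_norm ?B r f"
      unfolding lorentz_weak_norm_def using t by (intro SUP_upper) auto
    also have "\<dots> = ennreal L" using fin by (simp add: L_def)
    finally have "t powr (1 / r) * g \<rho> \<le> L"
      using g(2)[OF \<rho>] by (simp add: ennreal_mult[symmetric] L_def)
    then have "g \<rho> \<le> L * t powr (- (1 / r))"
      using t by (simp add: powr_minus field_simps)
    also have "t powr (- (1 / r)) = V powr (- (1 / r)) * \<rho> powr (- (real DIM('a) / r))"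
      using V \<rho> by (simp add: t_def powr_mult powr_powr flip: powr_realpow)
    finally show ?thesis by (simp add: mult.assoc)
  qed
  show ?thesis
    by (rule that[OF _ bound]) (use V in \<open>auto simp: L_def\<close>)
qed

text \<open>Dyadic shells replace polar coordinates. For a negative exponent the function is
  dominated by a series of constants times indicators of the balls of radius
  \<open>R / 2 ^ j\<close>; the integrals form a geometric series of ratio 2 powr (- e - N), which
  is below 1 exactly when e > - N.\<close>

lemma integrable_norm_powr:
  assumes e: "- real DIM('a::euclidean_space) < e"
  shows "integrable (lebesgue_on (ball 0 R)) (\<lambda>x::'a. norm x powr e)"
proof (cases "0 < R \<and> e < 0")
  case False
  have m: "(\<lambda>x::'a. norm x powr e) \<in> borel_measurable (lebesgue_on (ball 0 R))"
    by (rule measurable_restrict_space1, rule measurable_completion) measurable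
  show ?thesis
  proof (rule Bochner_Integration.integrable_bound[OF _ m])
    show "integrable (lebesgue_on (ball (0::'a) R)) (\<lambda>x. R powr e)"
      by (intro finite_measure.integrable_const finite_measure_lebesgue_on) simp
    show "AE x in lebesgue_on (ball (0::'a) R). norm (norm x powr e) \<le> norm (R powr e)"
      using False by (intro AE_I2) (auto simp: space_restrict_space intro!: powr_mono2 dest: le_less_trans[OF norm_ge_zero])
  qed
next
  case True
  then have R: "R > 0" and neg: "e < 0" by auto
  let ?N = "DIM('a)"
  define V where "V = unit_ball_vol (real ?N)"
  have V: "V \<ge> 0" unfolding V_def by simp
  \<comment> \<open>The value of the power at the inner radius of the j-th shell, which is its
    maximum on the shell because \<open>e\<close> is negative.\<close>
  define c where "c j = (R / 2 ^ Suc j) powr e" for j :: nat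
  have "(\<integral>\<^sup>+ x. ennreal (norm (indicator (ball 0 R) x *\<^sub>R norm (x::'a) powr e)) \<partial>lborel)
      \<le> (\<integral>\<^sup>+ x. (\<Sum>j. ennreal (c j) * indicator (ball 0 (R / 2 ^ j)) x) \<partial>(lborel :: 'a measure))"
  proof (rule nn_integral_mono)
    fix x :: 'a
    show "ennreal (norm (indicator (ball 0 R) x *\<^sub>R norm x powr e))
        \<le> (\<Sum>j. ennreal (c j) * indicator (ball 0 (R / 2 ^ j)) x)"
    proof (cases "x \<in> ball 0 R \<and> x \<noteq> 0")
      case x: True
      obtain n where "(1/2) ^ n < norm x / R"
        using real_arch_pow_inv[of "norm x / R" "1/2"] x R by auto
      then have ex: "R / 2 ^ n \<le> norm x" using R by (simp add: field_simps power_divide)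
      \<comment> \<open>Minimality puts \<open>x\<close> inside the ball with the preceding index,
        which exists because \<open>norm x < R\<close> excludes 0.\<close>
      define j where "j = (LEAST n. R / 2 ^ n \<le> norm x)"
      have j: "R / 2 ^ j \<le> norm x" unfolding j_def using ex by (rule LeastI[where P = "\<lambda>n. R / 2 ^ n \<le> norm x"])
      have "j \<noteq> 0" using j x by (auto intro: ccontr)
      then obtain i where i: "j = Suc i" using not0_implies_Suc by blast
      have "\<not> R / 2 ^ i \<le> norm x" by (rule not_less_Least) (simp add: j_def[symmetric] i)
      then have xi: "x \<in> ball 0 (R / 2 ^ i)" by simp
      have "norm x powr e \<le> c i"
        unfolding c_def using j i R neg by (intro powr_mono2') auto
      then have "ennreal (norm (indicator (ball 0 R) x *\<^sub>R norm x powr e))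
          \<le> (\<Sum>k\<in>{i}. ennreal (c k) * indicator (ball 0 (R / 2 ^ k)) x)"
        using x xi by (simp add: ennreal_leI)
      also have "\<dots> \<le> (\<Sum>j. ennreal (c j) * indicator (ball 0 (R / 2 ^ j)) x)"
        by (rule sum_le_suminf) auto
      finally show ?thesis .
    qed auto
  qed
  also have "\<dots> = (\<Sum>j. ennreal (c j) * emeasure lborel (ball (0::'a) (R / 2 ^ j)))"
    by (subst nn_integral_suminf)
      (auto simp: nn_integral_cmult_indicator intro!: borel_measurable_times_ennreal borel_measurable_indicator)
  also have "\<dots> = (\<Sum>j. ennreal ((R/2) powr e * V * R ^ ?N * (2 powr (- e - ?N)) ^ j))"
  proof (rule suminf_cong)
    fix j
    have "c j * (V * (R / 2 ^ j) ^ ?N) = (R/2) powr e * V * R ^ ?N * (2 powr (- e - ?N)) ^ j"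
    proof -
      have "c j = (R/2) powr e * (2 ^ j) powr (- e)"
        using R by (simp add: c_def powr_divide powr_mult powr_minus field_simps)
      also have "(2 ^ j) powr (- e) = (2::real) powr (- e * j)"
        by (simp add: powr_powr mult.commute flip: powr_realpow)
      finally have 1: "c j = (R/2) powr e * 2 powr (- e * j)" .
      have 2: "(R / 2 ^ j) ^ ?N = R ^ ?N * 2 powr (- (real ?N * j))"
      proof -
        have "2 powr (- (real ?N * j)) = 1 / (2::real) ^ (j * ?N)"
          by (simp add: powr_minus powr_realpow[symmetric] mult.commute divide_inverse)
        then show ?thesis by (simp add: power_divide power_mult)
      qed
      have 3: "(2 powr (- e - ?N)) ^ j = (2::real) powr (- e * j) * 2 powr (- (real ?N * j))"
        by (simp add: powr_realpow[symmetric] powr_powr powr_add[symmetric] algebra_simps)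
      show ?thesis unfolding 1 2 3 by simp
    qed
    then show "ennreal (c j) * emeasure lborel (ball (0::'a) (R / 2 ^ j))
        = ennreal ((R/2) powr e * V * R ^ ?N * (2 powr (- e - ?N)) ^ j)"
      using R V by (simp add: emeasure_ball V_def[symmetric] c_def ennreal_mult[symmetric])
  qed
  also have "\<dots> < \<infinity>"
  proof -
    have "2 powr (- e - ?N) < 2 powr (0::real)" using e by (intro powr_less_mono) auto
    then have "summable (\<lambda>j. (R/2) powr e * V * R ^ ?N * (2 powr (- e - ?N)) ^ j)"
      by (intro summable_mult summable_geometric) simp
    then show ?thesis using R V by (subst suminf_ennreal2) auto
  qed
  finally have fin: "(\<integral>\<^sup>+ x. ennreal (norm (indicator (ball 0 R) x *\<^sub>R norm (x::'a) powr e)) \<partial>lborel) < \<infinity>" .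
  have m: "(\<lambda>x::'a. indicator (ball 0 R) x *\<^sub>R norm x powr e) \<in> borel_measurable lborel"
    by (intro borel_measurable_scaleR borel_measurable_indicator) auto
  from fin have "integrable lborel (\<lambda>x::'a. indicator (ball 0 R) x *\<^sub>R norm x powr e)"
    by (intro integrableI_bounded m) auto
  then have "integrable lebesgue (\<lambda>x::'a. indicator (ball 0 R) x *\<^sub>R norm x powr e)"
    using m by (subst integrable_completion) auto
  then show ?thesis
    by (subst integrable_restrict_space) auto
qed


section \<open>Averages of a decreasing profile\<close>

text \<open>
  The exponent \<open>a\<close> will be \<open>N / r\<close>. In the notation of the introduction, \<open>avg \<rho> = h(\<rho>) / \<rho>\<close> and
  \<open>root_avg \<theta> \<rho> = h(\<rho>)\<^sup>\<theta> / \<rho>\<close>.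
\<close>

locale radial_profile =
  fixes g :: "real \<Rightarrow> real" and N :: nat and C a :: real
  assumes N: "0 < N" and a: "a < N"
    and antimono: "antimono_on {0<..} g"
    and nonneg: "0 < \<rho> \<Longrightarrow> 0 \<le> g \<rho>"
    and nonpos_arg: "\<rho> \<le> 0 \<Longrightarrow> g \<rho> = 0"
    and growth: "0 < \<rho> \<Longrightarrow> g \<rho> \<le> C * \<rho> powr (- a)"
begin

text \<open>Up to the area of the unit sphere, the integral of the radial source over the ball of
  radius \<open>\<rho>\<close>.\<close>

definition mass :: "real \<Rightarrow> real" where
  "mass \<rho> = integral {0..\<rho>} (\<lambda>s. g s * s ^ (N - 1))"

text \<open>This is 1 / N times the mean of the source over the ball. With this normalisation the
  field \<open>avg (norm x) *\<^sub>R x\<close> has the source as its divergence.\<close>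

definition avg :: "real \<Rightarrow> real" where
  "avg \<rho> = mass \<rho> / \<rho> ^ N"

lemma g_nonneg: "0 \<le> g \<rho>"
  using nonneg nonpos_arg by (cases "0 < \<rho>") auto

lemma C_nonneg: "0 \<le> C"
  using nonneg[of 1] growth[of 1] by simp

lemma mono_neg_g: "mono_on {0<..} (\<lambda>x. - g x)"
  using antimono by (auto simp: monotone_on_def)

lemma g_borel [measurable]: "g \<in> borel_measurable borel"
proof -
  have "(\<lambda>x. - g x) \<in> borel_measurable borel"
  proof (rule borel_measurable_piecewise_mono[of "{{0<..}, {..0}}"])
    fix c :: "real set" assume c: "c \<in> {{0<..}, {..0}}"
    then show "c \<in> sets borel" by auto
    show "mono_on c (\<lambda>x. - g x)"
      using c mono_neg_g nonpos_arg by (auto simp: monotone_on_def)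
  qed auto
  then show ?thesis by simp
qed

lemma discontinuities_countable: "countable {\<rho>\<in>{0<..}. \<not> isCont g \<rho>}"
proof -
  have "countable {\<rho>\<in>{0<..}. \<not> isCont (\<lambda>x. - g x) \<rho>}"
    by (rule mono_on_ctble_discont_open[OF _ mono_neg_g]) auto
  moreover have "isCont (\<lambda>x. - g x) \<rho> \<longleftrightarrow> isCont g \<rho>" for \<rho>
    using isCont_minus[of \<rho> g] isCont_minus[of \<rho> "\<lambda>x. - g x"] by auto
  ultimately show ?thesis by simp
qed

lemma integrand_le: "0 \<le> s \<Longrightarrow> g s * s ^ (N - 1) \<le> C * s powr (real N - 1 - a)"
proof (cases "s = 0")
  case False
  assume "0 \<le> s"
  with False have s: "0 < s" by simp
  have "g s * s ^ (N - 1) \<le> C * s powr (- a) * s ^ (N - 1)"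
    using growth[OF s] s by (intro mult_right_mono) auto
  also have "\<dots> = C * s powr (real N - 1 - a)"
    using s N by (simp add: powr_add[symmetric] of_nat_diff algebra_simps flip: powr_realpow)
  finally show ?thesis .
qed (simp add: nonpos_arg)

lemma integrand_nonneg: "0 \<le> s \<Longrightarrow> 0 \<le> g s * s ^ (N - 1)"
  using g_nonneg by simp

lemma majorant_integral:
  assumes "0 \<le> \<rho>"
  shows "((\<lambda>s. C * s powr (real N - 1 - a)) has_integral C * (\<rho> powr (N - a) / (N - a))) {0..\<rho>}"
  using has_integral_powr_from_0[of "real N - 1 - a" \<rho>] a assms
  by (intro has_integral_mult_right) simp

lemma integrand_integrable: "(\<lambda>s. g s * s ^ (N - 1)) integrable_on {0..\<rho>}"
proof (cases "0 \<le> \<rho>")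
  case True
  show ?thesis
  proof (rule measurable_bounded_by_integrable_imp_integrable)
    show "(\<lambda>s. g s * s ^ (N - 1)) \<in> borel_measurable (lebesgue_on {0..\<rho>})"
      by (rule measurable_restrict_space1, rule measurable_completion) measurable
    show "(\<lambda>s. C * s powr (real N - 1 - a)) integrable_on {0..\<rho>}"
      using majorant_integral[OF True] by (rule has_integral_integrable)
    show "norm (g s * s ^ (N - 1)) \<le> C * s powr (real N - 1 - a)" if "s \<in> {0..\<rho>}" for s
      using that integrand_le[of s] g_nonneg by (simp add: abs_mult)
  qed auto
qed (simp add: integrable_on_empty)

lemma mass_mono: "mono mass"
  unfolding mass_def mono_def
  by (intro allI impI integral_subset_le integrand_integrable) (use integrand_nonneg in auto)

lemma mass_nonneg: "0 \<le> mass \<rho>"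
  unfolding mass_def by (intro integral_nonneg integrand_integrable) (use integrand_nonneg in auto)

lemma mass_le: "0 \<le> \<rho> \<Longrightarrow> mass \<rho> \<le> C * (\<rho> powr (N - a) / (N - a))"
  unfolding mass_def
  using has_integral_le[OF integrable_integral[OF integrand_integrable] majorant_integral]
    integrand_le by simp

text \<open>A decreasing profile is bounded below on the interval by its value at the right end. All
  later control of g by its averages rests on this.\<close>

lemma mass_ge:
  assumes "0 < \<rho>"
  shows "g \<rho> * \<rho> ^ N / N \<le> mass \<rho>"
proof -
  have "((\<lambda>s. g \<rho> * s powr (real N - 1)) has_integral g \<rho> * (\<rho> powr N / N)) {0..\<rho>}"
    using has_integral_powr_from_0[of "real N - 1" \<rho>] N assms
    by (intro has_integral_mult_right) simp
  moreover have "g \<rho> * s powr (real N - 1) \<le> g s * s ^ (N - 1)" if "s \<in> {0..\<rho>}" for s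
  proof (cases "s = 0")
    case False
    with that assms have s: "0 < s" "s \<le> \<rho>" by auto
    then have "g \<rho> \<le> g s" using antimono assms by (auto simp: monotone_on_def)
    moreover have "s powr (real N - 1) = s ^ (N - 1)"
      using s N by (simp add: of_nat_diff flip: powr_realpow)
    ultimately show ?thesis using s by (simp add: mult_right_mono)
  qed (simp add: nonpos_arg)
  ultimately have "g \<rho> * (\<rho> powr N / N) \<le> mass \<rho>"
    unfolding mass_def
    by (rule has_integral_le[OF _ integrable_integral[OF integrand_integrable]])
  then show ?thesis using assms by (simp add: powr_realpow)
qed

lemma mass_isCont:
  assumes "0 < \<rho>"
  shows "isCont mass \<rho>"
proof -
  have "continuous_on {0..\<rho> + 1} mass"
    unfolding mass_def by (rule indefinite_integral_continuous_1[OF integrand_integrable])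
  then have "continuous_on {0<..<\<rho> + 1} mass"
    by (rule continuous_on_subset) auto
  then show ?thesis
    using assms by (simp add: continuous_on_eq_continuous_at)
qed

lemma mass_deriv:
  assumes "0 < \<rho>" "isCont g \<rho>"
  shows "(mass has_real_derivative g \<rho> * \<rho> ^ (N - 1)) (at \<rho>)"
proof -
  have "isCont (\<lambda>s. g s * s ^ (N - 1)) \<rho>"
    using assms by (intro continuous_intros)
  then have "((\<lambda>u. integral {0..u} (\<lambda>s. g s * s ^ (N - 1))) has_vector_derivative g \<rho> * \<rho> ^ (N - 1))
      (at \<rho> within ({0..\<rho> + 1} - {}))"
    using assms(1)
    by (intro integral_has_vector_derivative_continuous_at[OF integrand_integrable])
      (auto intro: continuous_at_imp_continuous_at_within)
  moreover have "at \<rho> within ({0..\<rho> + 1} - {}) = at \<rho>"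
    using assms(1) at_within_Icc_at[of 0 \<rho> "\<rho> + 1"] by simp
  ultimately show ?thesis
    unfolding mass_def has_real_derivative_iff_has_vector_derivative by simp
qed

lemma avg_borel [measurable]: "avg \<in> borel_measurable borel"
  using borel_measurable_mono[OF mass_mono] unfolding avg_def by measurable

lemma avg_nonneg: "0 < \<rho> \<Longrightarrow> 0 \<le> avg \<rho>"
  by (simp add: avg_def mass_nonneg)

lemma g_le_avg: "0 < \<rho> \<Longrightarrow> g \<rho> \<le> N * avg \<rho>"
  using mass_ge[of \<rho>] N by (simp add: avg_def field_simps)

lemma avg_le:
  assumes "0 < \<rho>"
  shows "avg \<rho> \<le> C / (N - a) * \<rho> powr (- a)"
proof -
  have "\<rho> powr (N - a) = \<rho> ^ N * \<rho> powr (- a)"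
    using assms by (simp add: powr_diff powr_minus powr_realpow field_simps)
  then show ?thesis
    using mass_le[of \<rho>] assms by (simp add: avg_def field_simps)
qed

lemma avg_isCont: "0 < \<rho> \<Longrightarrow> isCont avg \<rho>"
  unfolding avg_def by (intro continuous_intros mass_isCont) auto

lemma avg_deriv:
  assumes "0 < \<rho>" "isCont g \<rho>"
  shows "(avg has_real_derivative (g \<rho> - N * avg \<rho>) / \<rho>) (at \<rho>)"
proof -
  have N': "\<rho> ^ N = \<rho> * \<rho> ^ (N - 1)" using N by (metis power_eq_if not_gr_zero)
  have "((\<lambda>\<rho>. mass \<rho> / \<rho> ^ N) has_real_derivative
      (g \<rho> * \<rho> ^ (N - 1) * \<rho> ^ N - mass \<rho> * (real N * \<rho> ^ (N - 1))) / (\<rho> ^ N * \<rho> ^ N)) (at \<rho>)"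
    using assms by (auto intro!: derivative_eq_intros mass_deriv)
  moreover have "(g \<rho> * \<rho> ^ (N - 1) * \<rho> ^ N - mass \<rho> * (real N * \<rho> ^ (N - 1))) / (\<rho> ^ N * \<rho> ^ N)
      = (g \<rho> - N * avg \<rho>) / \<rho>"
    using assms(1) by (simp add: avg_def N' field_simps)
  ultimately show ?thesis unfolding avg_def by simp
qed

text \<open>Hence \<open>avg\<close> never reaches the point where \<open>t powr \<theta>\<close> with \<open>\<theta> < 1\<close> fails to be differentiable.\<close>

lemma avg_pos_or_zero: "(\<forall>\<rho>>0. 0 < avg \<rho>) \<or> (\<forall>\<rho>>0. avg \<rho> = 0)"
proof (rule disjCI)
  assume "\<not> (\<forall>\<rho>>0. avg \<rho> = 0)"
  show "\<forall>\<rho>>0. 0 < avg \<rho>"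
  proof (rule ccontr)
    assume "\<not> ?thesis"
    then obtain \<rho> where \<rho>: "0 < \<rho>" "avg \<rho> = 0" using avg_nonneg by force
    \<comment> \<open>A vanishing average at one radius spreads both ways: inwards because
      \<open>mass\<close> is nondecreasing and g is dominated by its average, outwards because g
      decreases.\<close>
    have g0: "g s = 0" if "0 < s" for s
    proof -
      have "avg s = 0 \<or> \<rho> \<le> s"
      proof (rule disjCI)
        assume "\<not> \<rho> \<le> s"
        then have "mass s \<le> mass \<rho>" using mass_mono by (simp add: mono_def)
        then show "avg s = 0" using \<rho> mass_nonneg[of s] by (simp add: avg_def)
      qed
      then show ?thesis
      proof
        assume "avg s = 0"
        then show ?thesis using g_le_avg[OF that] g_nonneg[of s] by simp
      next
        assume "\<rho> \<le> s"
        then have "g s \<le> g \<rho>" using antimono \<rho> that by (auto simp: monotone_on_def)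
        then show ?thesis using g_le_avg[OF \<rho>(1)] \<rho>(2) g_nonneg[of s] by simp
      qed
    qed
    then have "(\<lambda>s. g s * s ^ (N - 1)) = (\<lambda>s. 0)"
      using nonpos_arg by (metis mult_zero_left not_le)
    then have "avg \<rho> = 0" for \<rho> by (simp add: avg_def mass_def)
    with \<open>\<not> (\<forall>\<rho>>0. avg \<rho> = 0)\<close> show False by simp
  qed
qed

definition root_avg :: "real \<Rightarrow> real \<Rightarrow> real" where
  "root_avg \<theta> \<rho> = \<rho> powr (\<theta> - 1) * avg \<rho> powr \<theta>"

text \<open>The product rule for \<open>root_avg\<close> with the derivative from
  \<open>avg_deriv\<close> inserted. If \<open>avg\<close> vanishes, the convention that 0
  \<open>powr\<close> anything is 0 gives the value 0, which is then the true derivative.\<close>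

definition root_avg_deriv :: "real \<Rightarrow> real \<Rightarrow> real" where
  "root_avg_deriv \<theta> \<rho> = ((\<theta> - 1) * \<rho> powr (\<theta> - 1) * avg \<rho> powr \<theta>
     + \<theta> * \<rho> powr (\<theta> - 1) * avg \<rho> powr (\<theta> - 1) * (g \<rho> - N * avg \<rho>)) / \<rho>"

lemma root_avg_borel [measurable]: "root_avg \<theta> \<in> borel_measurable borel"
  unfolding root_avg_def by measurable

lemma root_avg_deriv_borel [measurable]: "root_avg_deriv \<theta> \<in> borel_measurable borel"
  unfolding root_avg_deriv_def by measurable

lemma root_avg_isCont:
  assumes "0 < \<rho>" "0 < \<theta>"
  shows "isCont (root_avg \<theta>) \<rho>"
  using avg_pos_or_zero
proof
  assume "\<forall>\<rho>>0. 0 < avg \<rho>"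
  then have "avg \<rho> \<noteq> 0" using assms by force
  then show ?thesis
    unfolding root_avg_def using assms by (intro continuous_intros avg_isCont) auto
next
  assume "\<forall>\<rho>>0. avg \<rho> = 0"
  then have "\<forall>\<^sub>F r in nhds \<rho>. root_avg \<theta> r = 0"
    using assms by (intro eventually_mono[OF eventually_nhds_in_open[of "{0<..}" \<rho>]]) (auto simp: root_avg_def)
  from isCont_cong[OF this] show ?thesis by simp
qed

lemma root_avg_has_deriv:
  assumes "0 < \<rho>" "isCont g \<rho>"
  shows "(root_avg \<theta> has_real_derivative root_avg_deriv \<theta> \<rho>) (at \<rho>)"
  using avg_pos_or_zero
proof
  assume "\<forall>\<rho>>0. 0 < avg \<rho>"
  then have pos: "0 < avg \<rho>" using assms by blast
  have 1: "((\<lambda>\<rho>. avg \<rho> powr \<theta>) has_real_derivative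
      \<theta> * avg \<rho> powr (\<theta> - 1) * ((g \<rho> - N * avg \<rho>) / \<rho>)) (at \<rho>)"
    by (rule DERIV_chain2[OF has_real_derivative_powr[OF pos] avg_deriv[OF assms]])
  have "\<rho> powr (\<theta> - 1 - 1) = \<rho> powr (\<theta> - 1) / \<rho>"
    using assms(1) powr_diff[of \<rho> "\<theta> - 1" 1] by simp
  with has_real_derivative_powr[OF assms(1), of "\<theta> - 1"]
  have 2: "((\<lambda>\<rho>. \<rho> powr (\<theta> - 1)) has_real_derivative (\<theta> - 1) * (\<rho> powr (\<theta> - 1) / \<rho>)) (at \<rho>)"
    by (simp only:)
  show ?thesis
    unfolding root_avg_def
    by (rule DERIV_cong[OF DERIV_mult[OF 2 1]]) (simp add: root_avg_deriv_def algebra_simps add_divide_distrib diff_divide_distrib)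
next
  assume 0: "\<forall>\<rho>>0. avg \<rho> = 0"
  have "((\<lambda>_. 0) has_real_derivative 0) (at \<rho>)" by simp
  moreover have "\<forall>\<^sub>F r in nhds \<rho>. 0 = root_avg \<theta> r"
    using assms 0
    by (intro eventually_mono[OF eventually_nhds_in_open[of "{0<..}" \<rho>]]) (auto simp: root_avg_def)
  ultimately have "(root_avg \<theta> has_real_derivative 0) (at \<rho>)"
    by (rule DERIV_cong_ev[THEN iffD1, OF refl _ refl, rotated])
  moreover have "root_avg_deriv \<theta> \<rho> = 0" using 0 assms by (simp add: root_avg_deriv_def)
  ultimately show ?thesis by simp
qed

text \<open>Since g lies between 0 and N times \<open>avg\<close>, the difference in the second term
  is at most N times \<open>avg\<close>, and this factor lifts the exponent \<theta> - 1 back to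
  \<theta>. For 0 < \<theta> \<le> 1 both coefficients have absolute value at most 1.\<close>

lemma root_avg_deriv_bound:
  assumes "0 < \<rho>" "0 < \<theta>" "\<theta> \<le> 1"
  shows "\<bar>\<rho> * root_avg_deriv \<theta> \<rho>\<bar> \<le> (N + 1) * root_avg \<theta> \<rho>"
proof -
  let ?k = "root_avg \<theta> \<rho>"
  have k: "0 \<le> ?k" by (simp add: root_avg_def)
  have "\<rho> * root_avg_deriv \<theta> \<rho> = (\<theta> - 1) * \<rho> powr (\<theta> - 1) * avg \<rho> powr \<theta>
      + \<theta> * \<rho> powr (\<theta> - 1) * avg \<rho> powr (\<theta> - 1) * (g \<rho> - N * avg \<rho>)"
    using assms(1) by (simp add: root_avg_deriv_def)
  then have "\<bar>\<rho> * root_avg_deriv \<theta> \<rho>\<bar> = \<bar>(\<theta> - 1) * ?k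
      + \<theta> * (\<rho> powr (\<theta> - 1) * avg \<rho> powr (\<theta> - 1) * (g \<rho> - N * avg \<rho>))\<bar>"
    by (simp only: root_avg_def mult.assoc)
  also have "\<dots> \<le> \<bar>\<theta> - 1\<bar> * ?k + \<bar>\<theta>\<bar> * (\<rho> powr (\<theta> - 1) * avg \<rho> powr (\<theta> - 1) * \<bar>g \<rho> - N * avg \<rho>\<bar>)"
    using k by (intro abs_triangle_ineq[THEN order_trans]) (simp add: abs_mult)
  also have "\<dots> \<le> 1 * ?k + 1 * (\<rho> powr (\<theta> - 1) * avg \<rho> powr (\<theta> - 1) * (N * avg \<rho>))"
    using assms k g_le_avg[OF assms(1)] g_nonneg[of \<rho>]
    by (intro add_mono mult_mono) (auto simp: abs_le_iff)
  also have "avg \<rho> powr (\<theta> - 1) * avg \<rho> = avg \<rho> powr \<theta>"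
    using avg_nonneg[OF assms(1)] by (cases "avg \<rho> = 0") (auto simp: powr_mult_base mult.commute)
  then have "\<rho> powr (\<theta> - 1) * avg \<rho> powr (\<theta> - 1) * (N * avg \<rho>) = N * ?k"
    by (simp add: root_avg_def algebra_simps)
  finally show ?thesis by (simp add: algebra_simps)
qed

end


section \<open>Monotonicity and duality\<close>

lemma sgn_idem: "sgn (sgn x) = sgn (x :: 'a::real_normed_vector)"
  by (simp add: sgn_div_norm[of "sgn x"] norm_sgn)

lemma inner_sgn_self: "sgn x \<bullet> x = norm (x :: 'a::real_inner)"
  by (cases "x = 0") (simp_all add: sgn_div_norm dot_square_norm power2_eq_square)

lemma H_eq_sgn: "H \<alpha> \<xi> = (max 0 (norm \<xi> - 1) powr \<alpha>) *\<^sub>R sgn \<xi>"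
  by (simp add: H_def sgn_div_norm)

lemma H_borel [measurable]: "H \<alpha> \<in> borel_measurable borel"
  unfolding H_def[abs_def] by measurable

lemma norm_H: "norm (H \<alpha> \<xi>) = max 0 (norm \<xi> - 1) powr \<alpha>"
  by (simp add: H_eq_sgn norm_sgn)

lemma norm_H_le: "0 \<le> \<alpha> \<Longrightarrow> norm (H \<alpha> \<xi>) \<le> norm \<xi> powr \<alpha>"
  unfolding norm_H by (intro powr_mono2) auto

text \<open>The product splits into a radial term, nonnegative because the modulus of
  \<open>H\<close> grows with the norm, and two angular terms, nonnegative by Cauchy-Schwarz.
  Equality can identify only the values of \<open>H\<close>, because \<open>H\<close> collapses the
  closed unit ball to 0.\<close>

lemma H_monotone:
  fixes \<xi> \<eta> :: "'a::euclidean_space"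
  assumes "0 < \<alpha>"
  shows "0 \<le> (H \<alpha> \<xi> - H \<alpha> \<eta>) \<bullet> (\<xi> - \<eta>)"
    and "(H \<alpha> \<xi> - H \<alpha> \<eta>) \<bullet> (\<xi> - \<eta>) = 0 \<Longrightarrow> H \<alpha> \<xi> = H \<alpha> \<eta>"
proof -
  define s where "s = norm \<xi>"
  define t where "t = norm \<eta>"
  define m where "m r = max 0 (r - 1) powr \<alpha>" for r :: real
  have m_nonneg: "0 \<le> m r" for r by (simp add: m_def)
  have mono: "m r \<le> m r'" if "r \<le> r'" for r r'
    unfolding m_def using that assms by (intro powr_mono2) auto
  have H: "H \<alpha> \<xi> = m s *\<^sub>R sgn \<xi>" "H \<alpha> \<eta> = m t *\<^sub>R sgn \<eta>"
    by (simp_all add: H_eq_sgn m_def s_def t_def)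
  have self: "sgn \<xi> \<bullet> \<xi> = s" "sgn \<eta> \<bullet> \<eta> = t"
    by (simp_all add: inner_sgn_self s_def t_def)
  have cross: "sgn \<xi> \<bullet> \<eta> \<le> t" "sgn \<eta> \<bullet> \<xi> \<le> s"
    using norm_cauchy_schwarz[of "sgn \<xi>" \<eta>] norm_cauchy_schwarz[of "sgn \<eta>" \<xi>]
    by (auto simp: norm_sgn s_def t_def split: if_splits)
  have split: "(H \<alpha> \<xi> - H \<alpha> \<eta>) \<bullet> (\<xi> - \<eta>)
      = (m s - m t) * (s - t) + m s * (t - sgn \<xi> \<bullet> \<eta>) + m t * (s - sgn \<eta> \<bullet> \<xi>)"
    unfolding H using self by (simp add: inner_diff_left inner_diff_right algebra_simps)
  have 1: "0 \<le> (m s - m t) * (s - t)"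
    using mono[of s t] mono[of t s] by (cases "s \<le> t") (auto simp: mult_nonneg_nonneg mult_nonpos_nonpos)
  have 2: "0 \<le> m s * (t - sgn \<xi> \<bullet> \<eta>)" "0 \<le> m t * (s - sgn \<eta> \<bullet> \<xi>)"
    using m_nonneg cross by auto
  show "0 \<le> (H \<alpha> \<xi> - H \<alpha> \<eta>) \<bullet> (\<xi> - \<eta>)"
    unfolding split using 1 2 by linarith
  assume "(H \<alpha> \<xi> - H \<alpha> \<eta>) \<bullet> (\<xi> - \<eta>) = 0"
  then have zero: "(m s - m t) * (s - t) = 0" "m s * (t - sgn \<xi> \<bullet> \<eta>) = 0"
    unfolding split using 1 2 by linarith+
  then have eq: "m s = m t" by auto
  show "H \<alpha> \<xi> = H \<alpha> \<eta>"
  proof (cases "m s = 0")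
    case False
    then have "\<xi> \<noteq> 0" "\<eta> \<noteq> 0" using eq by (auto simp: m_def s_def t_def)
    then have "norm (sgn \<xi>) = 1" "t > 0" by (simp_all add: norm_sgn t_def)
    \<comment> \<open>Equality in Cauchy-Schwarz: once the common modulus is nonzero, the two
      directions must agree.\<close>
    have "sgn \<xi> \<bullet> \<eta> = norm (sgn \<xi>) * norm \<eta>"
      using zero(2) False \<open>norm (sgn \<xi>) = 1\<close> by (simp add: t_def)
    then have "norm (sgn \<xi>) *\<^sub>R \<eta> = norm \<eta> *\<^sub>R sgn \<xi>"
      by (simp only: norm_cauchy_schwarz_eq)
    then have "\<eta> = t *\<^sub>R sgn \<xi>" using \<open>norm (sgn \<xi>) = 1\<close> by (simp add: t_def)
    then have "sgn \<eta> = sgn \<xi>"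
      using \<open>t > 0\<close> by (simp add: sgn_scaleR sgn_idem)
    then show ?thesis using H eq by simp
  qed (simp add: H flip: eq)
qed

text \<open>The quantity of interest is thus a function of the flux alone, so the gradient itself
  need not be known. On the closed unit ball, where \<open>H\<close> cannot be inverted, both sides
  are 0.\<close>

lemma H_half:
  assumes "1 < p"
  shows "H (p / 2) \<xi> = (norm (H (p - 1) \<xi>) powr (p / (2 * (p - 1)))) *\<^sub>R sgn (H (p - 1) \<xi>)"
proof (cases "max 0 (norm \<xi> - 1) = 0")
  case False
  then have pos: "max 0 (norm \<xi> - 1) > 0" by linarith
  have "(p - 1) * (p / (2 * (p - 1))) = p / 2" using assms by (simp add: field_simps)
  then have "norm (H (p - 1) \<xi>) powr (p / (2 * (p - 1))) = max 0 (norm \<xi> - 1) powr (p / 2)"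
    by (simp only: norm_H powr_powr)
  moreover have "sgn (H (p - 1) \<xi>) = sgn \<xi>"
    using pos by (simp add: H_eq_sgn sgn_scaleR sgn_idem)
  ultimately show ?thesis by (simp only: H_eq_sgn[of "p / 2"])
qed (simp add: H_eq_sgn)

section \<open>Elementary operations on Lp spaces and the duality pairing\<close>

lemma norm_add_powr_le:
  fixes x y :: "'a::real_normed_vector"
  assumes "0 \<le> q"
  shows "norm (x + y) powr q \<le> 2 powr q * (norm x powr q + norm y powr q)"
proof -
  have "norm (x + y) powr q \<le> (2 * max (norm x) (norm y)) powr q"
    using norm_triangle_ineq[of x y] assms by (intro powr_mono2) auto
  also have "\<dots> = 2 powr q * max (norm x) (norm y) powr q"
    by (simp add: powr_mult)
  also have "max (norm x) (norm y) powr q \<le> norm x powr q + norm y powr q"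
    by (simp add: max_def)
  finally show ?thesis by (simp add: mult_left_mono)
qed

lemma Lp_space_add:
  assumes "0 \<le> q" "A \<in> Lp_space \<Omega> q" "B \<in> Lp_space \<Omega> q"
  shows "(\<lambda>x. A x + B x) \<in> Lp_space \<Omega> q"
proof -
  have [measurable]: "A \<in> borel_measurable (lebesgue_on \<Omega>)" "B \<in> borel_measurable (lebesgue_on \<Omega>)"
    using assms by (auto simp: Lp_space_def)
  have "integrable (lebesgue_on \<Omega>) (\<lambda>x. norm (A x + B x) powr q)"
  proof (rule Bochner_Integration.integrable_bound)
    show "integrable (lebesgue_on \<Omega>) (\<lambda>x. 2 powr q * (norm (A x) powr q + norm (B x) powr q))"
      using assms unfolding Lp_space_def by (intro integrable_mult_right Bochner_Integration.integrable_add) auto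
    show "AE x in lebesgue_on \<Omega>. norm (norm (A x + B x) powr q)
        \<le> norm (2 powr q * (norm (A x) powr q + norm (B x) powr q))"
      using norm_add_powr_le[OF assms(1)] by (intro AE_I2) auto
  qed measurable
  then show ?thesis by (simp add: Lp_space_def)
qed

lemma Lp_space_uminus: "A \<in> Lp_space \<Omega> q \<Longrightarrow> (\<lambda>x. - A x) \<in> Lp_space \<Omega> q"
  by (simp add: Lp_space_def)

lemma Lp_space_diff:
  assumes "0 \<le> q" "A \<in> Lp_space \<Omega> q" "B \<in> Lp_space \<Omega> q"
  shows "(\<lambda>x. A x - B x) \<in> Lp_space \<Omega> q"
  using Lp_space_add[OF assms(1,2) Lp_space_uminus[OF assms(3)]] by simp

lemma Lp_space_bound:
  fixes A :: "'a::euclidean_space \<Rightarrow> 'b::euclidean_space"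
  assumes "A \<in> borel_measurable (lebesgue_on \<Omega>)" "integrable (lebesgue_on \<Omega>) B"
    and "\<And>x. x \<in> \<Omega> \<Longrightarrow> norm (A x) powr q \<le> B x"
  shows "A \<in> Lp_space \<Omega> q"
proof -
  have "integrable (lebesgue_on \<Omega>) (\<lambda>x. norm (A x) powr q)"
  proof (rule Bochner_Integration.integrable_bound[OF assms(2)])
    show "(\<lambda>x. norm (A x) powr q) \<in> borel_measurable (lebesgue_on \<Omega>)" using assms(1) by measurable
    show "AE x in lebesgue_on \<Omega>. norm (norm (A x) powr q) \<le> norm (B x)"
      using assms(3) by (intro AE_I2) (force simp: space_restrict_space)
  qed
  then show ?thesis using assms(1) by (simp add: Lp_space_def)
qed

lemma Lp_space_bounded_ball:
  fixes A :: "'a::euclidean_space \<Rightarrow> 'b::euclidean_space"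
  assumes "A \<in> borel_measurable (lebesgue_on (ball 0 R))" "0 \<le> q" "\<And>x. norm (A x) \<le> M"
  shows "A \<in> Lp_space (ball 0 R) q"
  using assms by (intro Lp_space_bound[where B = "\<lambda>_. M powr q"] powr_mono2
      finite_measure.integrable_const finite_measure_lebesgue_on) auto

text \<open>The free parameter makes the coefficient of one factor small at the expense of the
  other, which is enough for passing to limits in the duality pairing.\<close>

lemma Youngs_inequality_scaled:
  fixes p q \<epsilon> :: real
  assumes "p > 1" "q > 1" "1 / p + 1 / q = 1" "a \<ge> 0" "b \<ge> 0" "\<epsilon> > 0"
  shows "a * b \<le> \<epsilon> powr q * a powr q + \<epsilon> powr (- p) * b powr p"
proof -
  have "a * b = (\<epsilon> * a) * (b / \<epsilon>)" using assms by simp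
  also have "\<dots> \<le> (\<epsilon> * a) powr q / q + (b / \<epsilon>) powr p / p"
    using assms by (intro Youngs_inequality) (auto simp: add.commute)
  also have "\<dots> \<le> (\<epsilon> * a) powr q / 1 + (b / \<epsilon>) powr p / 1"
    using assms by (intro add_mono divide_left_mono) auto
  also have "\<dots> = \<epsilon> powr q * a powr q + \<epsilon> powr (- p) * b powr p"
    using assms by (simp add: powr_mult powr_divide powr_minus_divide)
  finally show ?thesis .
qed

context
  fixes p q :: real
  assumes conj: "p > 1" "q > 1" "1 / p + 1 / q = 1"
begin

lemma integrable_norm_mult_Lp:
  assumes "A \<in> Lp_space \<Omega> q" "D \<in> Lp_space \<Omega> p"
  shows "integrable (lebesgue_on \<Omega>) (\<lambda>x. norm (A x) * norm (D x))"
proof (rule Bochner_Integration.integrable_bound)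
  show "integrable (lebesgue_on \<Omega>) (\<lambda>x. norm (A x) powr q + norm (D x) powr p)"
    using assms by (auto simp: Lp_space_def)
  show "(\<lambda>x. norm (A x) * norm (D x)) \<in> borel_measurable (lebesgue_on \<Omega>)"
    using assms by (auto simp: Lp_space_def)
  show "AE x in lebesgue_on \<Omega>. norm (norm (A x) * norm (D x)) \<le> norm (norm (A x) powr q + norm (D x) powr p)"
    using Youngs_inequality_scaled[OF conj, of _ _ 1] by (intro AE_I2) auto
qed

lemma integrable_inner_Lp:
  fixes A D :: "'a::euclidean_space \<Rightarrow> 'b::euclidean_space"
  assumes "A \<in> Lp_space \<Omega> q" "D \<in> Lp_space \<Omega> p"
  shows "integrable (lebesgue_on \<Omega>) (\<lambda>x. A x \<bullet> D x)"
proof (rule Bochner_Integration.integrable_bound[OF integrable_norm_mult_Lp[OF assms]])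
  show "(\<lambda>x. A x \<bullet> D x) \<in> borel_measurable (lebesgue_on \<Omega>)"
    using assms by (auto simp: Lp_space_def)
qed (simp add: Cauchy_Schwarz_ineq2)

text \<open>The scaled Young inequality bounds the pairing by a term independent of
  \<open>k\<close>, made small by the choice of the parameter, plus a multiple of the integral that
  tends to 0.\<close>

lemma tendsto_integral_inner_Lp:
  fixes A :: "'a::euclidean_space \<Rightarrow> 'b::euclidean_space"
  assumes A: "A \<in> Lp_space \<Omega> q" and D: "\<And>k. D k \<in> Lp_space \<Omega> p"
    and lim: "(\<lambda>k. \<integral>x. norm (D k x) powr p \<partial>lebesgue_on \<Omega>) \<longlonglongrightarrow> 0"
  shows "(\<lambda>k. \<integral>x. A x \<bullet> D k x \<partial>lebesgue_on \<Omega>) \<longlonglongrightarrow> 0"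
proof (rule LIMSEQ_I)
  fix e :: real assume "0 < e"
  define S where "S = (\<integral>x. norm (A x) powr q \<partial>lebesgue_on \<Omega>)"
  have S: "0 \<le> S" unfolding S_def by simp
  \<comment> \<open>Solves \<epsilon> powr q * (S + 1) = e / 2; adding 1 avoids a division by zero
    when \<open>A\<close> vanishes.\<close>
  define \<epsilon> where "\<epsilon> = (e / (2 * (S + 1))) powr (1 / q)"
  have \<epsilon>: "\<epsilon> > 0" using S \<open>0 < e\<close> by (simp add: \<epsilon>_def)
  have "\<epsilon> powr q = e / (2 * (S + 1))" using S \<open>0 < e\<close> conj by (simp add: \<epsilon>_def powr_powr)
  then have \<epsilon>S: "\<epsilon> powr q * S < e / 2"
  proof -
    have "\<epsilon> powr q * S < \<epsilon> powr q * (S + 1)" using \<epsilon> by simp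
    also have "\<dots> = e / 2" using \<open>\<epsilon> powr q = e / (2 * (S + 1))\<close> S by (simp add: field_simps)
    finally show ?thesis .
  qed
  have bound: "\<bar>\<integral>x. A x \<bullet> D k x \<partial>lebesgue_on \<Omega>\<bar>
      \<le> \<epsilon> powr q * S + \<epsilon> powr (- p) * (\<integral>x. norm (D k x) powr p \<partial>lebesgue_on \<Omega>)" for k
  proof -
    have iA: "integrable (lebesgue_on \<Omega>) (\<lambda>x. \<epsilon> powr q * norm (A x) powr q)"
      and iD: "integrable (lebesgue_on \<Omega>) (\<lambda>x. \<epsilon> powr (- p) * norm (D k x) powr p)"
      using A D[of k] by (auto simp: Lp_space_def)
    have "\<bar>\<integral>x. A x \<bullet> D k x \<partial>lebesgue_on \<Omega>\<bar> \<le> (\<integral>x. \<bar>A x \<bullet> D k x\<bar> \<partial>lebesgue_on \<Omega>)"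
      by (rule integral_abs_bound)
    also have "\<dots> \<le> (\<integral>x. \<epsilon> powr q * norm (A x) powr q + \<epsilon> powr (- p) * norm (D k x) powr p \<partial>lebesgue_on \<Omega>)"
    proof (rule integral_mono)
      show "integrable (lebesgue_on \<Omega>) (\<lambda>x. \<bar>A x \<bullet> D k x\<bar>)"
        by (intro integrable_abs integrable_inner_Lp[OF A D])
      show "integrable (lebesgue_on \<Omega>) (\<lambda>x. \<epsilon> powr q * norm (A x) powr q + \<epsilon> powr (- p) * norm (D k x) powr p)"
        by (rule Bochner_Integration.integrable_add[OF iA iD])
      show "\<bar>A x \<bullet> D k x\<bar> \<le> \<epsilon> powr q * norm (A x) powr q + \<epsilon> powr (- p) * norm (D k x) powr p" for x
        using Cauchy_Schwarz_ineq2[of "A x" "D k x"]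
          Youngs_inequality_scaled[OF conj norm_ge_zero norm_ge_zero \<epsilon>, of "A x" "D k x"]
        by linarith
    qed
    also have "\<dots> = \<epsilon> powr q * S + \<epsilon> powr (- p) * (\<integral>x. norm (D k x) powr p \<partial>lebesgue_on \<Omega>)"
      using Bochner_Integration.integral_add[OF iA iD] by (simp add: S_def)
    finally show ?thesis .
  qed
  have "(\<lambda>k. \<epsilon> powr (- p) * (\<integral>x. norm (D k x) powr p \<partial>lebesgue_on \<Omega>)) \<longlonglongrightarrow> \<epsilon> powr (- p) * 0"
    by (intro tendsto_intros lim)
  then have "\<forall>\<^sub>F k in sequentially. \<epsilon> powr (- p) * (\<integral>x. norm (D k x) powr p \<partial>lebesgue_on \<Omega>) < e / 2"
    using \<open>0 < e\<close> by (intro order_tendstoD) auto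
  then obtain K where K: "\<And>k. k \<ge> K \<Longrightarrow> \<epsilon> powr (- p) * (\<integral>x. norm (D k x) powr p \<partial>lebesgue_on \<Omega>) < e / 2"
    unfolding eventually_sequentially by blast
  show "\<exists>K. \<forall>k\<ge>K. norm ((\<integral>x. A x \<bullet> D k x \<partial>lebesgue_on \<Omega>) - 0) < e"
  proof (intro exI[of _ K] allI impI)
    fix k assume "k \<ge> K"
    then show "norm ((\<integral>x. A x \<bullet> D k x \<partial>lebesgue_on \<Omega>) - 0) < e"
      using bound[of k] K[of k] \<epsilon>S by simp
  qed
qed

end

lemma gradient_inner: "gradient \<phi> x \<bullet> v = (\<Sum>b\<in>Basis. frechet_derivative \<phi> (at x) b * (v \<bullet> b))"
  by (simp add: gradient_def inner_sum_left) (simp add: inner_commute)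

lemma gradient_Lp_space:
  fixes \<phi> :: "'a::euclidean_space \<Rightarrow> real"
  assumes \<phi>: "\<phi> \<in> test_functions (ball 0 R)" and "0 \<le> p"
  shows "gradient \<phi> \<in> Lp_space (ball 0 R) p"
proof -
  have d: "(\<lambda>x. frechet_derivative \<phi> (at x) b) \<in> test_functions (ball 0 R)" if "b \<in> Basis" for b
    by (rule test_function_partial[OF \<phi> that])
  have "\<forall>b\<in>Basis. \<exists>M. \<forall>x. \<bar>frechet_derivative \<phi> (at x) b\<bar> \<le> M"
    using test_function_bounded[OF d] by metis
  from bchoice[OF this] obtain M where M: "\<And>b x. b \<in> Basis \<Longrightarrow> \<bar>frechet_derivative \<phi> (at x) b\<bar> \<le> M b"
    by blast
  have "norm (gradient \<phi> x) \<le> (\<Sum>b\<in>Basis. M b)" for x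
    unfolding gradient_def using M by (intro order_trans[OF norm_sum] sum_mono) auto
  moreover have "gradient \<phi> \<in> borel_measurable borel"
    unfolding gradient_def[abs_def]
    using d by (intro borel_measurable_sum borel_measurable_scaleR test_function_borel) auto
  ultimately show ?thesis
    using \<open>0 \<le> p\<close> by (intro Lp_space_bounded_ball measurable_lebesgue_on_borel)
qed


section \<open>Radial test functions\<close>

text \<open>The potential is a primitive of \<open>\<eta>\<close> evaluated at the squared norm.
  Using the square keeps it smooth at the origin and makes its gradient 2 \<open>\<eta>\<close>
  times the position vector.\<close>

lemma radial_test_function:
  assumes \<eta>: "smooth \<eta>" and "0 < R" "0 < \<delta>"
    and low: "\<And>\<tau>. \<tau> \<le> \<delta> \<Longrightarrow> \<eta> \<tau> = 0" and high: "\<And>\<tau>. R\<^sup>2 - \<delta> \<le> \<tau> \<Longrightarrow> \<eta> \<tau> = 0"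
  obtains \<phi> :: "'a::euclidean_space \<Rightarrow> real" where "\<phi> \<in> test_functions (ball 0 R)"
    "\<And>x b. frechet_derivative \<phi> (at x) b = 2 * \<eta> ((norm x)\<^sup>2) * (x \<bullet> b)"
proof -
  have cont: "continuous_on S \<eta>" for S by (rule smooth_continuous_on[OF \<eta>])
  then have int: "\<eta> integrable_on {u..v}" for u v by (rule integrable_continuous_interval)
  \<comment> \<open>Subtracting the full integral makes the primitive vanish from
    \<open>R\<^sup>2 - \<delta>\<close> on, which gives compact support inside the ball; near the
    origin it is a constant, in general nonzero.\<close>
  define \<psi> where "\<psi> \<tau> = integral {0..\<tau>} \<eta> - integral {0..R\<^sup>2} \<eta>" for \<tau>
  have deriv: "(\<psi> has_real_derivative \<eta> \<tau>) (at \<tau>)" for \<tau>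
  \<comment> \<open>For negative arguments the interval is empty and its integral is 0 by
    convention. As \<open>\<eta>\<close> vanishes up to \<open>\<delta>\<close>, the function
    \<open>\<psi>\<close> is constant below \<open>\<delta>\<close>, across 0 as well.\<close>
  proof (cases "\<tau> < \<delta>")
    case True
    have "((\<lambda>_. - integral {0..R\<^sup>2} \<eta>) has_real_derivative 0) (at \<tau>)" by simp
    moreover have "\<forall>\<^sub>F t in nhds \<tau>. - integral {0..R\<^sup>2} \<eta> = \<psi> t"
    proof (rule eventually_mono[OF eventually_nhds_in_open[of "{..<\<delta>}" \<tau>]])
      fix t assume "t \<in> {..<\<delta>}"
      then have "integral {0..t} \<eta> = integral {0..t} (\<lambda>_. 0)"
        using low by (intro integral_cong) auto
      then show "- integral {0..R\<^sup>2} \<eta> = \<psi> t" by (simp add: \<psi>_def)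
    qed (use True in auto)
    ultimately have "(\<psi> has_real_derivative 0) (at \<tau>)"
      by (rule DERIV_cong_ev[THEN iffD1, OF refl _ refl, rotated])
    then show ?thesis using low True by simp
  next
    case False
    then have "0 < \<tau>" using \<open>0 < \<delta>\<close> by simp
    then have "((\<lambda>t. integral {0..t} \<eta>) has_real_derivative \<eta> \<tau>) (at \<tau> within {0..\<tau> + 1})"
      by (intro integral_has_real_derivative cont) auto
    then have "((\<lambda>t. integral {0..t} \<eta>) has_real_derivative \<eta> \<tau>) (at \<tau>)"
      using \<open>0 < \<tau>\<close> at_within_Icc_at[of 0 \<tau> "\<tau> + 1"] by simp
    then show ?thesis unfolding \<psi>_def by (auto intro!: derivative_eq_intros)
  qed
  have \<psi>0: "\<psi> \<tau> = 0" if "0 \<le> \<tau>" "R\<^sup>2 - \<delta> \<le> \<tau>" for \<tau>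
  proof (cases "\<tau> \<le> R\<^sup>2")
    case True
    have "integral {\<tau>..R\<^sup>2} \<eta> = integral {\<tau>..R\<^sup>2} (\<lambda>_. 0)"
      using high that by (intro integral_cong) auto
    then show ?thesis
      using Henstock_Kurzweil_Integration.integral_combine[OF that(1) True int] by (simp add: \<psi>_def)
  next
    case False
    have "integral {R\<^sup>2..\<tau>} \<eta> = integral {R\<^sup>2..\<tau>} (\<lambda>_. 0)"
      using high \<open>0 < \<delta>\<close> by (intro integral_cong) auto
    then show ?thesis
      using Henstock_Kurzweil_Integration.integral_combine[of 0 "R\<^sup>2" \<tau> \<eta>, OF _ _ int] False by (simp add: \<psi>_def)
  qed
  define \<phi> :: "'a \<Rightarrow> real" where "\<phi> x = \<psi> ((norm x)\<^sup>2)" for x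
  have "smooth \<psi>" by (rule smooth_antiderivative[OF deriv \<eta>])
  then have smooth: "smooth \<phi>"
    unfolding \<phi>_def by (rule smooth_compose[OF _ smooth_square_norm])
  have sub: "closure {x. \<phi> x \<noteq> 0} \<subseteq> cball 0 (sqrt (max 0 (R\<^sup>2 - \<delta>)))"
  proof (rule closure_minimal)
    show "{x. \<phi> x \<noteq> 0} \<subseteq> cball 0 (sqrt (max 0 (R\<^sup>2 - \<delta>)))"
    proof
      fix x assume "x \<in> {x. \<phi> x \<noteq> 0}"
      then have "(norm x)\<^sup>2 \<le> R\<^sup>2 - \<delta>" using \<psi>0[of "(norm x)\<^sup>2"] by (force simp: \<phi>_def)
      then show "x \<in> cball 0 (sqrt (max 0 (R\<^sup>2 - \<delta>)))" by (simp add: real_le_rsqrt)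
    qed
  qed simp
  have "sqrt (max 0 (R\<^sup>2 - \<delta>)) < R"
    using \<open>0 < R\<close> \<open>0 < \<delta>\<close> by (intro real_less_lsqrt) auto
  then have "cball 0 (sqrt (max 0 (R\<^sup>2 - \<delta>))) \<subseteq> ball (0::'a) R" by auto
  moreover have "compact (closure {x. \<phi> x \<noteq> 0})"
    using sub by (metis closed_closure compact_Int_closed compact_cball inf.absorb_iff2)
  ultimately have test: "\<phi> \<in> test_functions (ball 0 R)"
    using smooth sub unfolding test_functions_def by (simp only: mem_Collect_eq) blast
  have "frechet_derivative \<phi> (at x) b = 2 * \<eta> ((norm x)\<^sup>2) * (x \<bullet> b)" for x b
  proof -
    have "((\<lambda>x::'a. (norm x)\<^sup>2) has_derivative (\<lambda>h. 2 * (x \<bullet> h))) (at x)"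
      unfolding power2_norm_eq_inner by (auto intro!: derivative_eq_intros simp: inner_commute)
    then have "(\<phi> has_derivative (\<lambda>h. \<eta> ((norm x)\<^sup>2) * (2 * (x \<bullet> h)))) (at x)"
      unfolding \<phi>_def using has_derivative_compose[OF _ deriv[unfolded has_field_derivative_def]] by blast
    then have "frechet_derivative \<phi> (at x) = (\<lambda>h. \<eta> ((norm x)\<^sup>2) * (2 * (x \<bullet> h)))"
      by (metis frechet_derivative_at)
    then show ?thesis by simp
  qed
  with test that show ?thesis by blast
qed

text \<open>Every radial field is formally a gradient, but \<open>\<kappa>\<close> is only
  continuous. It is therefore replaced by polynomials times smooth cutoffs, for which
  \<open>radial_test_function\<close> supplies genuine potentials, and dominated convergence passes
  to the limit.\<close>

lemma integral_inner_radial_eq_0: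
  fixes A :: "'a::euclidean_space \<Rightarrow> 'a" and \<kappa> :: "real \<Rightarrow> real"
  assumes conj: "p > 1" "q > 1" "1 / p + 1 / q = 1" and "0 < R"
    and A: "A \<in> Lp_space (ball 0 R) q"
    and zero: "\<And>\<phi>. \<phi> \<in> test_functions (ball 0 R) \<Longrightarrow> (\<integral>x. A x \<bullet> gradient \<phi> x \<partial>lebesgue_on (ball 0 R)) = 0"
    and \<kappa>: "continuous_on {0<..} \<kappa>" "\<And>\<tau>. 0 < \<tau> \<Longrightarrow> 0 \<le> \<kappa> \<tau>"
    and D: "(\<lambda>x::'a. \<kappa> ((norm x)\<^sup>2) *\<^sub>R x) \<in> Lp_space (ball 0 R) p"
  shows "(\<integral>x. A x \<bullet> (\<kappa> ((norm x)\<^sup>2) *\<^sub>R x) \<partial>lebesgue_on (ball 0 R)) = 0"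
proof -
  let ?B = "ball 0 R :: 'a set"
  have Am: "A \<in> borel_measurable (lebesgue_on ?B)" using A by (simp add: Lp_space_def)
  \<comment> \<open>\<open>\<kappa>\<close> may be unbounded near 0, so the approximation takes
    place on intervals that stay away from 0 and exhaust the positive numbers up to
    \<open>R\<^sup>2\<close>.\<close>
  have "\<exists>P. real_polynomial_function P \<and> (\<forall>\<tau>\<in>{1 / real (Suc n)..R\<^sup>2}. \<bar>\<kappa> \<tau> - P \<tau>\<bar> < 1 / real (Suc n))" for n
  proof -
    have "{1 / real (Suc n)..R\<^sup>2} \<subseteq> {0<..}"
      using less_le_trans[of 0 "1 / real (Suc n)"] by auto
    then have "continuous_on {1 / real (Suc n)..R\<^sup>2} \<kappa>"
      by (rule continuous_on_subset[OF \<kappa>(1)])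
    then obtain Q where "real_polynomial_function Q"
      "\<And>\<tau>. \<tau> \<in> {1 / real (Suc n)..R\<^sup>2} \<Longrightarrow> \<bar>\<kappa> \<tau> - Q \<tau>\<bar> < 1 / real (Suc n)"
      using Stone_Weierstrass_real_polynomial_function[of "{1 / real (Suc n)..R\<^sup>2}" \<kappa> "1 / real (Suc n)"]
        compact_Icc by (metis of_nat_0_less_iff zero_less_Suc zero_less_divide_1_iff)
    then show ?thesis by blast
  qed
  then obtain P where P: "\<And>n. real_polynomial_function (P n)"
    "\<And>n \<tau>. \<tau> \<in> {1 / real (Suc n)..R\<^sup>2} \<Longrightarrow> \<bar>\<kappa> \<tau> - P n \<tau>\<bar> < 1 / real (Suc n)"
    by metis
  \<comment> \<open>The shifts by 1 make the cutoff vanish within 1 / (n + 1) of either end. It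
    therefore removes the region near 0 where \<open>P n\<close> is not controlled, and it leaves
    room at the boundary for compact support.\<close>
  define cut where "cut n \<tau> = flat_exp (real (Suc n) * \<tau> - 1) * flat_exp (real (Suc n) * (R\<^sup>2 - \<tau>) - 1)" for n \<tau>
  have cut01: "0 \<le> cut n \<tau>" "cut n \<tau> \<le> 1" for n \<tau>
    unfolding cut_def by (auto intro!: mult_nonneg_nonneg mult_le_one flat_exp_bounds)
  have cut0: "cut n \<tau> = 0" if "\<tau> \<le> 1 / real (Suc n) \<or> R\<^sup>2 - 1 / real (Suc n) \<le> \<tau>" for n \<tau>
  proof -
    have "real (Suc n) * \<tau> \<le> 1 \<or> real (Suc n) * (R\<^sup>2 - \<tau>) \<le> 1"
      using that by (simp add: field_simps)
    then show ?thesis by (auto simp: cut_def)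
  qed
  have cut_lim: "(\<lambda>n. cut n \<tau>) \<longlonglongrightarrow> 1" if "0 < \<tau>" "\<tau> < R\<^sup>2" for \<tau>
  proof -
    have lim: "filterlim (\<lambda>n. real (Suc n) * t - 1) at_top sequentially" if "0 < t" for t
      using that by real_asymp
    have "(\<lambda>n. cut n \<tau>) \<longlonglongrightarrow> 1 * 1"
      unfolding cut_def using that by (intro tendsto_mult flat_exp_limit lim) auto
    then show ?thesis by simp
  qed
  define \<eta> where "\<eta> n \<tau> = cut n \<tau> * P n \<tau>" for n \<tau>
  have smooth_\<eta>: "smooth (\<eta> n)" for n
    unfolding \<eta>_def[abs_def] cut_def
    by (intro smooth_mult smooth_compose[OF smooth_flat_exp] smooth_diff smooth_const smooth_ident
        smooth_polynomial_function P)
  have \<eta>_bound: "\<bar>\<eta> n \<tau>\<bar> \<le> \<kappa> \<tau> + 1" if "0 < \<tau>" for n \<tau>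
  proof (cases "\<tau> \<in> {1 / real (Suc n)..R\<^sup>2}")
    case True
    have "1 / real (Suc n) \<le> 1" by simp
    then have "\<bar>P n \<tau>\<bar> \<le> \<kappa> \<tau> + 1" using P(2)[OF True] \<kappa>(2)[OF that] by linarith
    then show ?thesis
      using mult_mono[of "cut n \<tau>" 1 "\<bar>P n \<tau>\<bar>" "\<kappa> \<tau> + 1"] cut01[of n \<tau>] by (simp add: \<eta>_def abs_mult)
  next
    case False
    then have "\<tau> \<le> 1 / real (Suc n) \<or> R\<^sup>2 \<le> \<tau>" by auto
    moreover have "R\<^sup>2 - 1 / real (Suc n) \<le> R\<^sup>2" by simp
    ultimately have "cut n \<tau> = 0" by (meson cut0 order_trans)
    then show ?thesis using \<kappa>(2)[OF that] by (simp add: \<eta>_def)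
  qed
  have \<eta>_lim: "(\<lambda>n. \<eta> n \<tau>) \<longlonglongrightarrow> \<kappa> \<tau>" if "0 < \<tau>" "\<tau> < R\<^sup>2" for \<tau>
  proof -
    have "(\<lambda>n. P n \<tau> - \<kappa> \<tau>) \<longlonglongrightarrow> 0"
    proof (rule Lim_null_comparison)
      have "(\<lambda>n. 1 / real (Suc n)) \<longlonglongrightarrow> 0" by real_asymp
      then have "\<forall>\<^sub>F n in sequentially. 1 / real (Suc n) < \<tau>" using that by (intro order_tendstoD)
      then show "\<forall>\<^sub>F n in sequentially. norm (P n \<tau> - \<kappa> \<tau>) \<le> 1 / real (Suc n)"
      proof eventually_elim
        case (elim n)
        then show ?case using P(2)[of \<tau> n] that by (simp add: abs_minus_commute)
      qed
      show "(\<lambda>n. 1 / real (Suc n)) \<longlonglongrightarrow> 0" by fact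
    qed
    then have "(\<lambda>n. P n \<tau>) \<longlonglongrightarrow> \<kappa> \<tau>" by (simp add: LIM_zero_iff)
    then show ?thesis
      using tendsto_mult[OF cut_lim[OF that], of "\<lambda>n. P n \<tau>" "\<kappa> \<tau>"] by (simp add: \<eta>_def)
  qed
  have int0: "(\<integral>x. A x \<bullet> (\<eta> n ((norm x)\<^sup>2) *\<^sub>R x) \<partial>lebesgue_on ?B) = 0" for n
  proof -
    obtain \<phi> :: "'a \<Rightarrow> real" where \<phi>: "\<phi> \<in> test_functions ?B"
      "\<And>x b. frechet_derivative \<phi> (at x) b = 2 * \<eta> n ((norm x)\<^sup>2) * (x \<bullet> b)"
    proof (rule radial_test_function[OF smooth_\<eta>[of n] \<open>0 < R\<close>, of "1 / real (Suc n)"])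
      show "\<eta> n \<tau> = 0" if "\<tau> \<le> 1 / real (Suc n)" for \<tau>
        using cut0 that by (simp add: \<eta>_def)
      show "\<eta> n \<tau> = 0" if "R\<^sup>2 - 1 / real (Suc n) \<le> \<tau>" for \<tau>
        using cut0 that by (simp add: \<eta>_def)
    qed auto
    have grad: "gradient \<phi> x = 2 *\<^sub>R (\<eta> n ((norm x)\<^sup>2) *\<^sub>R x)" for x
    proof -
      have "gradient \<phi> x = (2 * \<eta> n ((norm x)\<^sup>2)) *\<^sub>R (\<Sum>b\<in>Basis. (x \<bullet> b) *\<^sub>R b)"
        by (simp add: gradient_def \<phi>(2) scaleR_sum_right)
      then show ?thesis by (simp add: euclidean_representation)
    qed
    have "2 * (\<integral>x. A x \<bullet> (\<eta> n ((norm x)\<^sup>2) *\<^sub>R x) \<partial>lebesgue_on ?B)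
        = (\<integral>x. A x \<bullet> gradient \<phi> x \<partial>lebesgue_on ?B)"
      unfolding grad by (subst integral_mult_right_zero[symmetric]) (simp only: inner_scaleR_right)
    then show ?thesis using zero[OF \<phi>(1)] by simp
  qed
  \<comment> \<open>The dominating function is the norm of \<open>A\<close> times
    (\<open>\<kappa>\<close> |x| + R), by \<open>\<eta>_bound\<close>; pairing with the constant 1
    makes its second term integrable.\<close>
  have one: "(\<lambda>_. 1 :: real) \<in> Lp_space ?B p"
    using conj by (intro Lp_space_bounded_ball[where M = 1]) auto
  have iA: "integrable (lebesgue_on ?B) (\<lambda>x. norm (A x) * R)"
    using integrable_norm_mult_Lp[OF conj A one] by simp
  have iAD: "integrable (lebesgue_on ?B) (\<lambda>x. norm (A x) * norm (\<kappa> ((norm x)\<^sup>2) *\<^sub>R x))"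
    by (rule integrable_norm_mult_Lp[OF conj A D])
  have "(\<lambda>n. \<integral>x. A x \<bullet> (\<eta> n ((norm x)\<^sup>2) *\<^sub>R x) \<partial>lebesgue_on ?B)
      \<longlonglongrightarrow> (\<integral>x. A x \<bullet> (\<kappa> ((norm x)\<^sup>2) *\<^sub>R x) \<partial>lebesgue_on ?B)"
  proof (rule integral_dominated_convergence[OF _ _ Bochner_Integration.integrable_add[OF iAD iA]])
    show "(\<lambda>x. A x \<bullet> (\<kappa> ((norm x)\<^sup>2) *\<^sub>R x)) \<in> borel_measurable (lebesgue_on ?B)"
      using D by (intro borel_measurable_inner Am) (simp add: Lp_space_def)
    show "(\<lambda>x. A x \<bullet> (\<eta> n ((norm x)\<^sup>2) *\<^sub>R x)) \<in> borel_measurable (lebesgue_on ?B)" for n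
    proof -
      have [measurable]: "\<eta> n \<in> borel_measurable borel"
        by (intro borel_measurable_continuous_onI smooth_continuous_on smooth_\<eta>)
      show ?thesis
        by (intro borel_measurable_inner Am measurable_lebesgue_on_borel) measurable
    qed
    show "AE x in lebesgue_on ?B. (\<lambda>n. A x \<bullet> (\<eta> n ((norm x)\<^sup>2) *\<^sub>R x)) \<longlonglongrightarrow> A x \<bullet> (\<kappa> ((norm x)\<^sup>2) *\<^sub>R x)"
    proof (rule AE_I2)
      fix x assume "x \<in> space (lebesgue_on ?B)"
      then have x: "norm x < R" by (simp add: space_restrict_space)
      show "(\<lambda>n. A x \<bullet> (\<eta> n ((norm x)\<^sup>2) *\<^sub>R x)) \<longlonglongrightarrow> A x \<bullet> (\<kappa> ((norm x)\<^sup>2) *\<^sub>R x)"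
      proof (cases "x = 0")
        case False
        then have "0 < (norm x)\<^sup>2" "(norm x)\<^sup>2 < R\<^sup>2"
          using x \<open>0 < R\<close> by (auto intro!: power_strict_mono)
        then show ?thesis by (intro tendsto_intros \<eta>_lim)
      qed simp
    qed
    show "AE x in lebesgue_on ?B. norm (A x \<bullet> (\<eta> n ((norm x)\<^sup>2) *\<^sub>R x))
        \<le> norm (A x) * norm (\<kappa> ((norm x)\<^sup>2) *\<^sub>R x) + norm (A x) * R" for n
    proof (rule AE_I2)
      fix x assume "x \<in> space (lebesgue_on ?B)"
      then have x: "norm x < R" by (simp add: space_restrict_space)
      show "norm (A x \<bullet> (\<eta> n ((norm x)\<^sup>2) *\<^sub>R x)) \<le> norm (A x) * norm (\<kappa> ((norm x)\<^sup>2) *\<^sub>R x) + norm (A x) * R"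
      proof (cases "x = 0")
        case False
        then have pos: "0 < (norm x)\<^sup>2" by simp
        have "norm (A x \<bullet> (\<eta> n ((norm x)\<^sup>2) *\<^sub>R x)) \<le> norm (A x) * (\<bar>\<eta> n ((norm x)\<^sup>2)\<bar> * norm x)"
          using Cauchy_Schwarz_ineq2[of "A x" "\<eta> n ((norm x)\<^sup>2) *\<^sub>R x"] by simp
        also have "\<dots> \<le> norm (A x) * (\<kappa> ((norm x)\<^sup>2) * norm x + R)"
        proof (rule mult_left_mono)
          have "\<bar>\<eta> n ((norm x)\<^sup>2)\<bar> * norm x \<le> (\<kappa> ((norm x)\<^sup>2) + 1) * norm x"
            by (intro mult_right_mono \<eta>_bound pos) auto
          then show "\<bar>\<eta> n ((norm x)\<^sup>2)\<bar> * norm x \<le> \<kappa> ((norm x)\<^sup>2) * norm x + R"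
            using x by (simp add: algebra_simps)
        qed simp
        finally show ?thesis using \<kappa>(2)[OF pos] by (simp add: algebra_simps)
      qed (use \<open>0 < R\<close> in simp)
    qed
  qed
  then show ?thesis unfolding int0 by (simp add: LIMSEQ_const_iff)
qed


section \<open>The flux of a weak solution\<close>

lemma AE_lebesgue_on_neq_0:
  assumes "\<Omega> \<in> sets lebesgue"
  shows "AE x::'a::euclidean_space in lebesgue_on \<Omega>. x \<noteq> 0"
proof -
  have "AE x::'a in lebesgue. x \<noteq> 0"
    using AE_lborel_singleton[of "0::'a"] by (rule AE_completion)
  then show ?thesis using assms by (subst AE_restrict_space_iff) auto
qed

section \<open>Invariance under changes on null sets\<close>

lemma Lp_space_cong_AE:
  assumes "A \<in> Lp_space \<Omega> q" "B \<in> borel_measurable (lebesgue_on \<Omega>)"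
    and "AE x in lebesgue_on \<Omega>. A x = B x"
  shows "B \<in> Lp_space \<Omega> q"
proof -
  have "integrable (lebesgue_on \<Omega>) (\<lambda>x. norm (A x) powr q)"
    and [measurable]: "A \<in> borel_measurable (lebesgue_on \<Omega>)"
    using assms(1) by (auto simp: Lp_space_def)
  moreover have "AE x in lebesgue_on \<Omega>. norm (A x) powr q = norm (B x) powr q"
    using assms(3) by eventually_elim simp
  ultimately have "integrable (lebesgue_on \<Omega>) (\<lambda>x. norm (B x) powr q)"
    using assms(2) by (subst (asm) integrable_cong_AE) auto
  then show ?thesis using assms(2) by (simp add: Lp_space_def)
qed

lemma L1_loc_cong_AE:
  fixes A B :: "'a::euclidean_space \<Rightarrow> 'b::euclidean_space"
  assumes "open \<Omega>" "A \<in> L1_loc \<Omega>" "B \<in> borel_measurable (lebesgue_on \<Omega>)"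
    and ae: "AE x in lebesgue_on \<Omega>. A x = B x"
  shows "B \<in> L1_loc \<Omega>"
  unfolding L1_loc_def
proof (intro CollectI conjI allI impI assms(3))
  fix K assume K: "compact K \<and> K \<subseteq> \<Omega>"
  then have int: "integrable (lebesgue_on K) A" using assms(2) by (simp add: L1_loc_def)
  have Kl: "K \<in> sets lebesgue" using K by (simp add: lmeasurable_compact fmeasurableD)
  have m: "B \<in> borel_measurable (lebesgue_on K)"
    using assms(3) K by (metis measurable_restrict_mono)
  have "AE x in lebesgue. x \<in> \<Omega> \<longrightarrow> A x = B x"
    using ae \<open>open \<Omega>\<close> by (subst (asm) AE_restrict_space_iff) auto
  then have "AE x in lebesgue_on K. A x = B x"
    using Kl K by (subst AE_restrict_space_iff) (auto elim!: eventually_mono)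
  then show "integrable (lebesgue_on K) B"
    using int m borel_measurable_integrable[OF int] by (subst (asm) integrable_cong_AE)
qed

lemma has_weak_partial_cong_AE:
  fixes u u' :: "'a::euclidean_space \<Rightarrow> 'b::euclidean_space"
  assumes "open \<Omega>" "has_weak_partial \<Omega> b u v" "u' \<in> borel_measurable (lebesgue_on \<Omega>)" "b \<in> Basis"
    and ae: "AE x in lebesgue_on \<Omega>. u x = u' x"
  shows "has_weak_partial \<Omega> b u' v"
proof -
  have u: "u \<in> L1_loc \<Omega>" "v \<in> L1_loc \<Omega>" using assms(2) by (simp_all add: has_weak_partial_def)
  then have um: "u \<in> borel_measurable (lebesgue_on \<Omega>)" by (simp add: L1_loc_def)
  have eq: "(\<integral>x. frechet_derivative \<phi> (at x) b *\<^sub>R u' x \<partial>lebesgue_on \<Omega>)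
      = (\<integral>x. frechet_derivative \<phi> (at x) b *\<^sub>R u x \<partial>lebesgue_on \<Omega>)" if "\<phi> \<in> test_functions \<Omega>" for \<phi>
  proof (rule integral_cong_AE)
    have d: "(\<lambda>x. frechet_derivative \<phi> (at x) b) \<in> borel_measurable (lebesgue_on \<Omega>)"
      by (rule measurable_lebesgue_on_borel[OF test_function_borel[OF test_function_partial[OF that \<open>b \<in> Basis\<close>]]])
    show "(\<lambda>x. frechet_derivative \<phi> (at x) b *\<^sub>R u x) \<in> borel_measurable (lebesgue_on \<Omega>)"
      "(\<lambda>x. frechet_derivative \<phi> (at x) b *\<^sub>R u' x) \<in> borel_measurable (lebesgue_on \<Omega>)"
      by (intro borel_measurable_scaleR d um assms(3))+
    show "AE x in lebesgue_on \<Omega>. frechet_derivative \<phi> (at x) b *\<^sub>R u' x = frechet_derivative \<phi> (at x) b *\<^sub>R u x"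
      using ae by eventually_elim simp
  qed
  show ?thesis
    unfolding has_weak_partial_def
    using L1_loc_cong_AE[OF assms(1) u(1) assms(3) ae] u(2) assms(2) eq
    by (simp add: has_weak_partial_def)
qed

lemma integral_sum_inner_Basis:
  fixes w :: "'a::euclidean_space \<Rightarrow> 'b \<Rightarrow> 'a"
  assumes "\<And>b. b \<in> Basis \<Longrightarrow> integrable M (w b)"
  shows "(\<integral>x. (\<Sum>b\<in>Basis. w b x \<bullet> b) \<partial>M) = (\<Sum>b\<in>Basis. (\<integral>x. w b x \<partial>M) \<bullet> b)"
proof -
  have "(\<integral>x. (\<Sum>b\<in>Basis. w b x \<bullet> b) \<partial>M) = (\<Sum>b\<in>Basis. \<integral>x. w b x \<bullet> b \<partial>M)"
    using assms by (intro Bochner_Integration.integral_sum integrable_inner_left)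
  also have "\<dots> = (\<Sum>b\<in>Basis. (\<integral>x. w b x \<partial>M) \<bullet> b)"
    using assms by (intro sum.cong integral_inner_left) auto
  finally show ?thesis .
qed

text \<open>
  The parameter \<open>ty\<close> only pins down the type of the points, and \<open>critical\<close> is the hypothesis on \<open>r\<close>
  expressed through \<open>a = N / r\<close>. Below, \<open>flux\<close> is \<open>F\<close>, \<open>field\<close> is \<open>V\<close> and \<open>root_flux\<close> is the field
  whose Sobolev regularity is claimed.
\<close>

locale radial_source = radial_profile g "DIM('a::euclidean_space)" C a
  for g :: "real \<Rightarrow> real" and C a :: real and ty :: "'a::euclidean_space itself" +
  fixes R p q :: real
  assumes dim: "DIM('a) \<ge> 2" and R: "0 < R"
    and conj: "p > 1" "q > 1" "1 / p + 1 / q = 1"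
    and critical: "q * (1 - a) - 2 > - real DIM('a)"
begin

abbreviation B :: "'a set" where "B \<equiv> ball 0 R"

definition flux :: "'a \<Rightarrow> 'a" where
  "flux x = - (avg (norm x) *\<^sub>R x)"

lemma conj_exponent: "p / (p - 1) = q"
  using conj by (simp add: field_simps)

definition K :: real where "K = C / (real DIM('a) - a)"

lemma K_nonneg: "0 \<le> K"
  using C_nonneg a by (simp add: K_def)

lemma avg_0 [simp]: "avg 0 = 0"
  by (simp add: avg_def N)

lemma avg_norm: "0 \<le> avg (norm x)" "avg (norm x) \<le> K * norm x powr (- a)" for x :: 'a
  using avg_nonneg[of "norm x"] avg_le[of "norm x"] by (cases "x = 0"; simp add: K_def)+

lemma avg_integrable: "integrable (lebesgue_on B) (\<lambda>x. avg (norm x))"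
proof (rule Bochner_Integration.integrable_bound)
  show "integrable (lebesgue_on B) (\<lambda>x. K * norm x powr (- a))"
    using a by (intro integrable_mult_right integrable_norm_powr) simp
  show "(\<lambda>x::'a. avg (norm x)) \<in> borel_measurable (lebesgue_on B)"
    by (rule measurable_lebesgue_on_borel) measurable
  show "AE x in lebesgue_on B. norm (avg (norm x)) \<le> norm (K * norm x powr (- a))"
    using avg_norm K_nonneg by (intro AE_I2) simp
qed

text \<open>The divergence of \<open>avg (norm x) *\<^sub>R x\<close> is N \<open>avg\<close> plus
  |x| times the derivative of \<open>avg\<close>, which \<open>avg_deriv\<close> reduces to g. The
  diagonal weak partials make this valid across the origin and the discontinuities of g.\<close>

lemma flux_identity:
  assumes \<phi>: "\<phi> \<in> test_functions B"
  shows "(\<integral>x. flux x \<bullet> gradient \<phi> x \<partial>lebesgue_on B) = (\<integral>x. g (norm x) * \<phi> x \<partial>lebesgue_on B)"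
proof -
  let ?u = "\<lambda>x::'a. avg (norm x) *\<^sub>R x"
  define k' where "k' \<rho> = (g \<rho> - DIM('a) * avg \<rho>) / \<rho>" for \<rho>
  define v where "v b x = avg (norm x) *\<^sub>R b + (k' (norm x) * (x \<bullet> b) / norm x) *\<^sub>R x" for b x :: 'a
  have [measurable]: "k' \<in> borel_measurable borel" unfolding k'_def by measurable
  have "integrable (lebesgue_on B) (\<lambda>x::'a. norm x * k' (norm x))"
  proof (rule Bochner_Integration.integrable_bound)
    show "integrable (lebesgue_on B) (\<lambda>x. DIM('a) * avg (norm x))"
      by (intro integrable_mult_right avg_integrable)
    show "(\<lambda>x::'a. norm x * k' (norm x)) \<in> borel_measurable (lebesgue_on B)"
      by (rule measurable_lebesgue_on_borel) measurable
    have "\<bar>norm x * k' (norm x)\<bar> \<le> \<bar>DIM('a) * avg (norm x)\<bar>" for x :: 'a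
    proof (cases "x = 0")
      case False
      then show ?thesis
        using g_le_avg[of "norm x"] g_nonneg[of "norm x"] avg_norm(1)[of x] by (simp add: k'_def)
    qed simp
    then show "AE x in lebesgue_on B. norm (norm x * k' (norm x)) \<le> norm (DIM('a) * avg (norm x))"
      by (intro AE_I2) simp
  qed
  note wp = radial_field_has_weak_partial[OF dim _ discontinuities_countable _ _ avg_borel _ avg_integrable this,
      folded v_def]
  have wp: "has_weak_partial B b ?u (v b)" "integrable (lebesgue_on B) ?u" "integrable (lebesgue_on B) (v b)"
    if "b \<in> Basis" for b
  proof -
    have "continuous_on {0<..} avg"
      by (intro continuous_at_imp_continuous_on) (auto intro: avg_isCont)
    moreover have "(avg has_real_derivative k' \<rho>) (at \<rho>)"
      if "0 < \<rho>" "\<rho> \<notin> {\<rho>\<in>{0<..}. \<not> isCont g \<rho>}" for \<rho>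
      unfolding k'_def using that by (intro avg_deriv) auto
    ultimately show "has_weak_partial B b ?u (v b)" "integrable (lebesgue_on B) ?u" "integrable (lebesgue_on B) (v b)"
      using wp[OF that] by auto
  qed
  obtain b0 :: 'a where "b0 \<in> Basis" using nonempty_Basis by blast
  note iu = wp(2)[OF this]
  let ?d = "\<lambda>b x. frechet_derivative \<phi> (at x) b"
  have int: "integrable (lebesgue_on B) (\<lambda>x. \<zeta> x *\<^sub>R w x)"
    if \<zeta>: "\<zeta> \<in> test_functions B" and w: "integrable (lebesgue_on B) w" for \<zeta> and w :: "'a \<Rightarrow> 'a"
  proof -
    obtain M where "\<And>x. \<bar>\<zeta> x\<bar> \<le> M" using test_function_bounded[OF \<zeta>] by blast
    then show ?thesis
      by (intro integrable_scaleR_bounded[OF w] measurable_lebesgue_on_borel test_function_borel[OF \<zeta>])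
  qed
  have id: "integrable (lebesgue_on B) (\<lambda>x. ?d b x *\<^sub>R ?u x)"
    and iv: "integrable (lebesgue_on B) (\<lambda>x. \<phi> x *\<^sub>R v b x)" if "b \<in> Basis" for b
    using int[OF test_function_partial[OF \<phi> that] iu] int[OF \<phi> wp(3)[OF that]] by auto
  have "(\<integral>x. ?u x \<bullet> gradient \<phi> x \<partial>lebesgue_on B)
      = (\<integral>x. (\<Sum>b\<in>Basis. (?d b x *\<^sub>R ?u x) \<bullet> b) \<partial>lebesgue_on B)"
    by (simp add: inner_commute[of _ "gradient _ _"] gradient_inner sum_distrib_left ac_simps)
  also have "\<dots> = (\<Sum>b\<in>Basis. (\<integral>x. ?d b x *\<^sub>R ?u x \<partial>lebesgue_on B) \<bullet> b)"
    by (rule integral_sum_inner_Basis[OF id])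
  also have "\<dots> = (\<Sum>b\<in>Basis. - (\<integral>x. \<phi> x *\<^sub>R v b x \<partial>lebesgue_on B) \<bullet> b)"
    using wp(1) \<phi> by (intro sum.cong) (auto simp: has_weak_partial_def)
  also have "\<dots> = - (\<integral>x. (\<Sum>b\<in>Basis. (\<phi> x *\<^sub>R v b x) \<bullet> b) \<partial>lebesgue_on B)"
    using integral_sum_inner_Basis[OF iv] by (simp only: inner_minus_left sum_negf)
  also have "(\<lambda>x. \<Sum>b\<in>Basis. (\<phi> x *\<^sub>R v b x) \<bullet> b) = (\<lambda>x. g (norm x) * \<phi> x)"
  proof
    fix x :: 'a
    have "(\<Sum>b\<in>Basis. v b x \<bullet> b) = DIM('a) * avg (norm x) + k' (norm x) / norm x * (\<Sum>b\<in>Basis. (x \<bullet> b) * (x \<bullet> b))"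
      by (simp add: v_def inner_add_left sum.distrib sum_distrib_left algebra_simps)
    also have "(\<Sum>b\<in>Basis. (x \<bullet> b) * (x \<bullet> b)) = norm x * norm x"
      by (metis dot_square_norm euclidean_inner power2_eq_square)
    also have "DIM('a) * avg (norm x) + k' (norm x) / norm x * (norm x * norm x) = g (norm x)"
      using nonpos_arg[of 0] by (cases "x = 0") (auto simp: k'_def)
    finally show "(\<Sum>b\<in>Basis. (\<phi> x *\<^sub>R v b x) \<bullet> b) = g (norm x) * \<phi> x"
      by (simp add: sum_distrib_left[symmetric] mult.commute)
  qed
  finally show ?thesis by (simp add: flux_def)
qed

lemma norm_flux_powr: "norm (flux x) powr q \<le> K powr q * norm x powr (q * (1 - a))"
proof -
  have "norm (flux x) \<le> K * norm x powr (- a) * norm x"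
    using avg_norm[of x] by (simp add: flux_def mult_right_mono)
  also have "\<dots> = K * norm x powr (1 - a)"
    by (cases "x = 0") (auto simp: powr_diff powr_minus divide_inverse)
  finally have "norm (flux x) powr q \<le> (K * norm x powr (1 - a)) powr q"
    using conj by (intro powr_mono2) auto
  then show ?thesis using K_nonneg by (simp add: powr_mult powr_powr mult.commute)
qed

lemma flux_borel [measurable]: "flux \<in> borel_measurable borel"
  unfolding flux_def by measurable

text \<open>The exponent needed here exceeds the one in \<open>critical\<close> by 2, so there is
  room to spare.\<close>

lemma flux_Lp: "flux \<in> Lp_space B q"
proof (rule Lp_space_bound)
  show "integrable (lebesgue_on B) (\<lambda>x. K powr q * norm x powr (q * (1 - a)))"
    using critical by (intro integrable_mult_right integrable_norm_powr) simp
qed (use norm_flux_powr measurable_lebesgue_on_borel[OF flux_borel] in auto)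

text \<open>On norms at least 1 this inverts the modulus of \<open>H (p - 1)\<close>. Where the flux
  is 0 it selects the norm 1 from the degenerate range, which keeps the formula continuous in the
  flux.\<close>

definition speed :: "real \<Rightarrow> real" where
  "speed \<rho> = 1 + (\<rho> * avg \<rho>) powr (1 / (p - 1))"

definition field :: "'a \<Rightarrow> 'a" where
  "field x = - (speed (norm x) *\<^sub>R sgn x)"

lemma field_borel [measurable]: "field \<in> borel_measurable borel"
  unfolding field_def speed_def sgn_div_norm by measurable

lemma norm_flux: "norm (flux x) = norm x * avg (norm x)"
  using avg_norm[of x] by (simp add: flux_def mult.commute)

lemma H_field: "H (p - 1) (field x) = flux x"
proof (cases "x = 0")
  case False
  let ?h = "norm x * avg (norm x)"
  have h: "0 \<le> ?h" using avg_norm[of x] by simp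
  have s: "0 < speed (norm x)" by (simp add: speed_def add_pos_nonneg)
  have "norm (field x) = speed (norm x)"
    using s False by (simp add: field_def norm_sgn)
  moreover have "sgn (field x) = - sgn x"
    using s False by (simp add: field_def sgn_scaleR sgn_minus sgn_idem)
  moreover have "max 0 (speed (norm x) - 1) powr (p - 1) = ?h"
    using h conj by (simp add: speed_def powr_powr)
  ultimately have "H (p - 1) (field x) = - (?h *\<^sub>R sgn x)" by (simp add: H_eq_sgn)
  also have "\<dots> = flux x" using False by (simp add: flux_def sgn_div_norm)
  finally show ?thesis .
qed (simp add: flux_def field_def H_eq_sgn)

text \<open>Apart from a bounded direction field, the norm is the power 1 / (p - 1) of the norm of
  the flux; its p-th power is the q-th power of the latter.\<close>

lemma field_Lp: "field \<in> Lp_space B p"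
proof -
  have 1: "(\<lambda>x::'a. sgn x) \<in> Lp_space B p"
  proof (rule Lp_space_bounded_ball[where M = 1])
    show "(\<lambda>x::'a. sgn x) \<in> borel_measurable (lebesgue_on B)"
      unfolding sgn_div_norm by (rule measurable_lebesgue_on_borel) measurable
  qed (use conj in \<open>auto simp: norm_sgn\<close>)
  have 2: "(\<lambda>x::'a. (norm x * avg (norm x)) powr (1 / (p - 1)) *\<^sub>R sgn x) \<in> Lp_space B p"
  proof (rule Lp_space_bound)
    show "(\<lambda>x::'a. (norm x * avg (norm x)) powr (1 / (p - 1)) *\<^sub>R sgn x) \<in> borel_measurable (lebesgue_on B)"
      unfolding sgn_div_norm by (rule measurable_lebesgue_on_borel) measurable
    show "integrable (lebesgue_on B) (\<lambda>x. norm (flux x) powr q)"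
      using flux_Lp by (simp add: Lp_space_def)
    fix x :: 'a
    have "norm ((norm x * avg (norm x)) powr (1 / (p - 1)) *\<^sub>R sgn x) \<le> norm (flux x) powr (1 / (p - 1))"
      by (simp add: norm_flux norm_sgn)
    then have "norm ((norm x * avg (norm x)) powr (1 / (p - 1)) *\<^sub>R sgn x) powr p
        \<le> (norm (flux x) powr (1 / (p - 1))) powr p"
      using conj by (intro powr_mono2) auto
    then show "norm ((norm x * avg (norm x)) powr (1 / (p - 1)) *\<^sub>R sgn x) powr p \<le> norm (flux x) powr q"
      by (simp add: powr_powr conj_exponent)
  qed
  have "field = (\<lambda>x. - (sgn x + (norm x * avg (norm x)) powr (1 / (p - 1)) *\<^sub>R sgn x))"
    by (simp add: field_def speed_def scaleR_add_left fun_eq_iff)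
  then show ?thesis using Lp_space_uminus[OF Lp_space_add[OF _ 1 2]] conj by simp
qed

theorem H_weak_gradient_eq_flux:
  assumes sol: "weak_solution R p f u"
    and f: "AE x in lebesgue_on B. f x = g (norm x)"
    and fm: "f \<in> borel_measurable (lebesgue_on B)"
  shows "AE x in lebesgue_on B. H (p - 1) (weak_gradient B u x) = flux x"
proof -
  let ?G = "weak_gradient B u"
  have u: "u \<in> W1p_0 B p"
    and eq: "\<And>\<phi>. \<phi> \<in> test_functions B \<Longrightarrow>
      (\<integral>x. H (p - 1) (?G x) \<bullet> gradient \<phi> x \<partial>lebesgue_on B) = (\<integral>x. f x * \<phi> x \<partial>lebesgue_on B)"
    using sol by (auto simp: weak_solution_def)
  have G: "?G \<in> Lp_space B p"
    using u conj by (intro weak_gradient_W1p) (auto simp: W1p_0_def)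
  then have Gm [measurable]: "?G \<in> borel_measurable (lebesgue_on B)" by (simp add: Lp_space_def)
  have HGm: "(\<lambda>x. H (p - 1) (?G x)) \<in> borel_measurable (lebesgue_on B)" by measurable
  have HG: "(\<lambda>x. H (p - 1) (?G x)) \<in> Lp_space B q"
  proof (rule Lp_space_bound[OF HGm])
    show "integrable (lebesgue_on B) (\<lambda>x. norm (?G x) powr p)" using G by (simp add: Lp_space_def)
    fix x
    have "norm (H (p - 1) (?G x)) powr q \<le> (norm (?G x) powr (p - 1)) powr q"
      using conj by (intro powr_mono2 norm_H_le) auto
    also have "(p - 1) * q = p" using conj by (simp add: field_simps)
    then have "(norm (?G x) powr (p - 1)) powr q = norm (?G x) powr p" by (simp add: powr_powr)
    finally show "norm (H (p - 1) (?G x)) powr q \<le> norm (?G x) powr p" .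
  qed
  define A where "A x = H (p - 1) (?G x) - flux x" for x
  have A: "A \<in> Lp_space B q"
    unfolding A_def using conj by (intro Lp_space_diff HG flux_Lp) auto
  have grad: "gradient \<phi> \<in> Lp_space B p" if "\<phi> \<in> test_functions B" for \<phi>
    using conj by (intro gradient_Lp_space that) auto
  have zero: "(\<integral>x. A x \<bullet> gradient \<phi> x \<partial>lebesgue_on B) = 0" if \<phi>: "\<phi> \<in> test_functions B" for \<phi>
  proof -
    have "(\<integral>x. A x \<bullet> gradient \<phi> x \<partial>lebesgue_on B) = (\<integral>x. f x * \<phi> x \<partial>lebesgue_on B) - (\<integral>x. g (norm x) * \<phi> x \<partial>lebesgue_on B)"
      unfolding A_def inner_diff_left
      using integrable_inner_Lp[OF conj HG grad[OF \<phi>]] integrable_inner_Lp[OF conj flux_Lp grad[OF \<phi>]]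
      by (simp add: eq[OF \<phi>] flux_identity[OF \<phi>])
    also have "(\<integral>x. f x * \<phi> x \<partial>lebesgue_on B) = (\<integral>x. g (norm x) * \<phi> x \<partial>lebesgue_on B)"
    proof (rule integral_cong_AE)
      have \<phi>m: "\<phi> \<in> borel_measurable (lebesgue_on B)"
        by (intro measurable_lebesgue_on_borel test_function_borel[OF \<phi>])
      have gm: "(\<lambda>x::'a. g (norm x)) \<in> borel_measurable (lebesgue_on B)"
        by (rule measurable_lebesgue_on_borel) measurable
      show "(\<lambda>x. f x * \<phi> x) \<in> borel_measurable (lebesgue_on B)"
        by (intro borel_measurable_times fm \<phi>m)
      show "(\<lambda>x. g (norm x) * \<phi> x) \<in> borel_measurable (lebesgue_on B)"
        by (intro borel_measurable_times gm \<phi>m)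
      show "AE x in lebesgue_on B. f x * \<phi> x = g (norm x) * \<phi> x"
        using f by eventually_elim simp
    qed
    finally show ?thesis by simp
  qed
  \<comment> \<open>The zero boundary condition is used here: the gradient is an Lp limit of
    gradients of test functions, so the orthogonality extends to it by continuity of the
    pairing.\<close>
  have AG: "(\<integral>x. A x \<bullet> ?G x \<partial>lebesgue_on B) = 0"
  proof -
    obtain \<phi> where \<phi>: "\<And>k. \<phi> k \<in> test_functions B"
      "(\<lambda>k. \<integral>x. norm (?G x - gradient (\<phi> k) x) powr p \<partial>lebesgue_on B) \<longlonglongrightarrow> 0"
      using u by (auto simp: W1p_0_def)
    have D: "(\<lambda>x. ?G x - gradient (\<phi> k) x) \<in> Lp_space B p" for k
      using conj by (intro Lp_space_diff G grad \<phi>) auto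
    have "(\<integral>x. A x \<bullet> (?G x - gradient (\<phi> k) x) \<partial>lebesgue_on B) = (\<integral>x. A x \<bullet> ?G x \<partial>lebesgue_on B)" for k
      unfolding inner_diff_right
      using integrable_inner_Lp[OF conj A G] integrable_inner_Lp[OF conj A grad[OF \<phi>(1)]]
      by (simp add: zero[OF \<phi>(1)])
    then show ?thesis
      using tendsto_integral_inner_Lp[OF conj A D \<phi>(2)] by (simp add: LIMSEQ_const_iff)
  qed
  have AV: "(\<integral>x. A x \<bullet> field x \<partial>lebesgue_on B) = 0"
  proof -
    \<comment> \<open>Dividing by the radius turns the direction field into a multiple of the
      position vector, and the square root expresses the factor through the squared norm, the form
      required by \<open>integral_inner_radial_eq_0\<close>.\<close>
    define \<kappa> where "\<kappa> \<tau> = speed (sqrt \<tau>) / sqrt \<tau>" for \<tau>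
    have field: "field x = - (\<kappa> ((norm x)\<^sup>2) *\<^sub>R x)" for x
      by (simp add: field_def \<kappa>_def sgn_div_norm divide_inverse)
    have "(\<integral>x. A x \<bullet> (\<kappa> ((norm x)\<^sup>2) *\<^sub>R x) \<partial>lebesgue_on B) = 0"
    proof (rule integral_inner_radial_eq_0[OF conj R A zero])
      show "continuous_on {0<..} \<kappa>"
      proof (intro continuous_at_imp_continuous_on ballI)
        fix \<tau> :: real assume \<tau>: "\<tau> \<in> {0<..}"
        have "isCont avg (sqrt \<tau>)" using \<tau> by (intro avg_isCont) simp
        then have avg: "isCont (\<lambda>\<tau>. avg (sqrt \<tau>)) \<tau>"
          by (intro isCont_o2[OF isCont_real_sqrt])
        \<comment> \<open>Continuity of \<open>powr\<close> is invoked only for a nonzero base; in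
          the other case of \<open>avg_pos_or_zero\<close> the expression is 0 near
          \<open>\<tau>\<close>.\<close>
        have powr: "isCont (\<lambda>\<tau>. (sqrt \<tau> * avg (sqrt \<tau>)) powr (1 / (p - 1))) \<tau>"
        proof (cases "\<forall>\<rho>>0. 0 < avg \<rho>")
          case True
          then have "sqrt \<tau> * avg (sqrt \<tau>) \<noteq> 0" using \<tau> by (metis greaterThan_iff less_irrefl mult_pos_pos real_sqrt_gt_0_iff)
          then show ?thesis using avg by (intro continuous_intros) auto
        next
          case False
          then have "\<forall>\<rho>>0. avg \<rho> = 0" using avg_pos_or_zero by blast
          then have "\<forall>\<^sub>F t in nhds \<tau>. (sqrt t * avg (sqrt t)) powr (1 / (p - 1)) = 0"
            using \<tau> by (intro eventually_mono[OF eventually_nhds_in_open[of "{0<..}" \<tau>]]) auto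
          from isCont_cong[OF this] show ?thesis by simp
        qed
        show "isCont \<kappa> \<tau>"
          unfolding \<kappa>_def speed_def using \<tau>
          by (intro isCont_divide isCont_add continuous_const powr isCont_real_sqrt) auto
      qed
      show "0 \<le> \<kappa> \<tau>" if "0 < \<tau>" for \<tau>
        using that unfolding \<kappa>_def speed_def by (intro divide_nonneg_pos add_nonneg_nonneg) auto
      have "(\<lambda>x. - field x) \<in> Lp_space B p" by (rule Lp_space_uminus[OF field_Lp])
      then show "(\<lambda>x. \<kappa> ((norm x)\<^sup>2) *\<^sub>R x) \<in> Lp_space B p" by (simp add: field)
    qed
    then show ?thesis by (simp add: field)
  qed
  \<comment> \<open>By \<open>H_field\<close> this is the monotonicity expression for
    \<open>H (p - 1)\<close> at the gradient and \<open>field\<close>: it is nonnegative and, by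
    \<open>AG\<close> and \<open>AV\<close>, has integral 0.\<close>
  let ?E = "\<lambda>x. A x \<bullet> (?G x - field x)"
  have "(\<integral>x. ?E x \<partial>lebesgue_on B) = 0"
    unfolding inner_diff_right
    using integrable_inner_Lp[OF conj A G] integrable_inner_Lp[OF conj A field_Lp] by (simp add: AG AV)
  moreover have E: "?E x = (H (p - 1) (?G x) - H (p - 1) (field x)) \<bullet> (?G x - field x)" for x
    by (simp add: A_def H_field)
  moreover have "integrable (lebesgue_on B) ?E"
    using conj by (intro integrable_inner_Lp[OF conj A] Lp_space_diff G field_Lp) auto
  ultimately have "AE x in lebesgue_on B. ?E x = 0"
    using H_monotone(1)[of "p - 1"] conj by (subst (asm) integral_nonneg_eq_0_iff_AE) auto
  then show ?thesis
  proof eventually_elim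
    case (elim x)
    then have "H (p - 1) (?G x) = H (p - 1) (field x)"
      unfolding E using conj by (intro H_monotone(2)) auto
    then show ?case by (simp add: H_field)
  qed
qed

end


section \<open>Sobolev regularity of the transformed flux\<close>

context radial_source
begin

definition root_flux :: "'a \<Rightarrow> 'a" where
  "root_flux x = - (root_avg (q / 2) (norm x) *\<^sub>R x)"

text \<open>Field and weak partials will both be bounded by multiples of
  \<open>root_avg (q / 2)\<close>, so this square is the only quantity to integrate. It is h to the
  power q divided by the squared radius, which explains the exponent in
  \<open>critical\<close>.\<close>

lemma root_avg_square:
  fixes x :: 'a
  shows "(root_avg (q / 2) (norm x))\<^sup>2 \<le> K powr q * norm x powr (q * (1 - a) - 2)"
proof (cases "x = 0")
  case False
  let ?\<rho> = "norm x"
  have "(root_avg (q / 2) ?\<rho>)\<^sup>2 = ?\<rho> powr (q - 2) * avg ?\<rho> powr q"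
    by (simp add: root_avg_def power_mult_distrib power2_eq_square algebra_simps flip: powr_add)
  also have "avg ?\<rho> powr q \<le> (K * ?\<rho> powr (- a)) powr q"
    using conj avg_norm by (intro powr_mono2) auto
  also have "(K * ?\<rho> powr (- a)) powr q = K powr q * ?\<rho> powr (- a * q)"
    using K_nonneg by (simp add: powr_mult powr_powr)
  finally have "(root_avg (q / 2) ?\<rho>)\<^sup>2 \<le> K powr q * (?\<rho> powr (q - 2) * ?\<rho> powr (- a * q))"
    by (simp add: mult_left_mono mult.left_commute)
  also have "?\<rho> powr (q - 2) * ?\<rho> powr (- a * q) = ?\<rho> powr (q * (1 - a) - 2)"
    by (simp add: algebra_simps flip: powr_add)
  finally show ?thesis .
qed (simp add: root_avg_def)

lemma root_avg_square_integrable: "integrable (lebesgue_on B) (\<lambda>x. (root_avg (q / 2) (norm x))\<^sup>2)"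
proof (rule Bochner_Integration.integrable_bound)
  show "integrable (lebesgue_on B) (\<lambda>x. K powr q * norm x powr (q * (1 - a) - 2))"
    using critical by (intro integrable_mult_right integrable_norm_powr)
  show "(\<lambda>x::'a. (root_avg (q / 2) (norm x))\<^sup>2) \<in> borel_measurable (lebesgue_on B)"
    by (rule measurable_lebesgue_on_borel) measurable
  show "AE x in lebesgue_on B. norm ((root_avg (q / 2) (norm x))\<^sup>2) \<le> norm (K powr q * norm x powr (q * (1 - a) - 2))"
    using root_avg_square by (intro AE_I2) auto
qed

lemma root_avg_nonneg: "0 \<le> root_avg \<theta> \<rho>"
  by (simp add: root_avg_def)

lemma norm_mult_root_avg_deriv:
  fixes x :: 'a
  assumes "q \<le> 2"
  shows "\<bar>norm x * root_avg_deriv (q / 2) (norm x)\<bar> \<le> (real DIM('a) + 1) * root_avg (q / 2) (norm x)"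
proof (cases "x = 0")
  case False
  then show ?thesis using root_avg_deriv_bound[of "norm x" "q / 2"] conj assms by (simp add: add.commute)
qed (simp add: root_avg_def)

lemma root_flux_borel [measurable]: "root_flux \<in> borel_measurable borel"
  unfolding root_flux_def by measurable

theorem root_flux_W1p:
  assumes "q \<le> 2"
  shows "root_flux \<in> W1p B 2"
proof -
  let ?k = "\<lambda>\<rho>. - root_avg (q / 2) \<rho>" and ?k' = "\<lambda>\<rho>. - root_avg_deriv (q / 2) \<rho>"
  let ?v = "\<lambda>b x::'a. ?k (norm x) *\<^sub>R b + (?k' (norm x) * (x \<bullet> b) / norm x) *\<^sub>R x"
  have km [measurable]: "?k \<in> borel_measurable borel" "?k' \<in> borel_measurable borel" by measurable
  \<comment> \<open>The ball has finite measure, so square integrability gives integrability through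
    |t| \<le> 1 + t^2.\<close>
  have ik: "integrable (lebesgue_on B) (\<lambda>x. ?k (norm x))"
  proof (rule Bochner_Integration.integrable_bound)
    show "integrable (lebesgue_on B) (\<lambda>x. 1 + (root_avg (q / 2) (norm x))\<^sup>2)"
      by (intro Bochner_Integration.integrable_add root_avg_square_integrable
          finite_measure.integrable_const finite_measure_lebesgue_on) simp
    show "(\<lambda>x::'a. ?k (norm x)) \<in> borel_measurable (lebesgue_on B)"
      by (rule measurable_lebesgue_on_borel) measurable
    have "\<bar>t\<bar> \<le> 1 + t\<^sup>2" for t :: real
    proof -
      have "0 \<le> (\<bar>t\<bar> - 1)\<^sup>2" by simp
      then show ?thesis unfolding power2_diff by simp
    qed
    then show "AE x in lebesgue_on B. norm (?k (norm x)) \<le> norm (1 + (root_avg (q / 2) (norm x))\<^sup>2)"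
      by (intro AE_I2) simp
  qed
  have ik': "integrable (lebesgue_on B) (\<lambda>x. norm x * ?k' (norm x))"
  proof (rule Bochner_Integration.integrable_bound)
    show "integrable (lebesgue_on B) (\<lambda>x. (real DIM('a) + 1) * ?k (norm x))"
      by (intro integrable_mult_right ik)
    show "(\<lambda>x::'a. norm x * ?k' (norm x)) \<in> borel_measurable (lebesgue_on B)"
      by (rule measurable_lebesgue_on_borel) measurable
    show "AE x in lebesgue_on B. norm (norm x * ?k' (norm x)) \<le> norm ((real DIM('a) + 1) * ?k (norm x))"
      using norm_mult_root_avg_deriv[OF assms] root_avg_nonneg by (intro AE_I2) (simp add: abs_mult)
  qed
  have cont: "continuous_on {0<..} ?k"
    using conj by (intro continuous_at_imp_continuous_on ballI continuous_minus root_avg_isCont) auto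
  have deriv: "(?k has_real_derivative ?k' \<rho>) (at \<rho>)"
    if "0 < \<rho>" "\<rho> \<notin> {\<rho>\<in>{0<..}. \<not> isCont g \<rho>}" for \<rho>
    using that by (intro DERIV_minus root_avg_has_deriv) auto
  have wp: "has_weak_partial B b root_flux (?v b)" if "b \<in> Basis" for b
    using radial_field_has_weak_partial(1)[OF dim that discontinuities_countable cont deriv km ik ik']
    by (simp add: root_flux_def[abs_def])
  have vm: "?v b \<in> borel_measurable (lebesgue_on B)" for b
    by (rule measurable_lebesgue_on_borel) measurable
  have v: "?v b \<in> Lp_space B 2" if "b \<in> Basis" for b
  proof (rule Lp_space_bound[OF vm])
    \<comment> \<open>Of the constant N + 2, the summand 1 comes from the factor multiplying
      \<open>b\<close> and N + 1 from the bound on its radial derivative.\<close>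
    show "integrable (lebesgue_on B) (\<lambda>x. (real DIM('a) + 2)\<^sup>2 * (root_avg (q / 2) (norm x))\<^sup>2)"
      by (intro integrable_mult_right root_avg_square_integrable)
    fix x :: 'a
    have "norm (?v b x) \<le> \<bar>?k (norm x)\<bar> + \<bar>norm x * ?k' (norm x)\<bar>"
      by (rule norm_radial_partial_le[OF that])
    also have "\<dots> \<le> (real DIM('a) + 2) * root_avg (q / 2) (norm x)"
      using norm_mult_root_avg_deriv[OF assms, of x] root_avg_nonneg by (simp add: algebra_simps)
    finally have "(norm (?v b x))\<^sup>2 \<le> ((real DIM('a) + 2) * root_avg (q / 2) (norm x))\<^sup>2"
      by (intro power_mono) auto
    then show "norm (?v b x) powr 2 \<le> (real DIM('a) + 2)\<^sup>2 * (root_avg (q / 2) (norm x))\<^sup>2"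
      by (simp only: power_mult_distrib powr_numeral norm_ge_zero)
  qed
  have "root_flux \<in> Lp_space B 2"
  proof (rule Lp_space_bound[OF measurable_lebesgue_on_borel[OF root_flux_borel]])
    show "integrable (lebesgue_on B) (\<lambda>x. R\<^sup>2 * (root_avg (q / 2) (norm x))\<^sup>2)"
      by (intro integrable_mult_right root_avg_square_integrable)
    fix x assume "x \<in> B"
    then have "(norm x)\<^sup>2 \<le> R\<^sup>2" by (intro power_mono) auto
    then show "norm (root_flux x) powr 2 \<le> R\<^sup>2 * (root_avg (q / 2) (norm x))\<^sup>2"
      using mult_right_mono[of "(norm x)\<^sup>2" "R\<^sup>2" "(root_avg (q / 2) (norm x))\<^sup>2"]
      by (simp add: root_flux_def power_mult_distrib mult.commute)
  qed
  then show ?thesis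
    unfolding W1p_def using wp v by blast
qed

lemma root_flux_eq: "norm (flux x) powr (p / (2 * (p - 1))) *\<^sub>R sgn (flux x) = root_flux x"
proof (cases "x = 0 \<or> avg (norm x) = 0")
  case True
  then show ?thesis by (auto simp: flux_def root_flux_def root_avg_def)
next
  case False
  then have pos: "0 < norm x" "0 < avg (norm x)" using avg_norm(1)[of x] by auto
  have \<theta>: "p / (2 * (p - 1)) = q / 2" by (simp only: conj_exponent[symmetric] divide_divide_eq_left mult.commute)
  have "sgn (flux x) = - sgn x"
    using pos by (simp add: flux_def sgn_scaleR sgn_minus)
  moreover have "norm (flux x) powr (q / 2) = root_avg (q / 2) (norm x) * norm x"
    using pos by (simp add: norm_flux root_avg_def powr_mult powr_diff)
  ultimately show ?thesis
    using pos unfolding \<theta> by (simp add: root_flux_def sgn_div_norm)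
qed

theorem H_half_weak_gradient_W1p:
  assumes sol: "weak_solution R p f u" and "q \<le> 2"
    and f: "AE x in lebesgue_on B. f x = g (norm x)"
    and fm: "f \<in> borel_measurable (lebesgue_on B)"
  shows "(\<lambda>x. H (p / 2) (weak_gradient B u x)) \<in> W1p B 2"
proof -
  let ?W = "\<lambda>x. H (p / 2) (weak_gradient B u x)"
  have "weak_gradient B u \<in> Lp_space B p"
    using sol conj by (intro weak_gradient_W1p) (auto simp: W1p_0_def weak_solution_def)
  then have [measurable]: "weak_gradient B u \<in> borel_measurable (lebesgue_on B)"
    by (simp add: Lp_space_def)
  have Wm: "?W \<in> borel_measurable (lebesgue_on B)" by measurable
  have ae: "AE x in lebesgue_on B. root_flux x = ?W x"
    using H_weak_gradient_eq_flux[OF sol f fm]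
  proof eventually_elim
    case (elim x)
    then show ?case by (simp only: H_half[OF conj(1)] root_flux_eq)
  qed
  have "root_flux \<in> W1p B 2" by (rule root_flux_W1p[OF \<open>q \<le> 2\<close>])
  then show ?thesis
    unfolding W1p_def
    using Lp_space_cong_AE[OF _ Wm ae] has_weak_partial_cong_AE[OF open_ball _ Wm _ ae] by blast
qed

end

text \<open>Monotonicity upgrades an almost everywhere bound to every radius: a negative value would
  persist on the whole open shell between \<open>\<rho>\<close> and \<open>R\<close>, which is not a
  null set.\<close>

lemma radially_decreasing_profile_nonneg:
  fixes f :: "'a::euclidean_space \<Rightarrow> real"
  assumes "AE x in lebesgue_on (ball 0 R). f x \<ge> 0"
    and "antimono_on {0<..<R} g" "AE x in lebesgue_on (ball 0 R). f x = g (norm x)"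
    and \<rho>: "0 < \<rho>" "\<rho> < R"
  shows "0 \<le> g \<rho>"
proof (rule ccontr)
  assume neg: "\<not> 0 \<le> g \<rho>"
  define S where "S = ball (0::'a) R - cball 0 \<rho>"
  have "open S" unfolding S_def by (simp add: open_Diff)
  have "AE x in lebesgue_on (ball 0 R). x \<notin> S"
    using assms(1,3) AE_space
  proof eventually_elim
    case (elim x)
    show ?case
    proof
      assume "x \<in> S"
      then have "g (norm x) \<le> g \<rho>"
        using \<rho> by (intro monotone_onD[OF assms(2)]) (auto simp: S_def)
      then show False using elim neg by simp
    qed
  qed
  then have "AE x in lebesgue. x \<in> ball 0 R \<longrightarrow> x \<notin> S"
    by (subst (asm) AE_restrict_space_iff) auto
  then have "AE x in lebesgue. x \<notin> S" by eventually_elim (auto simp: S_def)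
  then have "S \<in> null_sets lebesgue"
    using \<open>open S\<close> by (subst AE_iff_null_sets) auto
  moreover obtain b :: 'a where b: "b \<in> Basis" using nonempty_Basis by blast
  have "((\<rho> + R) / 2) *\<^sub>R b \<in> S" using \<rho> b by (simp add: S_def)
  then have "S \<noteq> {}" by blast
  ultimately show False
    using open_not_negligible[OF \<open>open S\<close>] by (simp add: negligible_iff_null_sets)
qed

theorem theorem1p4:
  fixes R p r :: real
    and f u :: "real ^ 'n::finite \<Rightarrow> real"
  assumes "CARD('n) \<ge> 2"
    and "R > 0"
    and "p \<ge> 2"
    and "r > real CARD('n) * p / (real CARD('n) * (p - 1) + (2 - p))"
    and "f \<in> lorentz_weak (ball 0 R) r"
    and "AE x in lebesgue_on (ball 0 R). f x \<ge> 0"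
    and "radially_decreasing R f"
    and "weak_solution R p f u"
  shows "(\<lambda>x. H (p / 2) (weak_gradient (ball 0 R) u x)) \<in> W1p (ball 0 R) 2"
proof -
  define N where "N = real CARD('n)"
  define a where "a = N / r"
  define q where "q = p / (p - 1)"
  have N: "N \<ge> 2" using assms(1) by (simp add: N_def)
  have "2 * (p - 1) \<le> N * (p - 1)" using N assms(3) by (intro mult_right_mono) auto
  then have den: "N * (p - 1) + (2 - p) > 0" using assms(3) by simp
  have "0 \<le> N * p / (N * (p - 1) + (2 - p))" using N den assms(3) by simp
  then have r: "r > 0" using assms(4) by (simp add: N_def)
  \<comment> \<open>The hypothesis on \<open>r\<close> with denominators cleared; dividing by p - 1
    and rearranging gives \<open>critical\<close>.\<close>
  have pa: "p * a < N * (p - 1) + (2 - p)"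
    using assms(4) den r by (simp add: a_def N_def[symmetric] field_simps)
  \<comment> \<open>As N + p \<ge> 2, the same hypothesis also yields a < N, which makes the source
    integrable at the origin.\<close>
  have "N * (p - 1) + (2 - p) \<le> N * p" using N assms(3) by (simp add: right_diff_distrib)
  with pa have "p * a < p * N" by (simp only: mult.commute[of p N])
  then have a: "a < N" using assms(3) by simp
  have critical: "q * (1 - a) - 2 > - N"
    using pa assms(3) by (simp add: q_def field_simps)
  have q: "1 < q" "1 / p + 1 / q = 1" "q \<le> 2"
    using assms(3) by (auto simp: q_def field_simps)
  obtain g0 where g0: "antimono_on {0<..<R} g0" "AE x in lebesgue_on (ball 0 R). f x = g0 (norm x)"
    using assms(7) by (auto simp: radially_decreasing_def)
  have nonneg: "0 \<le> g0 \<rho>" if "0 < \<rho>" "\<rho> < R" for \<rho>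
    by (rule radially_decreasing_profile_nonneg[OF assms(6) g0 that])
  obtain C where C: "C \<ge> 0" "\<And>\<rho>. 0 < \<rho> \<Longrightarrow> \<rho> < R \<Longrightarrow> g0 \<rho> \<le> C * \<rho> powr (- a)"
    using lorentz_weak_radial_bound[OF r assms(5) g0(1) nonneg g0(2)] by (auto simp: a_def N_def)
  \<comment> \<open>Extension by 0 beyond \<open>R\<close> remains decreasing on the half-line
    because \<open>g0\<close> is nonnegative.\<close>
  define g where "g \<rho> = (if 0 < \<rho> \<and> \<rho> < R then g0 \<rho> else 0)" for \<rho>
  interpret radial_source g C a "TYPE(real ^ 'n)" R p q
  proof
    show "antimono_on {0<..} g"
      using g0(1) nonneg by (auto simp: monotone_on_def g_def)
    show "g \<rho> \<le> C * \<rho> powr (- a)" if "0 < \<rho>" for \<rho>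
      using C that by (simp add: g_def)
  qed (use assms(1-3) a nonneg q critical in \<open>auto simp: g_def N_def\<close>)
  \<comment> \<open>The origin has to be excluded: \<open>g 0\<close> is 0 by definition, unrelated
    to the values of \<open>f\<close> and \<open>g0\<close> there.\<close>
  have "AE x :: real ^ 'n in lebesgue_on (ball 0 R). x \<noteq> 0"
    by (rule AE_lebesgue_on_neq_0) simp
  then have "AE x in lebesgue_on (ball 0 R). f x = g (norm x)"
    using g0(2) AE_space
    by eventually_elim (auto simp: g_def space_restrict_space)
  then show ?thesis
    using assms(5,8) q by (intro H_half_weak_gradient_W1p) (auto simp: lorentz_weak_def)
qed

end
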